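(* If $(\mathbf{C},\mathcal{M})$ is a small geometric $\mathcal{M}$-category, then the $\mathcal{M}$-category $\mathsf{Sh}_{\mathcal{M}}(\mathbf{C})=(\mathsf{Sh}(\mathbf{C}),\mathcal{M}_{\mathsf{Sh}(\mathbf{C})})$ is also geometric.
   Context: All categories are locally small unless stated otherwise; families are indexed by sets. Restriction categories. A restriction category is a category $\mathbf{X}$ with an assignment $f\mapsto \bar f$, $\mathbf{X}(A,B)\to\mathbf{X}(A,A)$, satisfying, for suitable maps, (R1) $f\bar f=f$; (R2) $\bar g\bar f=\bar f\bar g$; (R3) $\overline{g\bar f}=\bar g\bar f$; (R4) $\bar h f=f\,\overline{hf}$. Hom-sets are partially ordered by $f\le g$ iff $f=g\bar f$. Maps $f,g\in\mathbf{X}(A,B)$ are compatible if $f\bar g=g\bar f$; a set of parallel maps is compatible if its elements are pairwise compatible. A join restriction category is a restriction category in which every compatible set $S\subset\mathbf{X}(A,B)$ has a join $\bigvee_{s\in S}s$ in the poset $\mathbf{X}(A,B)$ satisfying (J1) $\overline{\bigvee_{s\in S}s}=\bigvee_{s\in S}\bar s$ and (J2) $(\bigvee_{s\in S}s)\circ g=\bigvee_{s\in S}(s\circ g)$. $\mathcal{M}$-categories. An $\mathcal{M}$-category $(\mathbf{C},\mathcal{M})$ is a category $\mathbf{C}$ with a family $\mathcal{M}$ of monics containing all isomorphisms, closed under composition, and such that the pullback of any $m\in\mathcal{M}$ along any map exists and is in $\mathcal{M}$; the $\mathcal{M}$-subobjects of each object are assumed to form a small poset $\mathsf{Sub}_{\mathcal{M}}(C)$.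 It is small if $\mathbf{C}$ is small. $\mathsf{Par}(\mathbf{C},\mathcal{M})$ has the objects of $\mathbf{C}$; its morphisms $A\to B$ are isomorphism classes of spans $(m,f)$ with $m\colon C\to A$ in $\mathcal{M}$ and $f\colon C\to B$, composed by pullback; it is a restriction category with $\overline{(m,f)}=(m,m)$. $(\mathbf{C},\mathcal{M})$ is geometric if $\mathsf{Par}(\mathbf{C},\mathcal{M})$ is a join restriction category. Sheaves. For a small geometric $(\mathbf{C},\mathcal{M})$, the poset $\mathsf{Sub}_{\mathcal{M}}(C)$ has all joins, and $\mathbf{C}$ carries the Grothendieck topology $J$ whose basic covers of $C$ are the families $\{a_i\colon C_i\to C\}_{i\in I}$ with $a_i\in\mathcal{M}$ and $\bigvee_{i\in I}a_i=1$ in $\mathsf{Sub}_{\mathcal{M}}(C)$. $\mathsf{Sh}(\mathbf{C})$ is the category of sheaves on $(\mathbf{C},J)$, $\mathbf{y}$ is the Yoneda embedding and $\mathbf{a}\colon\mathsf{PSh}(\mathbf{C})\to\mathsf{Sh}(\mathbf{C})$ the associated sheaf functor. A map $\mu\colon P\to Q$ of sheaves is in $\mathcal{M}_{\mathsf{Sh}(\mathbf{C})}$ iff for every $\alpha\colon\mathbf{a}\mathbf{y}D\to Q$ there is $m\colon C\to D$ in $\mathcal{M}$ such that $\mathbf{a}\mathbf{y}m\colon\mathbf{a}\mathbf{y}C\to\mathbf{a}\mathbf{y}D$ is a pullback of $\mu$ along $\alpha$. *)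

theory Defs
  imports "HOL-Library.FuncSet" "HOL-Library.Equipollence" "HOL-Algebra.Order"
begin

section \<open>Sets and smallness\<close>

text \<open>
  Category theory over ``the category of sets'' is done relative to a Grothendieck universe \<open>U\<close>,
  given as a collection of sets over a type \<open>'v\<close>; ``set'' and ``small'' refer to \<open>U\<close>. As the
  elements of HOL sets are atoms, closure under power sets is stated up to equinumerosity.
  No infinite set is required: the finite sets of naturals are an instance, and so are the small
  sets in a type that models ZFC.
\<close>

definition set_universe :: "'v set set \<Rightarrow> bool" where
  "set_universe U \<longleftrightarrow>
     {} \<in> U \<and>
     (\<forall>A B. A \<in> U \<longrightarrow> B \<lesssim> A \<longrightarrow> B \<in> U) \<and>
     (\<forall>A. A \<in> U \<longrightarrow> (\<exists>B\<in>U. Pow A \<lesssim> B)) \<and>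
     (\<forall>A (F :: 'v \<Rightarrow> 'v set). A \<in> U \<longrightarrow> (\<forall>x\<in>A. F x \<in> U) \<longrightarrow> (\<Union>x\<in>A. F x) \<in> U)"

lemma set_universe_finite: "set_universe (Collect finite :: nat set set)"
proof -
  have "\<exists>B :: nat set. finite B \<and> Pow A \<lesssim> B" if "finite A" for A :: "nat set"
  proof -
    have "Pow A \<approx> {..<card (Pow A)}"
      using that by (simp add: eqpoll_iff_card)
    then show ?thesis
      by (meson eqpoll_imp_lepoll finite_lessThan)
  qed
  then show ?thesis
    unfolding set_universe_def by (auto simp: lepoll_def intro: inj_on_finite)
qed

definition small :: "'v set set \<Rightarrow> 'x set \<Rightarrow> bool" where
  "small U A \<longleftrightarrow> (\<exists>B\<in>U. A \<lesssim> B)"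


section \<open>Categories\<close>

record ('o, 'a) cat =
  Obj :: "'o set"
  Arr :: "'a set"
  Dom :: "'a \<Rightarrow> 'o"
  Cod :: "'a \<Rightarrow> 'o"
  Ide :: "'o \<Rightarrow> 'a"
  Comp :: "'a \<Rightarrow> 'a \<Rightarrow> 'a" (infixl "\<cdot>\<index>" 70)

definition Hom :: "('o, 'a) cat \<Rightarrow> 'o \<Rightarrow> 'o \<Rightarrow> 'a set" where
  "Hom C A B = {f \<in> Arr C. Dom C f = A \<and> Cod C f = B}"

locale category =
  fixes C :: "('o, 'a) cat" (structure)
  assumes Dom_Obj: "f \<in> Arr C \<Longrightarrow> Dom C f \<in> Obj C"
    and Cod_Obj: "f \<in> Arr C \<Longrightarrow> Cod C f \<in> Obj C"
    and Ide_Hom: "A \<in> Obj C \<Longrightarrow> Ide C A \<in> Hom C A A"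
    and Comp_Hom: "f \<in> Hom C A B \<Longrightarrow> g \<in> Hom C B D \<Longrightarrow> g \<cdot> f \<in> Hom C A D"
    and Comp_Ide: "f \<in> Hom C A B \<Longrightarrow> f \<cdot> Ide C A = f"
    and Ide_Comp: "f \<in> Hom C A B \<Longrightarrow> Ide C B \<cdot> f = f"
    and Comp_assoc: "f \<in> Hom C A B \<Longrightarrow> g \<in> Hom C B D \<Longrightarrow> h \<in> Hom C D E \<Longrightarrow>
      (h \<cdot> g) \<cdot> f = h \<cdot> (g \<cdot> f)"

locale locally_small_category = category C
  for U :: "'v set set" and C :: "('o, 'a) cat" (structure) +
  assumes small_Hom: "A \<in> Obj C \<Longrightarrow> B \<in> Obj C \<Longrightarrow> small U (Hom C A B)"

definition small_category :: "'v set set \<Rightarrow> ('o, 'a) cat \<Rightarrow> bool" where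
  "small_category U C \<longleftrightarrow> category C \<and> small U (Obj C) \<and> small U (Arr C)"

definition is_monic :: "('o, 'a) cat \<Rightarrow> 'a \<Rightarrow> bool" where
  "is_monic C m \<longleftrightarrow> m \<in> Arr C \<and>
     (\<forall>f\<in>Arr C. \<forall>g\<in>Arr C. Dom C f = Dom C g \<longrightarrow> Cod C f = Dom C m \<longrightarrow> Cod C g = Dom C m \<longrightarrow>
        m \<cdot>\<^bsub>C\<^esub> f = m \<cdot>\<^bsub>C\<^esub> g \<longrightarrow> f = g)"

definition is_iso :: "('o, 'a) cat \<Rightarrow> 'a \<Rightarrow> bool" where
  "is_iso C i \<longleftrightarrow> i \<in> Arr C \<and>
     (\<exists>j\<in>Hom C (Cod C i) (Dom C i).
        j \<cdot>\<^bsub>C\<^esub> i = Ide C (Dom C i) \<and> i \<cdot>\<^bsub>C\<^esub> j = Ide C (Cod C i))"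

text \<open>\<open>is_pullback C f g p q\<close>: the span \<open>(p, q)\<close> is a pullback of the cospan \<open>(f, g)\<close>, with
  \<open>f \<cdot> p = g \<cdot> q\<close>; thus \<open>p\<close> is a pullback of \<open>g\<close> along \<open>f\<close>, and \<open>q\<close> one of \<open>f\<close> along \<open>g\<close>.\<close>

definition is_pullback :: "('o, 'a) cat \<Rightarrow> 'a \<Rightarrow> 'a \<Rightarrow> 'a \<Rightarrow> 'a \<Rightarrow> bool" where
  "is_pullback C f g p q \<longleftrightarrow>
     f \<in> Arr C \<and> g \<in> Arr C \<and> Cod C f = Cod C g \<and>
     p \<in> Hom C (Dom C p) (Dom C f) \<and> q \<in> Hom C (Dom C p) (Dom C g) \<and>
     f \<cdot>\<^bsub>C\<^esub> p = g \<cdot>\<^bsub>C\<^esub> q \<and>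
     (\<forall>X\<in>Obj C. \<forall>u\<in>Hom C X (Dom C f). \<forall>v\<in>Hom C X (Dom C g).
        f \<cdot>\<^bsub>C\<^esub> u = g \<cdot>\<^bsub>C\<^esub> v \<longrightarrow>
        (\<exists>!w. w \<in> Hom C X (Dom C p) \<and> p \<cdot>\<^bsub>C\<^esub> w = u \<and> q \<cdot>\<^bsub>C\<^esub> w = v))"


section \<open>Join restriction categories\<close>

locale restriction_category = locally_small_category U X
  for U :: "'v set set" and X :: "('o, 'a) cat" (structure) +
  fixes rst :: "'a \<Rightarrow> 'a"
  assumes rst_Hom: "f \<in> Hom X A B \<Longrightarrow> rst f \<in> Hom X A A"
    and R1: "f \<in> Hom X A B \<Longrightarrow> f \<cdot> rst f = f"
    and R2: "f \<in> Hom X A B \<Longrightarrow> g \<in> Hom X A D \<Longrightarrow> rst g \<cdot> rst f = rst f \<cdot> rst g"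
    and R3: "f \<in> Hom X A B \<Longrightarrow> g \<in> Hom X A D \<Longrightarrow> rst (g \<cdot> rst f) = rst g \<cdot> rst f"
    and R4: "f \<in> Hom X A B \<Longrightarrow> h \<in> Hom X B D \<Longrightarrow> rst h \<cdot> f = f \<cdot> rst (h \<cdot> f)"

definition hom_poset :: "('o, 'a) cat \<Rightarrow> ('a \<Rightarrow> 'a) \<Rightarrow> 'o \<Rightarrow> 'o \<Rightarrow> 'a gorder" where
  "hom_poset X rst A B =
     \<lparr>carrier = Hom X A B, eq = (=), le = (\<lambda>f g. f = g \<cdot>\<^bsub>X\<^esub> rst f)\<rparr>"

definition compatible_set :: "('o, 'a) cat \<Rightarrow> ('a \<Rightarrow> 'a) \<Rightarrow> 'a set \<Rightarrow> bool" where
  "compatible_set X rst S \<longleftrightarrow> (\<forall>f\<in>S. \<forall>g\<in>S. f \<cdot>\<^bsub>X\<^esub> rst g = g \<cdot>\<^bsub>X\<^esub> rst f)"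

definition is_join :: "('a, 'm) gorder_scheme \<Rightarrow> 'a set \<Rightarrow> 'a \<Rightarrow> bool" where
  "is_join L S j \<longleftrightarrow> least L j (Upper L S)"

locale join_restriction_category = restriction_category U X rst
  for U :: "'v set set" and X :: "('o, 'a) cat" (structure) and rst :: "'a \<Rightarrow> 'a" +
  assumes joins:
    "A \<in> Obj X \<Longrightarrow> B \<in> Obj X \<Longrightarrow> S \<subseteq> Hom X A B \<Longrightarrow> compatible_set X rst S \<Longrightarrow>
      \<exists>j. is_join (hom_poset X rst A B) S j"
    and J1:
    "A \<in> Obj X \<Longrightarrow> B \<in> Obj X \<Longrightarrow> S \<subseteq> Hom X A B \<Longrightarrow> compatible_set X rst S \<Longrightarrow>
      is_join (hom_poset X rst A B) S j \<Longrightarrow>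
      is_join (hom_poset X rst A A) (rst ` S) (rst j)"
    and J2:
    "A \<in> Obj X \<Longrightarrow> B \<in> Obj X \<Longrightarrow> S \<subseteq> Hom X A B \<Longrightarrow> compatible_set X rst S \<Longrightarrow>
      is_join (hom_poset X rst A B) S j \<Longrightarrow> g \<in> Hom X A' A \<Longrightarrow>
      is_join (hom_poset X rst A' B) ((\<lambda>s. s \<cdot> g) ` S) (j \<cdot> g)"


section \<open>\<open>\<M>\<close>-categories and partial maps\<close>

definition subobj :: "('o, 'a) cat \<Rightarrow> 'a \<Rightarrow> 'a set" where
  "subobj C m = {m \<cdot>\<^bsub>C\<^esub> i | i. is_iso C i \<and> Cod C i = Dom C m}"

definition Sub_poset :: "('o, 'a) cat \<Rightarrow> 'a set \<Rightarrow> 'o \<Rightarrow> 'a set gorder" where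
  "Sub_poset C M A =
     \<lparr>carrier = subobj C ` {m \<in> M. Cod C m = A}, eq = (=),
      le = (\<lambda>X Y. \<exists>m\<in>X. \<exists>n\<in>Y. \<exists>k\<in>Hom C (Dom C m) (Dom C n). m = n \<cdot>\<^bsub>C\<^esub> k)\<rparr>"

locale M_category = locally_small_category U C
  for U :: "'v set set" and C :: "('o, 'a) cat" (structure) +
  fixes M :: "'a set"
  assumes M_monic: "m \<in> M \<Longrightarrow> is_monic C m"
    and iso_M: "is_iso C i \<Longrightarrow> i \<in> M"
    and Comp_M: "m \<in> M \<Longrightarrow> n \<in> M \<Longrightarrow> Cod C m = Dom C n \<Longrightarrow> n \<cdot> m \<in> M"
    and pullback_M: "m \<in> M \<Longrightarrow> f \<in> Arr C \<Longrightarrow> Cod C f = Cod C m \<Longrightarrow>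
      \<exists>m' f'. m' \<in> M \<and> is_pullback C f m m' f'"
    and small_Sub: "A \<in> Obj C \<Longrightarrow> small U (carrier (Sub_poset C M A))"

text \<open>A span is a pair \<open>(m, f)\<close> of arrows with common domain.\<close>

definition span_class :: "('o, 'a) cat \<Rightarrow> 'a \<times> 'a \<Rightarrow> ('a \<times> 'a) set" where
  "span_class C s =
     {(fst s \<cdot>\<^bsub>C\<^esub> i, snd s \<cdot>\<^bsub>C\<^esub> i) | i. is_iso C i \<and> Cod C i = Dom C (fst s)}"

text \<open>The composite of two classes collects the composites of all their representatives along all
  pullbacks; since pullbacks are unique up to isomorphism, this is a single isomorphism class.\<close>

definition Par :: "('o, 'a) cat \<Rightarrow> 'a set \<Rightarrow> ('o, ('a \<times> 'a) set) cat" where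
  "Par C M =
     \<lparr>Obj = Obj C,
      Arr = span_class C ` {(m, f). m \<in> M \<and> f \<in> Arr C \<and> Dom C m = Dom C f},
      Dom = (\<lambda>K. THE A. \<exists>(m, f)\<in>K. A = Cod C m),
      Cod = (\<lambda>K. THE B. \<exists>(m, f)\<in>K. B = Cod C f),
      Ide = (\<lambda>A. span_class C (Ide C A, Ide C A)),
      Comp = (\<lambda>L K. {(m \<cdot>\<^bsub>C\<^esub> n', g \<cdot>\<^bsub>C\<^esub> f') | m f n g n' f'.
        (m, f) \<in> K \<and> (n, g) \<in> L \<and> is_pullback C f n n' f'})\<rparr>"

text \<open>The restriction of the class of \<open>(m, f)\<close> is the class of \<open>(m, m)\<close>.\<close>

definition Par_rst :: "('a \<times> 'a) set \<Rightarrow> ('a \<times> 'a) set" where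
  "Par_rst K = (\<lambda>(m, f). (m, m)) ` K"

definition geometric :: "'v set set \<Rightarrow> ('o, 'a) cat \<Rightarrow> 'a set \<Rightarrow> bool" where
  "geometric U C M \<longleftrightarrow>
     M_category U C M \<and> join_restriction_category U (Par C M) Par_rst"


section \<open>Presheaves and sheaves\<close>

record ('o, 'a, 'v) presheaf =
  sec :: "'o \<Rightarrow> 'v set"
  res :: "'a \<Rightarrow> 'v \<Rightarrow> 'v"

record ('o, 'a, 'v) nat_trans =
  src :: "('o, 'a, 'v) presheaf"
  tgt :: "('o, 'a, 'v) presheaf"
  cmp :: "'o \<Rightarrow> 'v \<Rightarrow> 'v"

text \<open>The values outside \<open>Obj C\<close> and \<open>Arr C\<close> are fixed, so that equality in HOL is equality
  of presheaves and of natural transformations.\<close>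

definition is_presheaf :: "'v set set \<Rightarrow> ('o, 'a) cat \<Rightarrow> ('o, 'a, 'v) presheaf \<Rightarrow> bool" where
  "is_presheaf U C P \<longleftrightarrow>
     (\<forall>A. if A \<in> Obj C then sec P A \<in> U else sec P A = {}) \<and>
     (\<forall>f. if f \<in> Arr C then res P f \<in> sec P (Cod C f) \<rightarrow>\<^sub>E sec P (Dom C f)
          else res P f = (\<lambda>_. undefined)) \<and>
     (\<forall>A\<in>Obj C. \<forall>x\<in>sec P A. res P (Ide C A) x = x) \<and>
     (\<forall>f\<in>Arr C. \<forall>g\<in>Arr C. Cod C f = Dom C g \<longrightarrow>
        (\<forall>x\<in>sec P (Cod C g). res P (g \<cdot>\<^bsub>C\<^esub> f) x = res P f (res P g x)))"

definition is_nat_trans ::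
  "'v set set \<Rightarrow> ('o, 'a) cat \<Rightarrow> ('o, 'a, 'v) nat_trans \<Rightarrow> bool" where
  "is_nat_trans U C \<phi> \<longleftrightarrow>
     is_presheaf U C (src \<phi>) \<and> is_presheaf U C (tgt \<phi>) \<and>
     (\<forall>A. cmp \<phi> A \<in> sec (src \<phi>) A \<rightarrow>\<^sub>E sec (tgt \<phi>) A) \<and>
     (\<forall>f\<in>Arr C. \<forall>x\<in>sec (src \<phi>) (Cod C f).
        cmp \<phi> (Dom C f) (res (src \<phi>) f x) = res (tgt \<phi>) f (cmp \<phi> (Cod C f) x))"

definition PSh ::
  "'v set set \<Rightarrow> ('o, 'a) cat \<Rightarrow> (('o, 'a, 'v) presheaf, ('o, 'a, 'v) nat_trans) cat" where
  "PSh U C =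
     \<lparr>Obj = {P. is_presheaf U C P},
      Arr = {\<phi>. is_nat_trans U C \<phi>},
      Dom = src,
      Cod = tgt,
      Ide = (\<lambda>P. \<lparr>src = P, tgt = P, cmp = (\<lambda>A. \<lambda>x\<in>sec P A. x)\<rparr>),
      Comp = (\<lambda>\<psi> \<phi>. \<lparr>src = src \<phi>, tgt = tgt \<psi>,
        cmp = (\<lambda>A. compose (sec (src \<phi>) A) (cmp \<psi> A) (cmp \<phi> A))\<rparr>)\<rparr>"

definition is_sieve :: "('o, 'a) cat \<Rightarrow> 'o \<Rightarrow> 'a set \<Rightarrow> bool" where
  "is_sieve C A S \<longleftrightarrow>
     (\<forall>f\<in>S. f \<in> Arr C \<and> Cod C f = A) \<and>
     (\<forall>f\<in>S. \<forall>g\<in>Arr C. Cod C g = Dom C f \<longrightarrow> f \<cdot>\<^bsub>C\<^esub> g \<in> S)"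

text \<open>A topology is given by its covering sieves: \<open>J A\<close> is the set of covering sieves of \<open>A\<close>.\<close>

definition is_matching ::
  "('o, 'a) cat \<Rightarrow> ('o, 'a, 'v) presheaf \<Rightarrow> 'a set \<Rightarrow> ('a \<Rightarrow> 'v) \<Rightarrow> bool" where
  "is_matching C P S x \<longleftrightarrow>
     (\<forall>f\<in>S. x f \<in> sec P (Dom C f)) \<and>
     (\<forall>f\<in>S. \<forall>g\<in>Arr C. Cod C g = Dom C f \<longrightarrow> res P g (x f) = x (f \<cdot>\<^bsub>C\<^esub> g))"

definition is_sheaf ::
  "'v set set \<Rightarrow> ('o, 'a) cat \<Rightarrow> ('o \<Rightarrow> 'a set set) \<Rightarrow> ('o, 'a, 'v) presheaf \<Rightarrow> bool" where
  "is_sheaf U C J P \<longleftrightarrow> is_presheaf U C P \<and>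
     (\<forall>A\<in>Obj C. \<forall>S\<in>J A. \<forall>x. is_matching C P S x \<longrightarrow>
        (\<exists>!t. t \<in> sec P A \<and> (\<forall>f\<in>S. res P f t = x f)))"

definition full_subcat :: "('o, 'a) cat \<Rightarrow> 'o set \<Rightarrow> ('o, 'a) cat" where
  "full_subcat C X =
     C\<lparr>Obj := Obj C \<inter> X, Arr := {f \<in> Arr C. Dom C f \<in> X \<and> Cod C f \<in> X}\<rparr>"

definition Sh ::
  "'v set set \<Rightarrow> ('o, 'a) cat \<Rightarrow> ('o \<Rightarrow> 'a set set) \<Rightarrow>
    (('o, 'a, 'v) presheaf, ('o, 'a, 'v) nat_trans) cat" where
  "Sh U C J = full_subcat (PSh U C) {P. is_sheaf U C J P}"

text \<open>The associated sheaf functor is the left adjoint of the inclusion of sheaves into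
  presheaves. It is determined up to isomorphism by a choice of universal arrows \<open>P \<rightarrow> aP\<close>.\<close>

definition is_reflection ::
  "'v set set \<Rightarrow> ('o, 'a) cat \<Rightarrow> ('o \<Rightarrow> 'a set set) \<Rightarrow> ('o, 'a, 'v) presheaf \<Rightarrow>
    ('o, 'a, 'v) nat_trans \<Rightarrow> bool" where
  "is_reflection U C J P \<eta> \<longleftrightarrow>
     \<eta> \<in> Hom (PSh U C) P (tgt \<eta>) \<and> is_sheaf U C J (tgt \<eta>) \<and>
     (\<forall>Q\<in>Obj (Sh U C J). \<forall>\<phi>\<in>Hom (PSh U C) P Q.
        \<exists>!\<psi>. \<psi> \<in> Hom (Sh U C J) (tgt \<eta>) Q \<and> \<psi> \<cdot>\<^bsub>PSh U C\<^esub> \<eta> = \<phi>)"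

definition shf_unit ::
  "'v set set \<Rightarrow> ('o, 'a) cat \<Rightarrow> ('o \<Rightarrow> 'a set set) \<Rightarrow> ('o, 'a, 'v) presheaf \<Rightarrow>
    ('o, 'a, 'v) nat_trans" where
  "shf_unit U C J P = (SOME \<eta>. is_reflection U C J P \<eta>)"

definition shf_obj ::
  "'v set set \<Rightarrow> ('o, 'a) cat \<Rightarrow> ('o \<Rightarrow> 'a set set) \<Rightarrow> ('o, 'a, 'v) presheaf \<Rightarrow>
    ('o, 'a, 'v) presheaf" where
  "shf_obj U C J P = tgt (shf_unit U C J P)"

definition shf_arr ::
  "'v set set \<Rightarrow> ('o, 'a) cat \<Rightarrow> ('o \<Rightarrow> 'a set set) \<Rightarrow> ('o, 'a, 'v) nat_trans \<Rightarrow>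
    ('o, 'a, 'v) nat_trans" where
  "shf_arr U C J \<phi> =
     (THE \<psi>. \<psi> \<in> Hom (Sh U C J) (shf_obj U C J (src \<phi>)) (shf_obj U C J (tgt \<phi>)) \<and>
        \<psi> \<cdot>\<^bsub>PSh U C\<^esub> shf_unit U C J (src \<phi>) = shf_unit U C J (tgt \<phi>) \<cdot>\<^bsub>PSh U C\<^esub> \<phi>)"

text \<open>From here on the arrows of the base category are themselves elements of the type \<open>'v\<close> over
  which the universe lives, so that hom-sets are values of presheaves; every small category is
  isomorphic to one of this form.\<close>

definition yo_obj :: "('o, 'v) cat \<Rightarrow> 'o \<Rightarrow> ('o, 'v, 'v) presheaf" where
  "yo_obj C D =
     \<lparr>sec = (\<lambda>A. if A \<in> Obj C then Hom C A D else {}),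
      res = (\<lambda>f. if f \<in> Arr C then (\<lambda>g\<in>Hom C (Cod C f) D. g \<cdot>\<^bsub>C\<^esub> f) else (\<lambda>_. undefined))\<rparr>"

definition yo_arr :: "('o, 'v) cat \<Rightarrow> 'v \<Rightarrow> ('o, 'v, 'v) nat_trans" where
  "yo_arr C m =
     \<lparr>src = yo_obj C (Dom C m), tgt = yo_obj C (Cod C m),
      cmp = (\<lambda>A. \<lambda>g\<in>sec (yo_obj C (Dom C m)) A. m \<cdot>\<^bsub>C\<^esub> g)\<rparr>"


section \<open>The sheaf \<open>\<M>\<close>-category of a small geometric \<open>\<M>\<close>-category\<close>

definition basic_cover :: "('o, 'a) cat \<Rightarrow> 'a set \<Rightarrow> 'o \<Rightarrow> 'a set \<Rightarrow> bool" where
  "basic_cover C M A R \<longleftrightarrow>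
     R \<subseteq> {m \<in> M. Cod C m = A} \<and>
     is_join (Sub_poset C M A) (subobj C ` R) (subobj C (Ide C A))"

text \<open>The topology with the given basis: a sieve covers iff it contains a basic cover.\<close>

definition M_topology :: "('o, 'a) cat \<Rightarrow> 'a set \<Rightarrow> 'o \<Rightarrow> 'a set set" where
  "M_topology C M A = {S. is_sieve C A S \<and> (\<exists>R\<subseteq>S. basic_cover C M A R)}"

definition M_Sh ::
  "'v set set \<Rightarrow> ('o, 'v) cat \<Rightarrow> 'v set \<Rightarrow> ('o, 'v, 'v) nat_trans set" where
  "M_Sh U C M =
     {\<mu> \<in> Arr (Sh U C (M_topology C M)).
        \<forall>D\<in>Obj C.
          \<forall>\<alpha>\<in>Hom (Sh U C (M_topology C M)) (shf_obj U C (M_topology C M) (yo_obj C D)) (tgt \<mu>).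
            \<exists>m\<in>M. Cod C m = D \<and>
              (\<exists>\<beta>. is_pullback (Sh U C (M_topology C M)) \<alpha> \<mu>
                    (shf_arr U C (M_topology C M) (yo_arr C m)) \<beta>)}"

end

theory Submission
  imports Defs
begin

text \<open>
  Joins in \<open>Par(C, M)\<close> yield two facts about the base. By (J2) the joins of \<open>\<M>\<close>-subobjects are
  stable under pullback: every family of \<open>\<M>\<close>-subobjects of \<open>A\<close> has a join \<open>m\<close> such that \<open>f\<close> factors
  through \<open>m\<close> iff the family, pulled back along \<open>f\<close>, generates a covering sieve. And by gluing partial
  maps the topology is subcanonical. Hence \<open>a y D\<close> may be replaced by \<open>y D\<close>, and by the Yoneda lemma a
  map \<open>\<mu> : P \<rightarrow> Q\<close> of sheaves is an \<open>\<M>\<close>-map iff it is injective and for each section \<open>q\<close> of \<open>Q\<close>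
  over \<open>D\<close> there is an \<open>\<M>\<close>-subobject \<open>m\<close> of \<open>D\<close> such that \<open>q\<close> restricted along \<open>f\<close> lies in the image of \<open>\<mu>\<close>
  iff \<open>f\<close> factors through \<open>m\<close>. Partial maps of sheaves are then natural families of partial
  functions with domains classified in this way. The join of a compatible set of
  these is defined at a section iff the given maps are defined on a covering sieve; its value there
  is glued from theirs, and the join of the classifying subobjects classifies the new domain.
\<close>

section \<open>Smallness\<close>

text \<open>Two points shape the proof. The condition \<open>geometric\<close> speaks of isomorphism
  classes of spans, on which laws and joins are awkward to verify. A map in \<open>M_Sh\<close> is
  determined up to isomorphism by its image, so passing from spans to partial functions is an
  isomorphism of categories; the axioms are checked pointwise on the far side and carried back along
  it. The other point is local character. Images of \<open>M\<close>-maps and domains of partial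
  maps are families \<open>T\<close> of sets of sections such that, for each section
  \<open>q\<close>, the arrows along which \<open>q\<close> restricts into \<open>T\<close> form a
  principal sieve generated by an \<open>M\<close>-subobject. A principal sieve of this kind that
  contains a cover contains the identity, which makes \<open>T\<close> a subsheaf. By
  \<open>M_join\<close>, the arrows along which a union of such sieves pulls back to a covering
  sieve form a principal sieve again; hence a domain defined by a covering condition is still of the
  required kind. The associated sheaf \<open>a y D\<close> is handled through its universal property
  alone: at a representable, already a sheaf, the chosen unit is invertible.\<close>

lemma small_lepoll: "small U B \<Longrightarrow> A \<lesssim> B \<Longrightarrow> small U A"
  unfolding small_def by (meson lepoll_trans)

lemma small_subset: "small U B \<Longrightarrow> A \<subseteq> B \<Longrightarrow> small U A"
  by (erule small_lepoll) (rule subset_imp_lepoll)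

lemma small_image: "small U A \<Longrightarrow> small U (f ` A)"
  by (erule small_lepoll) (rule image_lepoll)

lemma small_inj_on: "small U B \<Longrightarrow> inj_on f A \<Longrightarrow> f ` A \<subseteq> B \<Longrightarrow> small U A"
  by (erule small_lepoll) (auto simp: lepoll_def)

lemma small_mem: "A \<in> U \<Longrightarrow> small U A"
  unfolding small_def by blast

context
  fixes U :: "'v set set"
  assumes U: "set_universe U"
begin

lemma universe_lepoll: "A \<in> U \<Longrightarrow> B \<lesssim> A \<Longrightarrow> B \<in> U"
  using U unfolding set_universe_def by blast

lemma universe_subset: "A \<in> U \<Longrightarrow> B \<subseteq> A \<Longrightarrow> B \<in> U"
  using universe_lepoll subset_imp_lepoll by blast

lemma small_iff_mem: "small U (A :: 'v set) \<longleftrightarrow> A \<in> U"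
  unfolding small_def using universe_lepoll lepoll_refl by blast

text \<open>The universe bounds \<open>Pow B\<close> only for its own members \<open>B\<close>;
  taking images under an injection of \<open>A\<close> into such a \<open>B\<close> embeds
  \<open>Pow A\<close> in \<open>Pow B\<close>.\<close>

lemma small_Pow:
  assumes "small U A"
  shows "small U (Pow A)"
proof -
  obtain B where B: "B \<in> U" "A \<lesssim> B"
    using assms unfolding small_def by blast
  then obtain f where "inj_on f A" "f ` A \<subseteq> B"
    by (auto simp: lepoll_def)
  then have "inj_on ((`) f) (Pow A)" "(`) f ` Pow A \<subseteq> Pow B"
    by (auto intro: inj_on_image_Pow)
  then have "Pow A \<lesssim> Pow B"
    unfolding lepoll_def by blast
  moreover obtain B' where "B' \<in> U" "Pow B \<lesssim> B'"
    using U B(1) unfolding set_universe_def by blast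
  ultimately show ?thesis
    unfolding small_def by (meson lepoll_trans)
qed

text \<open>The axiom on unions speaks of index sets over \<open>'v\<close>. An index set of another
  type is replaced by its image under an injection into a member of \<open>U\<close>, and the family
  is reindexed by the inverse.\<close>

lemma universe_UN:
  assumes "small U I" and X: "\<And>i. i \<in> I \<Longrightarrow> (X i :: 'v set) \<in> U"
  shows "(\<Union>i\<in>I. X i) \<in> U"
proof -
  obtain B g where B: "B \<in> U" "inj_on g I" "g ` I \<subseteq> B"
    using assms(1) by (auto simp: small_def lepoll_def)
  then have "g ` I \<in> U"
    using universe_subset by blast
  moreover have "\<forall>b\<in>g ` I. X (the_inv_into I g b) \<in> U"
    using B X by (auto simp: the_inv_into_f_f)
  moreover have "\<And>A F. A \<in> U \<Longrightarrow> \<forall>x\<in>A. F x \<in> U \<Longrightarrow> (\<Union>x\<in>A. F x) \<in> U"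
    using U unfolding set_universe_def by simp
  ultimately have "(\<Union>b\<in>g ` I. X (the_inv_into I g b)) \<in> U"
    by metis
  then show ?thesis
    using B by (simp add: the_inv_into_f_f)
qed

text \<open>A binary union is a union indexed by \<open>bool\<close>, and \<open>bool\<close> is
  small because it has as many elements as the double power set of the empty set.\<close>

lemma universe_Un:
  assumes "A \<in> U" "B \<in> U"
  shows "A \<union> B \<in> U"
proof -
  have "small U (Pow (Pow ({} :: 'v set)))"
    using U by (intro small_Pow small_mem) (auto simp: set_universe_def)
  moreover have "Pow (Pow ({} :: 'v set)) = {{}, {{}}}"
    by auto
  ultimately have "small U {{}, {{}} :: 'v set set}"
    by simp
  then have "small U (UNIV :: bool set)"
    by (rule small_inj_on[where f = "\<lambda>b. if b then {} else {{}}"]) (auto simp: inj_on_def)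
  then have "(\<Union>b\<in>UNIV. if b then A else B) \<in> U"
    using assms by (intro universe_UN) auto
  moreover have "(\<Union>b\<in>UNIV. if b then A else B) = A \<union> B"
    by (auto split: if_splits)
  ultimately show ?thesis by simp
qed

lemma small_Times:
  assumes "small U A" "small U B"
  shows "small U (A \<times> B)"
proof -
  obtain A' f where A': "A' \<in> U" "inj_on f A" "f ` A \<subseteq> A'"
    using assms(1) by (auto simp: small_def lepoll_def)
  obtain B' g where B': "B' \<in> U" "inj_on g B" "g ` B \<subseteq> B'"
    using assms(2) by (auto simp: small_def lepoll_def)
  \<comment> \<open>Kuratowski pairs, as the universe has no pairing of its own\<close>
  let ?k = "\<lambda>(a, b). {{f a}, {f a, g b}}"
  have "small U (Pow (Pow (A' \<union> B')))"
    using A'(1) B'(1) by (simp add: small_Pow small_mem universe_Un)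
  moreover have "inj_on ?k (A \<times> B)"
  proof (rule inj_onI, clarify)
    fix a b a' b'
    assume *: "a \<in> A" "b \<in> B" "a' \<in> A" "b' \<in> B"
      and "{{f a}, {f a, g b}} = {{f a'}, {f a', g b'}}"
    then have "f a = f a' \<and> g b = g b'"
      by (metis doubleton_eq_iff insert_absorb2)
    then show "a = a' \<and> b = b'"
      using * A'(2) B'(2) by (simp add: inj_on_eq_iff)
  qed
  moreover have "?k ` (A \<times> B) \<subseteq> Pow (Pow (A' \<union> B'))"
    using A'(3) B'(3) by auto
  ultimately show ?thesis
    by (rule small_inj_on)
qed

text \<open>A family of partial functions is determined by its graph, a subset of
  \<open>I \<times> X \<times> Y\<close>. Hom-sets of sheaves, sets of subobjects and sets of
  partial maps are all shown to be small through this one bound.\<close>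

lemma small_partial_families:
  assumes "small U I" "small U X" "small U Y"
  shows "small U {\<phi> :: 'i \<Rightarrow> 'x \<Rightarrow> 'y option.
    \<forall>i x y. \<phi> i x = Some y \<longrightarrow> i \<in> I \<and> x \<in> X \<and> y \<in> Y}" (is "small U ?F")
proof -
  let ?g = "\<lambda>\<phi> :: 'i \<Rightarrow> 'x \<Rightarrow> 'y option. {(i, x, y). \<phi> i x = Some y}"
  have "small U (Pow (I \<times> X \<times> Y))"
    by (intro small_Pow small_Times assms)
  moreover have "inj_on ?g ?F"
  proof (rule inj_onI, intro ext)
    fix \<phi> \<psi> :: "'i \<Rightarrow> 'x \<Rightarrow> 'y option" and i x
    assume "?g \<phi> = ?g \<psi>"
    then have "\<phi> i x = Some y \<longleftrightarrow> \<psi> i x = Some y" for y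
      by (auto simp: set_eq_iff)
    then show "\<phi> i x = \<psi> i x"
      by (metis not_Some_eq)
  qed
  moreover have "?g ` ?F \<subseteq> Pow (I \<times> X \<times> Y)"
    by auto
  ultimately show ?thesis
    by (rule small_inj_on)
qed

end


section \<open>Isomorphisms, pullbacks and partial maps\<close>

lemma in_Hom_iff: "f \<in> Hom C A B \<longleftrightarrow> f \<in> Arr C \<and> Dom C f = A \<and> Cod C f = B"
  unfolding Hom_def by blast

context category
begin

lemma comp_Arr [simp]:
  assumes "f \<in> Arr C" "g \<in> Arr C" "Cod C f = Dom C g"
  shows "g \<cdot> f \<in> Arr C" "Dom C (g \<cdot> f) = Dom C f" "Cod C (g \<cdot> f) = Cod C g"
  using Comp_Hom[of f "Dom C f" "Cod C f" g "Cod C g"] assms by (auto simp: in_Hom_iff)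

lemma ide_Arr [simp]:
  assumes "A \<in> Obj C"
  shows "Ide C A \<in> Arr C" "Dom C (Ide C A) = A" "Cod C (Ide C A) = A"
  using Ide_Hom[OF assms] by (auto simp: in_Hom_iff)

lemma comp_ide [simp]: "f \<in> Arr C \<Longrightarrow> Dom C f = A \<Longrightarrow> f \<cdot> Ide C A = f"
  using Comp_Ide[of f A "Cod C f"] by (simp add: in_Hom_iff)

lemma ide_comp [simp]: "f \<in> Arr C \<Longrightarrow> Cod C f = A \<Longrightarrow> Ide C A \<cdot> f = f"
  using Ide_Comp[of f "Dom C f" A] by (simp add: in_Hom_iff)

lemma comp_assoc:
  assumes "f \<in> Arr C" "g \<in> Arr C" "h \<in> Arr C" "Cod C f = Dom C g" "Cod C g = Dom C h"
  shows "(h \<cdot> g) \<cdot> f = h \<cdot> (g \<cdot> f)"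
  using Comp_assoc[of f "Dom C f" "Dom C g" g "Dom C h" h "Cod C h"] assms by (auto simp: in_Hom_iff)

lemma isoE:
  assumes "is_iso C i"
  obtains j where "i \<in> Arr C" "j \<in> Arr C" "Dom C j = Cod C i" "Cod C j = Dom C i"
    "j \<cdot> i = Ide C (Dom C i)" "i \<cdot> j = Ide C (Cod C i)" "is_iso C j"
proof -
  obtain j where j: "i \<in> Arr C" "j \<in> Arr C" "Dom C j = Cod C i" "Cod C j = Dom C i"
    "j \<cdot> i = Ide C (Dom C i)" "i \<cdot> j = Ide C (Cod C i)"
    using assms by (auto simp: is_iso_def in_Hom_iff)
  then have "is_iso C j"
    unfolding is_iso_def in_Hom_iff by (intro conjI bexI[of _ i]) (auto simp: in_Hom_iff)
  with j that show thesis by blast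
qed

lemma iso_Arr: "is_iso C i \<Longrightarrow> i \<in> Arr C"
  unfolding is_iso_def by blast

lemma isoI:
  assumes "i \<in> Arr C" "j \<in> Arr C" "Dom C j = Cod C i" "Cod C j = Dom C i"
    "j \<cdot> i = Ide C (Dom C i)" "i \<cdot> j = Ide C (Cod C i)"
  shows "is_iso C i"
  unfolding is_iso_def by (intro conjI bexI[of _ j]) (use assms in \<open>simp_all add: in_Hom_iff\<close>)

lemma iso_Ide: "A \<in> Obj C \<Longrightarrow> is_iso C (Ide C A)"
  by (intro isoI[where j = "Ide C A"]) auto

lemma iso_cancel_inner:
  assumes "f \<in> Arr C" "i \<in> Arr C" "j \<in> Arr C" "Cod C j = Dom C i" "Cod C i = Dom C f"
    "i \<cdot> j = Ide C (Dom C f)"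
  shows "(f \<cdot> i) \<cdot> j = f"
  using assms by (simp add: comp_assoc)

lemma iso_cancel_inner':
  assumes "f \<in> Arr C" "i \<in> Arr C" "j \<in> Arr C" "Cod C f = Dom C j" "Cod C j = Dom C i"
    "i \<cdot> j = Ide C (Cod C f)"
  shows "i \<cdot> (j \<cdot> f) = f"
  using assms by (simp add: comp_assoc[symmetric])

lemma iso_comp:
  assumes "is_iso C i" "is_iso C k" "Cod C i = Dom C k"
  shows "is_iso C (k \<cdot> i)"
proof -
  obtain i' where i: "i \<in> Arr C" "i' \<in> Arr C" "Dom C i' = Cod C i" "Cod C i' = Dom C i"
    "i' \<cdot> i = Ide C (Dom C i)" "i \<cdot> i' = Ide C (Cod C i)"
    using assms(1) by (rule isoE)
  obtain k' where k: "k \<in> Arr C" "k' \<in> Arr C" "Dom C k' = Cod C k" "Cod C k' = Dom C k"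
    "k' \<cdot> k = Ide C (Dom C k)" "k \<cdot> k' = Ide C (Cod C k)"
    using assms(2) by (rule isoE)
  have "(i' \<cdot> k') \<cdot> (k \<cdot> i) = i' \<cdot> (k' \<cdot> (k \<cdot> i))" "(k \<cdot> i) \<cdot> (i' \<cdot> k') = k \<cdot> (i \<cdot> (i' \<cdot> k'))"
    using i k assms(3) by (simp_all add: comp_assoc)
  moreover have "k' \<cdot> (k \<cdot> i) = i" "i \<cdot> (i' \<cdot> k') = k'"
    using i k assms(3) by (auto intro!: iso_cancel_inner')
  ultimately show ?thesis
    using i k assms(3) by (intro isoI[where j = "i' \<cdot> k'"]) auto
qed

lemma span_class_self:
  assumes "m \<in> Arr C" "f \<in> Arr C" "Dom C m = Dom C f"
  shows "(m, f) \<in> span_class C (m, f)"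
proof -
  have "is_iso C (Ide C (Dom C m))" "m = m \<cdot> Ide C (Dom C m)" "f = f \<cdot> Ide C (Dom C m)"
    "Cod C (Ide C (Dom C m)) = Dom C m"
    using assms Dom_Obj[of m] by (auto intro: iso_Ide)
  then show ?thesis
    unfolding span_class_def by force
qed

lemma span_class_memE:
  assumes "s \<in> span_class C (m, f)"
  obtains i where "is_iso C i" "Cod C i = Dom C m" "s = (m \<cdot> i, f \<cdot> i)"
  using assms unfolding span_class_def by auto

lemma span_class_memI:
  "is_iso C i \<Longrightarrow> Cod C i = Dom C m \<Longrightarrow> (m \<cdot> i, f \<cdot> i) \<in> span_class C (m, f)"
  unfolding span_class_def by auto

lemma span_class_iso:
  assumes "m \<in> Arr C" "f \<in> Arr C" "Dom C m = Dom C f" "is_iso C i" "Cod C i = Dom C m"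
  shows "span_class C (m \<cdot> i, f \<cdot> i) = span_class C (m, f)"
proof -
  \<comment> \<open>The inclusion is proved for arbitrary spans, because the reverse inclusion is
    its instance at the span \<open>(m \<cdot> i, f \<cdot> i)\<close> and the inverse
    \<open>j\<close> of \<open>i\<close>.\<close>
  have sub: "span_class C (m \<cdot> i, f \<cdot> i) \<subseteq> span_class C (m, f)"
    if "m \<in> Arr C" "f \<in> Arr C" "Dom C m = Dom C f" "is_iso C i" "Cod C i = Dom C m" for m f i
  proof
    fix s assume "s \<in> span_class C (m \<cdot> i, f \<cdot> i)"
    then obtain k where k: "is_iso C k" "Cod C k = Dom C (m \<cdot> i)" "s = ((m \<cdot> i) \<cdot> k, (f \<cdot> i) \<cdot> k)"
      by (elim span_class_memE)
    then have "s = (m \<cdot> (i \<cdot> k), f \<cdot> (i \<cdot> k))" "Cod C k = Dom C i"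
      using that iso_Arr[of i] iso_Arr[of k] by (auto simp: comp_assoc)
    then show "s \<in> span_class C (m, f)"
      using that k iso_comp[of k i] iso_Arr[of i] iso_Arr[of k] by (auto intro!: span_class_memI)
  qed
  obtain j where j: "i \<in> Arr C" "j \<in> Arr C" "Dom C j = Cod C i" "Cod C j = Dom C i"
    "i \<cdot> j = Ide C (Cod C i)" "is_iso C j"
    using assms(4) by (rule isoE)
  have "(m \<cdot> i) \<cdot> j = m" "(f \<cdot> i) \<cdot> j = f"
    using j assms by (auto intro!: iso_cancel_inner)
  then have "span_class C (m, f) \<subseteq> span_class C (m \<cdot> i, f \<cdot> i)"
    using sub[of "m \<cdot> i" "f \<cdot> i" j] j assms by auto
  then show ?thesis
    using sub assms by blast
qed

lemma pullbackD:
  assumes "is_pullback C f g p q"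
  shows "f \<in> Arr C" "g \<in> Arr C" "p \<in> Arr C" "q \<in> Arr C" "Cod C f = Cod C g"
    "Cod C p = Dom C f" "Dom C q = Dom C p" "Cod C q = Dom C g" "f \<cdot> p = g \<cdot> q"
  using assms by (auto simp: is_pullback_def in_Hom_iff)

lemma pullback_univ:
  assumes "is_pullback C f g p q" "u \<in> Arr C" "v \<in> Arr C" "Dom C u = Dom C v"
    "Cod C u = Dom C f" "Cod C v = Dom C g" "f \<cdot> u = g \<cdot> v"
  shows "\<exists>w. w \<in> Arr C \<and> Dom C w = Dom C u \<and> Cod C w = Dom C p \<and> p \<cdot> w = u \<and> q \<cdot> w = v"
proof -
  have "\<exists>!w. w \<in> Hom C (Dom C u) (Dom C p) \<and> p \<cdot> w = u \<and> q \<cdot> w = v"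
    using assms Dom_Obj[of u] unfolding is_pullback_def by (simp add: in_Hom_iff)
  then show ?thesis
    unfolding in_Hom_iff by blast
qed

lemma pullback_unique:
  assumes "is_pullback C f g p q" "w \<in> Arr C" "w' \<in> Arr C" "Dom C w = Dom C w'"
    "Cod C w = Dom C p" "Cod C w' = Dom C p" "p \<cdot> w = p \<cdot> w'" "q \<cdot> w = q \<cdot> w'"
  shows "w = w'"
proof -
  note D = pullbackD[OF assms(1)]
  let ?u = "p \<cdot> w" and ?v = "q \<cdot> w"
  have "?u \<in> Hom C (Dom C w) (Dom C f)" "?v \<in> Hom C (Dom C w) (Dom C g)"
    using D assms by (auto simp: in_Hom_iff)
  moreover have "f \<cdot> ?u = g \<cdot> ?v"
    using D assms by (simp add: comp_assoc[symmetric])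
  ultimately have "\<exists>!w'. w' \<in> Hom C (Dom C w) (Dom C p) \<and> p \<cdot> w' = ?u \<and> q \<cdot> w' = ?v"
    using assms(1) Dom_Obj[OF assms(2)] unfolding is_pullback_def by blast
  then show ?thesis
    using assms by (auto simp: in_Hom_iff)
qed

lemma pullbackI:
  assumes "f \<in> Arr C" "g \<in> Arr C" "p \<in> Arr C" "q \<in> Arr C" "Cod C f = Cod C g"
    "Cod C p = Dom C f" "Dom C q = Dom C p" "Cod C q = Dom C g" "f \<cdot> p = g \<cdot> q"
    and ex: "\<And>u v. u \<in> Arr C \<Longrightarrow> v \<in> Arr C \<Longrightarrow> Dom C u = Dom C v \<Longrightarrow> Cod C u = Dom C f \<Longrightarrow>
      Cod C v = Dom C g \<Longrightarrow> f \<cdot> u = g \<cdot> v \<Longrightarrow>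
      \<exists>w. w \<in> Arr C \<and> Dom C w = Dom C u \<and> Cod C w = Dom C p \<and> p \<cdot> w = u \<and> q \<cdot> w = v"
    and un: "\<And>w w'. w \<in> Arr C \<Longrightarrow> w' \<in> Arr C \<Longrightarrow> Dom C w = Dom C w' \<Longrightarrow> Cod C w = Dom C p \<Longrightarrow>
      Cod C w' = Dom C p \<Longrightarrow> p \<cdot> w = p \<cdot> w' \<Longrightarrow> q \<cdot> w = q \<cdot> w' \<Longrightarrow> w = w'"
  shows "is_pullback C f g p q"
  unfolding is_pullback_def
proof (intro conjI ballI impI)
  fix X u v assume *: "u \<in> Hom C X (Dom C f)" "v \<in> Hom C X (Dom C g)" "f \<cdot> u = g \<cdot> v"
  then obtain w where w: "w \<in> Arr C" "Dom C w = X" "Cod C w = Dom C p" "p \<cdot> w = u" "q \<cdot> w = v"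
    using ex[of u v] by (auto simp: in_Hom_iff)
  show "\<exists>!w. w \<in> Hom C X (Dom C p) \<and> p \<cdot> w = u \<and> q \<cdot> w = v"
  proof (rule ex1I[of _ w])
    show "w \<in> Hom C X (Dom C p) \<and> p \<cdot> w = u \<and> q \<cdot> w = v"
      using w by (simp add: in_Hom_iff)
  next
    fix w' assume "w' \<in> Hom C X (Dom C p) \<and> p \<cdot> w' = u \<and> q \<cdot> w' = v"
    then show "w' = w"
      using w un[of w' w] by (simp add: in_Hom_iff)
  qed
qed (use assms(1-9) in \<open>simp_all add: in_Hom_iff\<close>)

lemma pullback_sym:
  assumes "is_pullback C f g p q"
  shows "is_pullback C g f q p"
proof (rule pullbackI)
  fix u v assume "u \<in> Arr C" "v \<in> Arr C" "Dom C u = Dom C v" "Cod C u = Dom C g"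
    "Cod C v = Dom C f" "g \<cdot> u = f \<cdot> v"
  then show "\<exists>w. w \<in> Arr C \<and> Dom C w = Dom C u \<and> Cod C w = Dom C q \<and> q \<cdot> w = u \<and> p \<cdot> w = v"
    using pullback_univ[OF assms, of v u] pullbackD[OF assms] by auto
next
  fix w w' assume "w \<in> Arr C" "w' \<in> Arr C" "Dom C w = Dom C w'" "Cod C w = Dom C q"
    "Cod C w' = Dom C q" "q \<cdot> w = q \<cdot> w'" "p \<cdot> w = p \<cdot> w'"
  then show "w = w'"
    using pullback_unique[OF assms, of w w'] pullbackD[OF assms] by auto
qed (use pullbackD[OF assms] in auto)

text \<open>The comparison maps \<open>i\<close> and \<open>j\<close> are mutually inverse because
  the legs of a pullback are jointly monic.\<close>

lemma pullback_iso:
  assumes "is_pullback C f g p q" "is_pullback C f g p' q'"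
  obtains i where "is_iso C i" "Cod C i = Dom C p" "p' = p \<cdot> i" "q' = q \<cdot> i"
proof -
  note D = pullbackD[OF assms(1)] and D' = pullbackD[OF assms(2)]
  obtain i where i: "i \<in> Arr C" "Dom C i = Dom C p'" "Cod C i = Dom C p" "p \<cdot> i = p'" "q \<cdot> i = q'"
    using pullback_univ[OF assms(1), of p' q'] D' by auto
  obtain j where j: "j \<in> Arr C" "Dom C j = Dom C p" "Cod C j = Dom C p'" "p' \<cdot> j = p" "q' \<cdot> j = q"
    using pullback_univ[OF assms(2), of p q] D by auto
  have "p \<cdot> (i \<cdot> j) = p \<cdot> Ide C (Dom C p)" "q \<cdot> (i \<cdot> j) = q \<cdot> Ide C (Dom C p)"
    using D D' i j by (simp_all add: comp_assoc[symmetric])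
  then have "i \<cdot> j = Ide C (Dom C p)"
    using i j D Dom_Obj[of p] by - (rule pullback_unique[OF assms(1)], auto)
  moreover have "p' \<cdot> (j \<cdot> i) = p' \<cdot> Ide C (Dom C p')" "q' \<cdot> (j \<cdot> i) = q' \<cdot> Ide C (Dom C p')"
    using D D' i j by (simp_all add: comp_assoc[symmetric])
  then have "j \<cdot> i = Ide C (Dom C p')"
    using i j D' Dom_Obj[of p'] by - (rule pullback_unique[OF assms(2)], auto)
  ultimately have "is_iso C i"
    using i j by (intro isoI[where j = j]) auto
  with i that show thesis by blast
qed

lemma pullback_comp_iso:
  assumes "is_pullback C f g p q" "is_iso C i" "Cod C i = Dom C p"
  shows "is_pullback C f g (p \<cdot> i) (q \<cdot> i)"
proof -
  note D = pullbackD[OF assms(1)]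
  obtain j where i: "i \<in> Arr C" "j \<in> Arr C" "Dom C j = Cod C i" "Cod C j = Dom C i"
    "j \<cdot> i = Ide C (Dom C i)" "i \<cdot> j = Ide C (Cod C i)"
    using assms(2) by (rule isoE)
  show ?thesis
  proof (rule pullbackI)
    fix u v assume uv: "u \<in> Arr C" "v \<in> Arr C" "Dom C u = Dom C v" "Cod C u = Dom C f"
      "Cod C v = Dom C g" "f \<cdot> u = g \<cdot> v"
    then obtain w where w: "w \<in> Arr C" "Dom C w = Dom C u" "Cod C w = Dom C p" "p \<cdot> w = u" "q \<cdot> w = v"
      using pullback_univ[OF assms(1), of u v] by auto
    have "i \<cdot> (j \<cdot> w) = w"
      using i w assms(3) by (intro iso_cancel_inner') auto
    then have "(p \<cdot> i) \<cdot> (j \<cdot> w) = u" "(q \<cdot> i) \<cdot> (j \<cdot> w) = v"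
      using D i w assms(3) by (simp_all add: comp_assoc)
    then show "\<exists>w. w \<in> Arr C \<and> Dom C w = Dom C u \<and> Cod C w = Dom C (p \<cdot> i) \<and>
        (p \<cdot> i) \<cdot> w = u \<and> (q \<cdot> i) \<cdot> w = v"
      using i w assms(3) D by (intro exI[of _ "j \<cdot> w"]) auto
  next
    fix w w' assume w: "w \<in> Arr C" "w' \<in> Arr C" "Dom C w = Dom C w'" "Cod C w = Dom C (p \<cdot> i)"
      "Cod C w' = Dom C (p \<cdot> i)" "(p \<cdot> i) \<cdot> w = (p \<cdot> i) \<cdot> w'" "(q \<cdot> i) \<cdot> w = (q \<cdot> i) \<cdot> w'"
    then have "i \<cdot> w = i \<cdot> w'"
      using D i assms(3) by - (rule pullback_unique[OF assms(1)], auto simp: comp_assoc)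
    then have "j \<cdot> (i \<cdot> w) = j \<cdot> (i \<cdot> w')" by simp
    then show "w = w'"
      using iso_cancel_inner'[of w j i] iso_cancel_inner'[of w' j i] i w assms(3) D by auto
  qed (use D i assms(3) in \<open>auto simp: comp_assoc[symmetric]\<close>)
qed

text \<open>Choosing another representative of a span changes the legs of the cospan to be pulled
  back by isomorphisms. This brings a pullback of the changed legs back to the original
  ones.\<close>

lemma pullback_cospan_iso:
  assumes "is_pullback C (f \<cdot> i) (g \<cdot> k) p q" "is_iso C i" "is_iso C k"
    "f \<in> Arr C" "g \<in> Arr C" "Cod C i = Dom C f" "Cod C k = Dom C g"
  shows "is_pullback C f g (i \<cdot> p) (k \<cdot> q)"
proof -
  obtain j where i: "i \<in> Arr C" "j \<in> Arr C" "Dom C j = Cod C i" "Cod C j = Dom C i"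
    "j \<cdot> i = Ide C (Dom C i)" "i \<cdot> j = Ide C (Cod C i)"
    using assms(2) by (rule isoE)
  obtain l where k: "k \<in> Arr C" "l \<in> Arr C" "Dom C l = Cod C k" "Cod C l = Dom C k"
    "l \<cdot> k = Ide C (Dom C k)" "k \<cdot> l = Ide C (Cod C k)"
    using assms(3) by (rule isoE)
  have D: "p \<in> Arr C" "q \<in> Arr C" "Cod C f = Cod C g"
    "Cod C p = Dom C i" "Dom C q = Dom C p" "Cod C q = Dom C k" "(f \<cdot> i) \<cdot> p = (g \<cdot> k) \<cdot> q"
    using pullbackD[OF assms(1)] i k assms(4-) by auto
  show ?thesis
  proof (rule pullbackI)
    fix u v assume uv: "u \<in> Arr C" "v \<in> Arr C" "Dom C u = Dom C v" "Cod C u = Dom C f"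
      "Cod C v = Dom C g" "f \<cdot> u = g \<cdot> v"
    have *: "i \<cdot> (j \<cdot> u) = u" "k \<cdot> (l \<cdot> v) = v"
      using i k uv assms by (auto intro!: iso_cancel_inner')
    then have "(f \<cdot> i) \<cdot> (j \<cdot> u) = (g \<cdot> k) \<cdot> (l \<cdot> v)"
      using i k uv assms(4-) by (simp add: comp_assoc)
    then obtain w where w: "w \<in> Arr C" "Dom C w = Dom C u" "Cod C w = Dom C p"
        "p \<cdot> w = j \<cdot> u" "q \<cdot> w = l \<cdot> v"
      using pullback_univ[OF assms(1), of "j \<cdot> u" "l \<cdot> v"] i k uv assms(4-) by auto
    then have "(i \<cdot> p) \<cdot> w = u" "(k \<cdot> q) \<cdot> w = v"
      using * D i k by (auto simp: comp_assoc)
    then show "\<exists>w. w \<in> Arr C \<and> Dom C w = Dom C u \<and> Cod C w = Dom C (i \<cdot> p) \<and>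
        (i \<cdot> p) \<cdot> w = u \<and> (k \<cdot> q) \<cdot> w = v"
      using w D i by (intro exI[of _ w]) auto
  next
    fix w w' assume w: "w \<in> Arr C" "w' \<in> Arr C" "Dom C w = Dom C w'" "Cod C w = Dom C (i \<cdot> p)"
      "Cod C w' = Dom C (i \<cdot> p)" "(i \<cdot> p) \<cdot> w = (i \<cdot> p) \<cdot> w'" "(k \<cdot> q) \<cdot> w = (k \<cdot> q) \<cdot> w'"
    then have "j \<cdot> (i \<cdot> (p \<cdot> w)) = j \<cdot> (i \<cdot> (p \<cdot> w'))" "l \<cdot> (k \<cdot> (q \<cdot> w)) = l \<cdot> (k \<cdot> (q \<cdot> w'))"
      using D i k by (simp_all add: comp_assoc)
    then have "p \<cdot> w = p \<cdot> w'" "q \<cdot> w = q \<cdot> w'"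
      using w D i k by (simp_all add: iso_cancel_inner')
    then show "w = w'"
      using w D i by - (rule pullback_unique[OF assms(1)], auto)
  next
    show "f \<cdot> (i \<cdot> p) = g \<cdot> (k \<cdot> q)"
      using D i k assms(4-) by (simp add: comp_assoc)
  qed (use D i k assms(4-) in auto)
qed

end

section \<open>Partial maps: domains, codomains and composites by representatives\<close>

context M_category
begin

lemma M_Arr: "m \<in> M \<Longrightarrow> m \<in> Arr C"
  using M_monic unfolding is_monic_def by blast

lemma M_cancel:
  "m \<in> M \<Longrightarrow> f \<in> Arr C \<Longrightarrow> g \<in> Arr C \<Longrightarrow> Dom C f = Dom C g \<Longrightarrow> Cod C f = Dom C m \<Longrightarrow>
    Cod C g = Dom C m \<Longrightarrow> m \<cdot> f = m \<cdot> g \<Longrightarrow> f = g"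
  using M_monic unfolding is_monic_def by blast

lemma Ide_M: "A \<in> Obj C \<Longrightarrow> Ide C A \<in> M"
  by (intro iso_M iso_Ide)

lemma Par_Obj [simp]: "Obj (Par C M) = Obj C"
  by (simp add: Par_def)

lemma Par_ArrI: "m \<in> M \<Longrightarrow> f \<in> Arr C \<Longrightarrow> Dom C m = Dom C f \<Longrightarrow> span_class C (m, f) \<in> Arr (Par C M)"
  by (auto simp: Par_def)

lemma Par_ArrE:
  assumes "K \<in> Arr (Par C M)"
  obtains m f where "m \<in> M" "f \<in> Arr C" "Dom C m = Dom C f" "K = span_class C (m, f)"
  using assms by (auto simp: Par_def)

lemma span_class_Cod:
  assumes "(m', f') \<in> span_class C (m, f)" "m \<in> M" "f \<in> Arr C" "Dom C m = Dom C f"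
  shows "m' \<in> M" "f' \<in> Arr C" "Dom C m' = Dom C f'" "Cod C m' = Cod C m" "Cod C f' = Cod C f"
proof -
  obtain i where i: "is_iso C i" "Cod C i = Dom C m" "m' = m \<cdot> i" "f' = f \<cdot> i"
    using assms(1) by (auto elim: span_class_memE)
  then show "m' \<in> M" "f' \<in> Arr C" "Dom C m' = Dom C f'" "Cod C m' = Cod C m" "Cod C f' = Cod C f"
    using assms M_Arr iso_Arr[of i] iso_M by (auto intro: Comp_M)
qed

lemma Par_Dom:
  assumes "m \<in> M" "f \<in> Arr C" "Dom C m = Dom C f"
  shows "Dom (Par C M) (span_class C (m, f)) = Cod C m"
proof -
  have "(m, f) \<in> span_class C (m, f)"
    using assms M_Arr by (intro span_class_self) auto
  then have "(\<exists>(m', f')\<in>span_class C (m, f). A = Cod C m') \<longleftrightarrow> A = Cod C m" for A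
    using span_class_Cod(4)[OF _ assms] by blast
  then show ?thesis by (simp add: Par_def)
qed

lemma Par_Cod:
  assumes "m \<in> M" "f \<in> Arr C" "Dom C m = Dom C f"
  shows "Cod (Par C M) (span_class C (m, f)) = Cod C f"
proof -
  have "(m, f) \<in> span_class C (m, f)"
    using assms M_Arr by (intro span_class_self) auto
  then have "(\<exists>(m', f')\<in>span_class C (m, f). A = Cod C f') \<longleftrightarrow> A = Cod C f" for A
    using span_class_Cod(5)[OF _ assms] by blast
  then show ?thesis by (simp add: Par_def)
qed

lemma Par_HomI:
  assumes "m \<in> M" "f \<in> Arr C" "Dom C m = Dom C f" "Cod C m = A" "Cod C f = B"
  shows "span_class C (m, f) \<in> Hom (Par C M) A B"
  using assms by (simp add: in_Hom_iff Par_Dom Par_Cod Par_ArrI)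

lemma Par_HomE:
  assumes "K \<in> Hom (Par C M) A B"
  obtains m f where "m \<in> M" "f \<in> Arr C" "Dom C m = Dom C f" "Cod C m = A" "Cod C f = B"
    "K = span_class C (m, f)"
  using assms by (auto simp: in_Hom_iff Par_Dom Par_Cod elim!: Par_ArrE)

lemma Par_rst_span: "Par_rst (span_class C (m, f)) = span_class C (m, m)"
  unfolding Par_rst_def span_class_def by force

text \<open>Composition in \<open>Par\<close> collects composites over all representatives and all
  pullbacks. Since representatives differ by isomorphisms and pullbacks are unique up to
  isomorphism, a single pullback of a single pair of representatives already generates the whole
  composite class.\<close>

lemma Par_Comp:
  assumes m: "m \<in> M" "f \<in> Arr C" "Dom C m = Dom C f"
    and n: "n \<in> M" "g \<in> Arr C" "Dom C n = Dom C g"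
    and pb: "is_pullback C f n n' f'"
  shows "span_class C (n, g) \<cdot>\<^bsub>Par C M\<^esub> span_class C (m, f) = span_class C (m \<cdot> n', g \<cdot> f')"
proof -
  note D = pullbackD[OF pb]
  have mA: "m \<in> Arr C" "n \<in> Arr C"
    using m n M_Arr by auto
  have "(m1 \<cdot> n1', g1 \<cdot> f1') \<in> span_class C (m \<cdot> n', g \<cdot> f')"
    if H: "(m1, f1) \<in> span_class C (m, f)" "(n1, g1) \<in> span_class C (n, g)"
      "is_pullback C f1 n1 n1' f1'" for m1 f1 n1 g1 n1' f1'
  proof -
    obtain i where i: "is_iso C i" "Cod C i = Dom C m" "m1 = m \<cdot> i" "f1 = f \<cdot> i"
      using H(1) by (rule span_class_memE) auto
    obtain k where k: "is_iso C k" "Cod C k = Dom C n" "n1 = n \<cdot> k" "g1 = g \<cdot> k"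
      using H(2) by (rule span_class_memE) auto
    \<comment> \<open>Moved to the cospan \<open>(f, n)\<close>, the given pullback can be compared
      with \<open>pb\<close>; the resulting isomorphism \<open>j\<close> witnesses membership in the
      class.\<close>
    have "is_pullback C f n (i \<cdot> n1') (k \<cdot> f1')"
      using H(3) i k m n mA by (intro pullback_cospan_iso) auto
    then obtain j where j: "is_iso C j" "Cod C j = Dom C n'" "i \<cdot> n1' = n' \<cdot> j" "k \<cdot> f1' = f' \<cdot> j"
      using pullback_iso[OF pb] by blast
    have "m1 \<cdot> n1' = m \<cdot> (i \<cdot> n1')" "g1 \<cdot> f1' = g \<cdot> (k \<cdot> f1')"
      using i k m n mA pullbackD[OF H(3)] iso_Arr by (auto simp: comp_assoc)
    then have "m1 \<cdot> n1' = (m \<cdot> n') \<cdot> j" "g1 \<cdot> f1' = (g \<cdot> f') \<cdot> j"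
      using D j m n mA iso_Arr[of j] by (auto simp: comp_assoc)
    moreover have "Dom C (m \<cdot> n') = Dom C n'"
      using D m mA by auto
    ultimately show ?thesis
      using j by (auto intro: span_class_memI)
  qed
  moreover have "\<exists>m1 f1 n1 g1 n1' f1'. s = (m1 \<cdot> n1', g1 \<cdot> f1') \<and> (m1, f1) \<in> span_class C (m, f) \<and>
      (n1, g1) \<in> span_class C (n, g) \<and> is_pullback C f1 n1 n1' f1'"
    if s: "s \<in> span_class C (m \<cdot> n', g \<cdot> f')" for s
  proof -
    obtain i where i: "is_iso C i" "Cod C i = Dom C (m \<cdot> n')" "s = ((m \<cdot> n') \<cdot> i, (g \<cdot> f') \<cdot> i)"
      using s by (elim span_class_memE)
    then have i': "Cod C i = Dom C n'" "s = (m \<cdot> (n' \<cdot> i), g \<cdot> (f' \<cdot> i))"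
      using D m n mA iso_Arr[of i] by (auto simp: comp_assoc)
    \<comment> \<open>The isomorphism \<open>i\<close> is absorbed into the choice of pullback,
      while the representatives of the two classes stay fixed.\<close>
    have "is_pullback C f n (n' \<cdot> i) (f' \<cdot> i)"
      using pb i i' by (intro pullback_comp_iso)
    moreover have "(m, f) \<in> span_class C (m, f)" "(n, g) \<in> span_class C (n, g)"
      using m n mA by (auto intro: span_class_self)
    ultimately show ?thesis
      using i' by blast
  qed
  ultimately show ?thesis
    unfolding Par_def by auto
qed

end


section \<open>Joins of \<open>\<M>\<close>-subobjects in a geometric \<open>\<M>\<close>-category\<close>

text \<open>The order of subobjects on representatives, but with an arbitrary arrow on the left. It
  thus also says that a generalized element lies in a subobject, and its left-hand sides form the
  principal sieve of \<open>m\<close>.\<close>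

definition factors_through :: "('o, 'a) cat \<Rightarrow> 'a \<Rightarrow> 'a \<Rightarrow> bool" where
  "factors_through C f m \<longleftrightarrow>
     (\<exists>k\<in>Arr C. Dom C f = Dom C k \<and> Cod C k = Dom C m \<and> f = m \<cdot>\<^bsub>C\<^esub> k)"

lemma factors_throughI:
  "k \<in> Arr C \<Longrightarrow> Dom C f = Dom C k \<Longrightarrow> Cod C k = Dom C m \<Longrightarrow> f = m \<cdot>\<^bsub>C\<^esub> k \<Longrightarrow>
    factors_through C f m"
  unfolding factors_through_def by blast

lemma factors_throughE:
  assumes "factors_through C f m"
  obtains k where "k \<in> Arr C" "Dom C f = Dom C k" "Cod C k = Dom C m" "f = m \<cdot>\<^bsub>C\<^esub> k"
  using assms unfolding factors_through_def by blast

definition Sub_join :: "('o, 'a) cat \<Rightarrow> 'a set \<Rightarrow> 'a set \<Rightarrow> 'a \<Rightarrow> bool" where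
  "Sub_join C M R m \<longleftrightarrow> (\<forall>r\<in>R. factors_through C r m) \<and>
     (\<forall>n\<in>M. Cod C n = Cod C m \<longrightarrow> (\<forall>r\<in>R. factors_through C r n) \<longrightarrow> factors_through C m n)"

lemma is_joinD:
  assumes "is_join L S j" "S \<subseteq> carrier L"
  shows "j \<in> carrier L" "\<And>s. s \<in> S \<Longrightarrow> le L s j"
    "\<And>k. k \<in> carrier L \<Longrightarrow> (\<And>s. s \<in> S \<Longrightarrow> le L s k) \<Longrightarrow> le L j k"
  using assms unfolding is_join_def least_def Upper_def by auto

lemma is_joinI:
  assumes "j \<in> carrier L" "\<And>s. s \<in> S \<Longrightarrow> le L s j" "S \<subseteq> carrier L"
    "\<And>k. k \<in> carrier L \<Longrightarrow> (\<And>s. s \<in> S \<Longrightarrow> le L s k) \<Longrightarrow> le L j k"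
  shows "is_join L S j"
  unfolding is_join_def least_def Upper_def
proof (intro conjI ballI)
  fix k assume "k \<in> {u. \<forall>x. x \<in> S \<inter> carrier L \<longrightarrow> le L x u} \<inter> carrier L"
  then have "k \<in> carrier L" "\<And>s. s \<in> S \<Longrightarrow> le L s k"
    using assms(3) by auto
  then show "le L j k"
    by (rule assms(4))
qed (use assms(1,2) in auto)

context category
begin

lemma factors_through_refl: "f \<in> Arr C \<Longrightarrow> factors_through C f f"
  by (rule factors_throughI[of "Ide C (Dom C f)"]) (use Dom_Obj[of f] in simp_all)

lemma factors_through_trans:
  assumes "factors_through C f g" "factors_through C g h" "h \<in> Arr C"
  shows "factors_through C f h"
proof -
  obtain k where k: "k \<in> Arr C" "Dom C f = Dom C k" "Cod C k = Dom C g" "f = g \<cdot> k"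
    using assms(1) by (rule factors_throughE)
  obtain l where l: "l \<in> Arr C" "Dom C g = Dom C l" "Cod C l = Dom C h" "g = h \<cdot> l"
    using assms(2) by (rule factors_throughE)
  have "f = h \<cdot> (l \<cdot> k)"
    using k l assms(3) by (simp add: comp_assoc)
  with k l show ?thesis
    by (intro factors_throughI[of "l \<cdot> k"]) simp_all
qed

lemma factors_through_comp:
  assumes "factors_through C f m" "m \<in> Arr C" "g \<in> Arr C" "Cod C g = Dom C f"
  shows "factors_through C (f \<cdot> g) m"
proof -
  obtain k where k: "k \<in> Arr C" "Dom C f = Dom C k" "Cod C k = Dom C m" "f = m \<cdot> k"
    using assms(1) by (rule factors_throughE)
  have "f \<cdot> g = m \<cdot> (k \<cdot> g)"
    using k assms by (simp add: comp_assoc)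
  with k assms show ?thesis
    by (intro factors_throughI[of "k \<cdot> g"]) simp_all
qed

lemma factors_through_Ide_iff:
  assumes "m \<in> Arr C" "A = Cod C m"
  shows "factors_through C (Ide C A) m \<longleftrightarrow> (\<forall>f\<in>Arr C. Cod C f = A \<longrightarrow> factors_through C f m)"
proof
  assume *: "factors_through C (Ide C A) m"
  show "\<forall>f\<in>Arr C. Cod C f = A \<longrightarrow> factors_through C f m"
  proof (intro ballI impI)
    fix f assume "f \<in> Arr C" "Cod C f = A"
    then show "factors_through C f m"
      using factors_through_comp[OF * assms(1), of f] assms Cod_Obj[of m] by simp
  qed
next
  assume "\<forall>f\<in>Arr C. Cod C f = A \<longrightarrow> factors_through C f m"
  then show "factors_through C (Ide C A) m"
    using assms Cod_Obj[of m] by simp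
qed

lemma subobj_self:
  assumes "m \<in> Arr C"
  shows "m \<in> subobj C m"
proof -
  have "is_iso C (Ide C (Dom C m))" "m = m \<cdot> Ide C (Dom C m)" "Cod C (Ide C (Dom C m)) = Dom C m"
    using assms Dom_Obj[of m] by (simp_all add: iso_Ide)
  then show ?thesis
    unfolding subobj_def by blast
qed

end

section \<open>The orders on subobjects and on partial maps in terms of representatives\<close>

context M_category
begin

text \<open>The order on classes asks for some pair of representatives. Composing the comparison
  \<open>k\<close> with the isomorphism \<open>l\<close> and with the inverse \<open>j\<close> of
  \<open>i\<close> moves it to the given pair.\<close>

lemma Sub_le_iff:
  assumes "m \<in> M" "n \<in> M" "Cod C m = A" "Cod C n = A"
  shows "le (Sub_poset C M A) (subobj C m) (subobj C n) \<longleftrightarrow> factors_through C m n"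
proof
  assume "le (Sub_poset C M A) (subobj C m) (subobj C n)"
  then obtain m' n' k where k: "m' \<in> subobj C m" "n' \<in> subobj C n" "k \<in> Hom C (Dom C m') (Dom C n')"
    "m' = n' \<cdot> k"
    unfolding Sub_poset_def by auto
  obtain i where i: "is_iso C i" "Cod C i = Dom C m" "m' = m \<cdot> i"
    using k(1) unfolding subobj_def by blast
  obtain l where l: "is_iso C l" "Cod C l = Dom C n" "n' = n \<cdot> l"
    using k(2) unfolding subobj_def by blast
  obtain j where j: "i \<in> Arr C" "j \<in> Arr C" "Dom C j = Cod C i" "Cod C j = Dom C i"
    "j \<cdot> i = Ide C (Dom C i)" "i \<cdot> j = Ide C (Cod C i)"
    using i(1) by (rule isoE)
  have A: "m \<in> Arr C" "n \<in> Arr C" "l \<in> Arr C" "k \<in> Arr C" "Dom C i = Dom C k" "Cod C k = Dom C l"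
    using assms l j k(3) i M_Arr iso_Arr by (auto simp: in_Hom_iff)
  have "m \<cdot> i = n \<cdot> (l \<cdot> k)"
    using k(4) i l j A by (simp add: comp_assoc)
  then have "(m \<cdot> i) \<cdot> j = n \<cdot> ((l \<cdot> k) \<cdot> j)"
    using A l j i by (simp add: comp_assoc)
  moreover have "(m \<cdot> i) \<cdot> j = m"
    using j A i by (simp add: iso_cancel_inner)
  ultimately show "factors_through C m n"
    using A l j i by (intro factors_throughI[of "(l \<cdot> k) \<cdot> j"]) simp_all
next
  assume "factors_through C m n"
  then obtain k where k: "k \<in> Arr C" "Dom C m = Dom C k" "Cod C k = Dom C n" "m = n \<cdot> k"
    by (rule factors_throughE)
  have "k \<in> Hom C (Dom C m) (Dom C n)"
    unfolding in_Hom_iff using k(1-3) by simp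
  moreover have "m \<in> subobj C m" "n \<in> subobj C n"
    using assms M_Arr by (blast intro: subobj_self)+
  ultimately show "le (Sub_poset C M A) (subobj C m) (subobj C n)"
    unfolding Sub_poset_def using k(4) by simp metis
qed

lemma is_join_Sub_iff:
  assumes "R \<subseteq> {m \<in> M. Cod C m = A}" "m \<in> M" "Cod C m = A"
  shows "is_join (Sub_poset C M A) (subobj C ` R) (subobj C m) \<longleftrightarrow> Sub_join C M R m"
proof -
  have c: "carrier (Sub_poset C M A) = subobj C ` {m \<in> M. Cod C m = A}"
    by (simp add: Sub_poset_def)
  have le: "le (Sub_poset C M A) (subobj C m) (subobj C n) \<longleftrightarrow> factors_through C m n"
    if "m \<in> M" "n \<in> M" "Cod C m = A" "Cod C n = A" for m n
    using that by (rule Sub_le_iff)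
  have sub: "subobj C ` R \<subseteq> carrier (Sub_poset C M A)"
    using assms c by blast
  show ?thesis
  proof
    assume j: "is_join (Sub_poset C M A) (subobj C ` R) (subobj C m)"
    show "Sub_join C M R m"
      unfolding Sub_join_def
    proof (intro conjI ballI impI)
      fix r assume "r \<in> R"
      then show "factors_through C r m"
        using is_joinD(2)[OF j sub, of "subobj C r"] le[of r m] assms by auto
    next
      fix n assume n: "n \<in> M" "Cod C n = Cod C m" "\<forall>r\<in>R. factors_through C r n"
      have "le (Sub_poset C M A) s (subobj C n)" if "s \<in> subobj C ` R" for s
        using that n le[of _ n] assms by auto
      then show "factors_through C m n"
        using is_joinD(3)[OF j sub, of "subobj C n"] n le[of m n] assms c by auto
    qed
  next
    assume j: "Sub_join C M R m"
    show "is_join (Sub_poset C M A) (subobj C ` R) (subobj C m)"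
    proof (rule is_joinI)
      show "subobj C m \<in> carrier (Sub_poset C M A)"
        using assms c by blast
      show "le (Sub_poset C M A) s (subobj C m)" if "s \<in> subobj C ` R" for s
        using that j le[of _ m] assms unfolding Sub_join_def by auto
    next
      fix k assume k: "k \<in> carrier (Sub_poset C M A)"
        "\<And>s. s \<in> subobj C ` R \<Longrightarrow> le (Sub_poset C M A) s k"
      then obtain n where n: "n \<in> M" "Cod C n = A" "k = subobj C n"
        using c by auto
      have "factors_through C r n" if "r \<in> R" for r
        using k(2)[of "subobj C r"] n le[of r n] that assms by auto
      then show "le (Sub_poset C M A) (subobj C m) k"
        using j n le[of m n] assms unfolding Sub_join_def by auto
    qed (rule sub)
  qed
qed

text \<open>Everything with codomain \<open>A\<close> factors through the identity, so of the two
  conditions for a join only leastness remains.\<close>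

lemma basic_cover_iff:
  assumes "A \<in> Obj C"
  shows "basic_cover C M A R \<longleftrightarrow> R \<subseteq> {m \<in> M. Cod C m = A} \<and>
    (\<forall>n\<in>M. Cod C n = A \<longrightarrow> (\<forall>r\<in>R. factors_through C r n) \<longrightarrow> factors_through C (Ide C A) n)"
proof (cases "R \<subseteq> {m \<in> M. Cod C m = A}")
  case True
  have "factors_through C r (Ide C A)" if "r \<in> R" for r
  proof -
    have "r \<in> Arr C" "Cod C r = A"
      using that True M_Arr by auto
    then show ?thesis
      using assms by (intro factors_throughI[of r]) simp_all
  qed
  then show ?thesis
    using True assms is_join_Sub_iff[OF True, of "Ide C A"] Ide_M[of A]
    unfolding basic_cover_def Sub_join_def by simp
qed (simp add: basic_cover_def)

text \<open>The restriction order compares \<open>(m, f)\<close> with \<open>(n, g)\<close>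
  restricted to \<open>m\<close>, which is computed from the pullback of \<open>n\<close> along
  \<open>m\<close>. The right-hand side says that the domain is contained in the other one and that
  the values agree there.\<close>

lemma Par_le_iff:
  assumes m: "m \<in> M" "f \<in> Arr C" "Dom C m = Dom C f" "Cod C m = A"
    and n: "n \<in> M" "g \<in> Arr C" "Dom C n = Dom C g" "Cod C n = A"
  shows "le (hom_poset (Par C M) Par_rst A B) (span_class C (m, f)) (span_class C (n, g)) \<longleftrightarrow>
    (\<exists>k\<in>Arr C. Dom C m = Dom C k \<and> Cod C k = Dom C n \<and> m = n \<cdot> k \<and> f = g \<cdot> k)"
proof -
  have A: "m \<in> Arr C" "n \<in> Arr C"
    using m n M_Arr by auto
  have "le (hom_poset (Par C M) Par_rst A B) (span_class C (m, f)) (span_class C (n, g)) \<longleftrightarrow>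
      span_class C (m, f) = span_class C (n, g) \<cdot>\<^bsub>Par C M\<^esub> span_class C (m, m)"
    by (simp add: hom_poset_def Par_rst_span)
  also have "\<dots> \<longleftrightarrow> (\<exists>k\<in>Arr C. Dom C m = Dom C k \<and> Cod C k = Dom C n \<and> m = n \<cdot> k \<and> f = g \<cdot> k)"
  proof
    assume eq: "span_class C (m, f) = span_class C (n, g) \<cdot>\<^bsub>Par C M\<^esub> span_class C (m, m)"
    obtain n' m' where pb: "is_pullback C m n n' m'"
      using pullback_M[of n m] m n A by auto
    note D = pullbackD[OF pb]
    have "span_class C (m, f) = span_class C (m \<cdot> n', g \<cdot> m')"
      using eq Par_Comp[OF m(1) A(1) _ n(1-3) pb] by simp
    \<comment> \<open>So \<open>(m, f)\<close> is the composite span precomposed with an isomorphism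
      \<open>i\<close>. Since \<open>m \<cdot> n' = n \<cdot> m'\<close>, the arrow
      \<open>m' \<cdot> i\<close> is the required comparison.\<close>
    then have "(m, f) \<in> span_class C (m \<cdot> n', g \<cdot> m')"
      using span_class_self[of m f] A m by simp
    then obtain i where i: "is_iso C i" "Cod C i = Dom C (m \<cdot> n')" "m = (m \<cdot> n') \<cdot> i" "f = (g \<cdot> m') \<cdot> i"
      by (rule span_class_memE) simp
    have i': "i \<in> Arr C" "Cod C i = Dom C n'"
      using i iso_Arr D A by auto
    then have "Dom C m = Dom C i"
      using i(3) D A comp_Arr(2)[of i "m \<cdot> n'"] by simp
    moreover have "n \<cdot> (m' \<cdot> i) = (n \<cdot> m') \<cdot> i" "g \<cdot> (m' \<cdot> i) = (g \<cdot> m') \<cdot> i"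
      using i' D A n by (simp_all add: comp_assoc)
    ultimately show "\<exists>k\<in>Arr C. Dom C m = Dom C k \<and> Cod C k = Dom C n \<and> m = n \<cdot> k \<and> f = g \<cdot> k"
      using i' i D by (intro bexI[of _ "m' \<cdot> i"]) simp_all
  next
    assume "\<exists>k\<in>Arr C. Dom C m = Dom C k \<and> Cod C k = Dom C n \<and> m = n \<cdot> k \<and> f = g \<cdot> k"
    then obtain k where k: "k \<in> Arr C" "Dom C m = Dom C k" "Cod C k = Dom C n" "m = n \<cdot> k" "f = g \<cdot> k"
      by blast
    have O: "Dom C m \<in> Obj C"
      using A Dom_Obj by blast
    \<comment> \<open>As \<open>n\<close> is monic and \<open>m\<close> factors through it, the
      pullback of \<open>n\<close> along \<open>m\<close> can be taken to be the identity, with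
      \<open>k\<close> as the other leg.\<close>
    have "is_pullback C m n (Ide C (Dom C m)) k"
    proof (rule pullbackI)
      fix u v assume uv: "u \<in> Arr C" "v \<in> Arr C" "Dom C u = Dom C v" "Cod C u = Dom C m"
        "Cod C v = Dom C n" "m \<cdot> u = n \<cdot> v"
      have "n \<cdot> (k \<cdot> u) = (n \<cdot> k) \<cdot> u"
        using k(1-3) A uv(1,4) by (simp add: comp_assoc)
      also have "\<dots> = n \<cdot> v"
        using uv(6) by (simp only: k(4)[symmetric])
      finally have "k \<cdot> u = v"
        using uv(1-5) k(1-3) M_cancel[OF n(1), of "k \<cdot> u" v] by simp
      then show "\<exists>w. w \<in> Arr C \<and> Dom C w = Dom C u \<and> Cod C w = Dom C (Ide C (Dom C m)) \<and>
          Ide C (Dom C m) \<cdot> w = u \<and> k \<cdot> w = v"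
        using uv(1-5) O by (intro exI[of _ u]) simp
    next
      fix w w' assume "w \<in> Arr C" "w' \<in> Arr C" "Cod C w = Dom C (Ide C (Dom C m))"
        "Cod C w' = Dom C (Ide C (Dom C m))" "Ide C (Dom C m) \<cdot> w = Ide C (Dom C m) \<cdot> w'"
      then show "w = w'"
        using O by simp
    qed (use A k(1-3) k(4)[symmetric] m n O in simp_all)
    then show "span_class C (m, f) = span_class C (n, g) \<cdot>\<^bsub>Par C M\<^esub> span_class C (m, m)"
      using Par_Comp[OF m(1) A(1) _ n(1-3)] k(5) A by simp
  qed
  finally show ?thesis .
qed

text \<open>On the restriction idempotents \<open>(n, n)\<close> the order of \<open>Par\<close> is
  the order of subobjects. A join in the whole hom-poset is in particular below every upper bound of
  this form.\<close>

lemma Sub_join_of_Par_join: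
  assumes R: "R \<subseteq> {m \<in> M. Cod C m = A}" and m: "m \<in> M" "Cod C m = A"
    and j: "is_join (hom_poset (Par C M) Par_rst A A) ((\<lambda>r. span_class C (r, r)) ` R)
      (span_class C (m, m))"
  shows "Sub_join C M R m"
proof -
  let ?L = "hom_poset (Par C M) Par_rst A A"
  have le: "le ?L (span_class C (m, m)) (span_class C (n, n)) \<longleftrightarrow> factors_through C m n"
    if "m \<in> M" "n \<in> M" "Cod C m = A" "Cod C n = A" for m n
    using Par_le_iff[of m m A n n A] that M_Arr unfolding factors_through_def by auto
  have c: "span_class C (m, m) \<in> carrier ?L" if "m \<in> M" "Cod C m = A" for m
    using that M_Arr by (auto simp: hom_poset_def intro!: Par_HomI)
  then have sub: "(\<lambda>r. span_class C (r, r)) ` R \<subseteq> carrier ?L"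
    using R by auto
  show ?thesis
    unfolding Sub_join_def
  proof (intro conjI ballI impI)
    fix r assume "r \<in> R"
    then show "factors_through C r m"
      using is_joinD(2)[OF j sub, of "span_class C (r, r)"] le[of r m] R m by auto
  next
    fix n assume n: "n \<in> M" "Cod C n = Cod C m" "\<forall>r\<in>R. factors_through C r n"
    have "le ?L s (span_class C (n, n))" if "s \<in> (\<lambda>r. span_class C (r, r)) ` R" for s
      using that n le[of _ n] R m by auto
    then show "factors_through C m n"
      using is_joinD(3)[OF j sub, of "span_class C (n, n)"] n le[of m n] m c by auto
  qed
qed

end

text \<open>This is the pullback along \<open>f\<close> of the sieve generated by \<open>R\<close>;
  for an identity \<open>f\<close> it is the generated sieve itself.\<close>

lemma (in category) sieve_generated:
  assumes "f \<in> Arr C" "\<And>r. r \<in> R \<Longrightarrow> r \<in> Arr C \<and> Cod C r = Cod C f"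
  shows "is_sieve C (Dom C f) {g \<in> Arr C. Cod C g = Dom C f \<and> (\<exists>r\<in>R. factors_through C (f \<cdot> g) r)}"
  unfolding is_sieve_def
proof (intro conjI ballI impI)
  fix g h assume *: "g \<in> {g \<in> Arr C. Cod C g = Dom C f \<and> (\<exists>r\<in>R. factors_through C (f \<cdot> g) r)}"
    "h \<in> Arr C" "Cod C h = Dom C g"
  then obtain r where "r \<in> R" "factors_through C (f \<cdot> g) r"
    by blast
  then have "factors_through C ((f \<cdot> g) \<cdot> h) r"
    using * assms factors_through_comp[of "f \<cdot> g" r h] by simp
  then have "factors_through C (f \<cdot> (g \<cdot> h)) r"
    using * assms(1) by (simp add: comp_assoc)
  then show "g \<cdot> h \<in> {g \<in> Arr C. Cod C g = Dom C f \<and> (\<exists>r\<in>R. factors_through C (f \<cdot> g) r)}"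
    using * \<open>r \<in> R\<close> by auto
qed auto

section \<open>Joins of partial maps in the base: gluing and stability\<close>

locale geometric_M_category = M_category U C M + Par: join_restriction_category U "Par C M" Par_rst
  for U :: "'v set set" and C :: "('o, 'a) cat" (structure) and M :: "'a set"
begin

text \<open>The partial maps \<open>(r, x r)\<close> are to be glued. Agreement on overlaps, which
  is the hypothesis on \<open>p\<close> and \<open>q\<close>, amounts to compatibility in
  \<open>Par\<close>; (J1) then identifies the domain of the join as the join of the
  domains.\<close>

lemma Par_joins:
  assumes R: "R \<subseteq> {m \<in> M. Cod C m = A}" and AB: "A \<in> Obj C" "B \<in> Obj C"
    and x: "\<And>r. r \<in> R \<Longrightarrow> x r \<in> Arr C \<and> Dom C (x r) = Dom C r \<and> Cod C (x r) = B"
    and compat: "\<And>r r' p q. r \<in> R \<Longrightarrow> r' \<in> R \<Longrightarrow> p \<in> Arr C \<Longrightarrow> q \<in> Arr C \<Longrightarrow>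
      Dom C p = Dom C q \<Longrightarrow> Cod C p = Dom C r \<Longrightarrow> Cod C q = Dom C r' \<Longrightarrow>
      r \<cdot> p = r' \<cdot> q \<Longrightarrow> x r \<cdot> p = x r' \<cdot> q"
  obtains m t where "m \<in> M" "Cod C m = A" "t \<in> Arr C" "Dom C t = Dom C m" "Cod C t = B"
    "is_join (hom_poset (Par C M) Par_rst A B) ((\<lambda>r. span_class C (r, x r)) ` R) (span_class C (m, t))"
    "is_join (hom_poset (Par C M) Par_rst A A) ((\<lambda>r. span_class C (r, r)) ` R) (span_class C (m, m))"
proof -
  let ?S = "(\<lambda>r. span_class C (r, x r)) ` R"
  have RA: "r \<in> M" "r \<in> Arr C" "Cod C r = A" if "r \<in> R" for r
    using that R M_Arr by auto
  have sub: "?S \<subseteq> Hom (Par C M) A B"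
    using RA x by (auto intro!: Par_HomI)
  have comp: "compatible_set (Par C M) Par_rst ?S"
    unfolding compatible_set_def
  proof (clarify, simp only: Par_rst_span)
    fix r r' assume r: "r \<in> R" "r' \<in> R"
    \<comment> \<open>The pullback of \<open>r\<close> along \<open>r'\<close> is the overlap of the
      two domains, and both composites to be compared live on it.\<close>
    obtain n' f' where pb: "is_pullback C r' r n' f'"
      using pullback_M[of r r'] RA[OF r(1)] RA[OF r(2)] by auto
    note D = pullbackD[OF pb]
    have "x r \<cdot> f' = x r' \<cdot> n'"
      using compat[of r r' f' n'] r D by simp
    moreover have "span_class C (r, x r) \<cdot>\<^bsub>Par C M\<^esub> span_class C (r', r') = span_class C (r' \<cdot> n', x r \<cdot> f')"
      using RA[OF r(1)] RA[OF r(2)] x[OF r(1)] pb by (intro Par_Comp) simp_all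
    moreover have "span_class C (r', x r') \<cdot>\<^bsub>Par C M\<^esub> span_class C (r, r) = span_class C (r \<cdot> f', x r' \<cdot> n')"
      using RA[OF r(1)] RA[OF r(2)] x[OF r(2)] pullback_sym[OF pb] by (intro Par_Comp) simp_all
    ultimately show "span_class C (r, x r) \<cdot>\<^bsub>Par C M\<^esub> span_class C (r', r') =
        span_class C (r', x r') \<cdot>\<^bsub>Par C M\<^esub> span_class C (r, r)"
      using D by simp
  qed
  obtain j where j: "is_join (hom_poset (Par C M) Par_rst A B) ?S j"
    using Par.joins[of A B ?S] AB sub comp by auto
  then have "j \<in> Hom (Par C M) A B"
    using is_joinD(1)[OF j] sub by (simp add: hom_poset_def)
  then obtain m t where m: "m \<in> M" "t \<in> Arr C" "Dom C m = Dom C t" "Cod C m = A" "Cod C t = B"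
    "j = span_class C (m, t)"
    by (rule Par_HomE)
  have "Par_rst ` ?S = (\<lambda>r. span_class C (r, r)) ` R"
    by (auto simp: Par_rst_span image_image)
  then have "is_join (hom_poset (Par C M) Par_rst A A) ((\<lambda>r. span_class C (r, r)) ` R) (span_class C (m, m))"
    using Par.J1[of A B ?S j] AB sub comp j m by (simp add: Par_rst_span)
  then show thesis
    using that[of m t] m j by simp
qed

text \<open>With \<open>x r = r\<close> the partial maps are restriction idempotents, and agreement
  on overlaps is trivial. This is how subobjects acquire joins.\<close>

lemma Par_joins_Ide:
  assumes "R \<subseteq> {m \<in> M. Cod C m = A}" "A \<in> Obj C"
  obtains m where "m \<in> M" "Cod C m = A"
    "is_join (hom_poset (Par C M) Par_rst A A) ((\<lambda>r. span_class C (r, r)) ` R) (span_class C (m, m))"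
proof (rule Par_joins[OF assms assms(2), of "\<lambda>r. r"])
  show "r \<in> Arr C \<and> Dom C r = Dom C r \<and> Cod C r = A" if "r \<in> R" for r
    using that assms M_Arr by auto
qed (use that in auto)

text \<open>Stability of joins under pullback is an instance of (J2): precompose with the total map \<open>f\<close>.\<close>

lemma Sub_join_pullback:
  assumes R: "R \<subseteq> {m \<in> M. Cod C m = A}" and A: "A \<in> Obj C" and m: "m \<in> M" "Cod C m = A"
    and j: "is_join (hom_poset (Par C M) Par_rst A A) ((\<lambda>r. span_class C (r, r)) ` R)
      (span_class C (m, m))"
    and f: "f \<in> Arr C" "Cod C f = A"
    and pb: "m' \<in> M" "is_pullback C f m m' f'"
    and pbR: "\<And>r. r \<in> R \<Longrightarrow> p r \<in> M \<and> is_pullback C f r (p r) (q r)"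
  shows "Sub_join C M (p ` R) m'"
proof -
  let ?X = "Dom C f"
  have RA: "r \<in> M" "r \<in> Arr C" "Cod C r = A" if "r \<in> R" for r
    using that R M_Arr by auto
  have X: "?X \<in> Obj C"
    using f Dom_Obj by blast
  have mA: "m \<in> Arr C"
    using m M_Arr by blast
  let ?S = "(\<lambda>r. span_class C (r, r)) ` R" and ?F = "span_class C (Ide C ?X, f)"
  have comp: "compatible_set (Par C M) Par_rst ?S"
    unfolding compatible_set_def
  proof (clarify, simp only: Par_rst_span)
    fix r r' assume "r \<in> R" "r' \<in> R"
    then have *: "span_class C (r, r) \<in> Hom (Par C M) A A" "span_class C (r', r') \<in> Hom (Par C M) A A"
      using RA by (auto intro!: Par_HomI)
    show "span_class C (r, r) \<cdot>\<^bsub>Par C M\<^esub> span_class C (r', r') =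
      span_class C (r', r') \<cdot>\<^bsub>Par C M\<^esub> span_class C (r, r)"
      using Par.R2[OF *] by (simp add: Par_rst_span)
  qed
  have sub: "?S \<subseteq> Hom (Par C M) A A"
    using RA by (auto intro!: Par_HomI)
  have F: "?F \<in> Hom (Par C M) ?X A"
    using f X by (intro Par_HomI) (simp_all add: Ide_M)
  \<comment> \<open>Because \<open>n \<cdot> h = f \<cdot> n'\<close>, the composite is
    \<open>f\<close> restricted to the preimage \<open>n'\<close> of \<open>n\<close>.\<close>
  have cmp: "span_class C (n, n) \<cdot>\<^bsub>Par C M\<^esub> ?F = span_class C (n', n \<cdot> h)"
    if "n \<in> M" "Cod C n = A" "is_pullback C f n n' h" for n n' h
  proof -
    have "n \<in> Arr C"
      using that M_Arr by blast
    then have "span_class C (n, n) \<cdot>\<^bsub>Par C M\<^esub> ?F = span_class C (Ide C ?X \<cdot> n', n \<cdot> h)"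
      using f X that by (intro Par_Comp) (simp_all add: Ide_M)
    then show ?thesis
      using pullbackD[OF that(3)] X by simp
  qed
  have ime: "(\<lambda>s. s \<cdot>\<^bsub>Par C M\<^esub> ?F) ` ?S = (\<lambda>r. span_class C (p r, r \<cdot> q r)) ` R"
    unfolding image_image using RA pbR cmp by (intro image_cong) auto
  have j2: "is_join (hom_poset (Par C M) Par_rst ?X A) ((\<lambda>r. span_class C (p r, r \<cdot> q r)) ` R)
      (span_class C (m', m \<cdot> f'))"
    using Par.J2[of A A ?S "span_class C (m, m)" ?F ?X] A sub comp j F cmp[OF m pb(2)] ime by simp
  \<comment> \<open>What (J2) yields is a join of partial maps from \<open>?X\<close> to
    \<open>A\<close>. Once these are known to be compatible, (J1) passes to their domains
    \<open>p r\<close>, and the values in \<open>A\<close> drop out.\<close>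
  have comp2: "compatible_set (Par C M) Par_rst ((\<lambda>r. span_class C (p r, r \<cdot> q r)) ` R)"
    unfolding compatible_set_def
  proof (clarify, simp only: Par_rst_span)
    fix r r' assume r: "r \<in> R" "r' \<in> R"
    let ?P = "span_class C (p r, r \<cdot> q r)" and ?P' = "span_class C (p r', r' \<cdot> q r')"
    obtain n' h where n: "is_pullback C (p r') (p r) n' h"
      using pullback_M[of "p r" "p r'"] pbR[OF r(1)] pbR[OF r(2)] M_Arr pullbackD(6) by metis
    note D = pullbackD[OF n] and Dr = pullbackD[OF conjunct2[OF pbR[OF r(1)]]]
      and Dr' = pullbackD[OF conjunct2[OF pbR[OF r(2)]]]
    have "?P \<cdot>\<^bsub>Par C M\<^esub> span_class C (p r', p r') = span_class C (p r' \<cdot> n', (r \<cdot> q r) \<cdot> h)"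
      using n pbR[OF r(1)] pbR[OF r(2)] Dr Dr' by (intro Par_Comp) simp_all
    moreover have "?P' \<cdot>\<^bsub>Par C M\<^esub> span_class C (p r, p r) = span_class C (p r \<cdot> h, (r' \<cdot> q r') \<cdot> n')"
      using pullback_sym[OF n] pbR[OF r(1)] pbR[OF r(2)] Dr Dr' by (intro Par_Comp) simp_all
    moreover have "(r \<cdot> q r) \<cdot> h = (f \<cdot> p r) \<cdot> h" "(r' \<cdot> q r') \<cdot> n' = (f \<cdot> p r') \<cdot> n'"
      using Dr Dr' by simp_all
    then have "(r \<cdot> q r) \<cdot> h = (r' \<cdot> q r') \<cdot> n'"
      using D Dr(1,3,6) Dr'(1,3,6) by (simp only: comp_assoc)
    ultimately show "?P \<cdot>\<^bsub>Par C M\<^esub> span_class C (p r', p r') = ?P' \<cdot>\<^bsub>Par C M\<^esub> span_class C (p r, p r)"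
      using D by simp
  qed
  have sub2: "(\<lambda>r. span_class C (p r, r \<cdot> q r)) ` R \<subseteq> Hom (Par C M) ?X A"
  proof clarify
    fix r assume r: "r \<in> R"
    note D = pullbackD[OF conjunct2[OF pbR[OF r]]]
    show "span_class C (p r, r \<cdot> q r) \<in> Hom (Par C M) ?X A"
      using D pbR[OF r] RA[OF r] by (intro Par_HomI) simp_all
  qed
  have ime2: "Par_rst ` (\<lambda>r. span_class C (p r, r \<cdot> q r)) ` R = (\<lambda>r. span_class C (r, r)) ` p ` R"
    by (simp add: image_image Par_rst_span)
  have "is_join (hom_poset (Par C M) Par_rst ?X ?X) ((\<lambda>r. span_class C (r, r)) ` p ` R)
      (span_class C (m', m'))"
    using Par.J1[OF _ _ sub2 comp2 j2] X A ime2 by (simp add: Par_rst_span)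
  moreover have "p ` R \<subseteq> {m \<in> M. Cod C m = ?X}"
    using pbR pullbackD(6) by blast
  ultimately show ?thesis
    using Sub_join_of_Par_join[of "p ` R" ?X m'] pb(1) pullbackD(6)[OF pb(2)] by blast
qed

text \<open>Let \<open>m'\<close> be the pullback of \<open>m\<close> along \<open>f\<close>; then
  \<open>f\<close> factors through \<open>m\<close> iff the identity factors through
  \<open>m'\<close>. By stability \<open>m'\<close> is the join of the pullbacks of the members of
  \<open>R\<close>. If the identity factors through it, these pullbacks form a basic cover inside
  the sieve. Conversely, every member of the sieve factors through \<open>m'\<close>, so a cover
  among them forces the identity to do so.\<close>

theorem M_join:
  assumes R: "R \<subseteq> {m \<in> M. Cod C m = A}" and A: "A \<in> Obj C"
  obtains m where "m \<in> M" "Cod C m = A"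
    "\<And>f. f \<in> Arr C \<Longrightarrow> Cod C f = A \<Longrightarrow> factors_through C f m \<longleftrightarrow>
      {g \<in> Arr C. Cod C g = Dom C f \<and> (\<exists>r\<in>R. factors_through C (f \<cdot> g) r)} \<in> M_topology C M (Dom C f)"
proof -
  obtain m where m: "m \<in> M" "Cod C m = A"
    "is_join (hom_poset (Par C M) Par_rst A A) ((\<lambda>r. span_class C (r, r)) ` R) (span_class C (m, m))"
    using Par_joins_Ide[OF R A] .
  have RA: "r \<in> M" "r \<in> Arr C" "Cod C r = A" if "r \<in> R" for r
    using that R M_Arr by auto
  have mA: "m \<in> Arr C"
    using m M_Arr by blast
  have up: "factors_through C r m" if "r \<in> R" for r
    using Sub_join_of_Par_join[OF R m] that unfolding Sub_join_def by blast
  have "factors_through C f m \<longleftrightarrow>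
      {g \<in> Arr C. Cod C g = Dom C f \<and> (\<exists>r\<in>R. factors_through C (f \<cdot> g) r)} \<in> M_topology C M (Dom C f)"
    (is "_ \<longleftrightarrow> ?S \<in> _") if f: "f \<in> Arr C" "Cod C f = A" for f
  proof
    have X: "Dom C f \<in> Obj C"
      using f Dom_Obj by blast
    obtain m' f' where pb: "m' \<in> M" "is_pullback C f m m' f'"
      using pullback_M[of m f] m f by auto
    note D = pullbackD[OF pb(2)]
    {
      assume "factors_through C f m"
      then obtain k where k: "k \<in> Arr C" "Dom C f = Dom C k" "Cod C k = Dom C m" "f = m \<cdot> k"
        by (rule factors_throughE)
      obtain w where w: "w \<in> Arr C" "Dom C w = Dom C f" "Cod C w = Dom C m'" "m' \<cdot> w = Ide C (Dom C f)"
        using pullback_univ[OF pb(2), of "Ide C (Dom C f)" k] k(1-3) k(4)[symmetric] f X by auto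
      have "\<forall>r. \<exists>p q. r \<in> R \<longrightarrow> p \<in> M \<and> is_pullback C f r p q"
        using pullback_M RA f by metis
      then obtain p q where pq: "\<And>r. r \<in> R \<Longrightarrow> p r \<in> M \<and> is_pullback C f r (p r) (q r)"
        by metis
      have j: "Sub_join C M (p ` R) m'"
        by (rule Sub_join_pullback[OF R A m f pb pq])
      have "basic_cover C M (Dom C f) (p ` R)"
        unfolding basic_cover_iff[OF X]
      proof (intro conjI ballI impI)
        show "p ` R \<subseteq> {m \<in> M. Cod C m = Dom C f}"
          using pq pullbackD(6) by blast
        fix n assume n: "n \<in> M" "Cod C n = Dom C f" "\<forall>r\<in>p ` R. factors_through C r n"
        then have *: "factors_through C m' n"
          using j D unfolding Sub_join_def by simp
        have "factors_through C (Ide C (Dom C f)) m'"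
          using w X by (intro factors_throughI[of w]) simp_all
        then show "factors_through C (Ide C (Dom C f)) n"
          using * M_Arr[OF n(1)] by (rule factors_through_trans)
      qed
      moreover have "p ` R \<subseteq> ?S"
      proof clarify
        fix r assume r: "r \<in> R"
        note D = pullbackD[OF conjunct2[OF pq[OF r]]]
        have "factors_through C (f \<cdot> p r) r"
          using D by (intro factors_throughI[of "q r"]) simp_all
        then show "p r \<in> Arr C \<and> Cod C (p r) = Dom C f \<and> (\<exists>r'\<in>R. factors_through C (f \<cdot> p r) r')"
          using r D by blast
      qed
      moreover have "is_sieve C (Dom C f) ?S"
        by (rule sieve_generated) (use f RA in auto)
      ultimately show "?S \<in> M_topology C M (Dom C f)"
        unfolding M_topology_def by blast
    next
      assume "?S \<in> M_topology C M (Dom C f)"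
      then obtain T where T: "T \<subseteq> ?S" "basic_cover C M (Dom C f) T"
        unfolding M_topology_def by blast
      have "factors_through C t m'" if tT: "t \<in> T" for t
      proof -
        obtain r where r: "r \<in> R" "factors_through C (f \<cdot> t) r" and t: "t \<in> Arr C" "Cod C t = Dom C f"
          using tT T(1) by blast
        have "factors_through C (f \<cdot> t) m"
          using r up mA factors_through_trans by blast
        then obtain k where k: "k \<in> Arr C" "Dom C (f \<cdot> t) = Dom C k" "Cod C k = Dom C m" "f \<cdot> t = m \<cdot> k"
          by (rule factors_throughE)
        obtain w where "w \<in> Arr C" "Dom C w = Dom C t" "Cod C w = Dom C m'" "m' \<cdot> w = t"
          using pullback_univ[OF pb(2), of t k] k t f mA m(2) comp_Arr(2)[of t f] by auto
        then show ?thesis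
          by (intro factors_throughI[of w]) simp_all
      qed
      then have "factors_through C (Ide C (Dom C f)) m'"
        using T(2) pb(1) D(6) unfolding basic_cover_iff[OF X] by blast
      then obtain k where k: "k \<in> Arr C" "Dom C (Ide C (Dom C f)) = Dom C k" "Cod C k = Dom C m'"
          "Ide C (Dom C f) = m' \<cdot> k"
        by (rule factors_throughE)
      have "m \<cdot> (f' \<cdot> k) = (m \<cdot> f') \<cdot> k"
        using k(1,3) D(1-8) by (simp add: comp_assoc)
      also have "\<dots> = (f \<cdot> m') \<cdot> k"
        using D(9) by simp
      also have "\<dots> = f \<cdot> (m' \<cdot> k)"
        using k(1,3) D(1-8) by (simp add: comp_assoc)
      also have "\<dots> = f"
        using k(4)[symmetric] f by simp
      finally have "f = m \<cdot> (f' \<cdot> k)"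
        by simp
      then show "factors_through C f m"
        using k(1-3) D X by (intro factors_throughI[of "f' \<cdot> k"]) simp_all
    }
  qed
  then show thesis
    using that m by blast
qed

section \<open>Covering sieves: stability, separation and gluing of arrows\<close>

lemma cover_sieve:
  assumes "S \<in> M_topology C M A" "f \<in> S"
  shows "f \<in> Arr C" "Cod C f = A" "g \<in> Arr C \<Longrightarrow> Cod C g = Dom C f \<Longrightarrow> f \<cdot> g \<in> S"
  using assms unfolding M_topology_def is_sieve_def by auto

lemma cover_factors:
  assumes "S \<in> M_topology C M A" "A \<in> Obj C" "m \<in> M" "Cod C m = A"
    "\<And>f. f \<in> S \<Longrightarrow> factors_through C f m"
  shows "factors_through C (Ide C A) m"
proof -
  obtain R where "R \<subseteq> S" "basic_cover C M A R"
    using assms(1) unfolding M_topology_def by blast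
  then show ?thesis
    using assms unfolding basic_cover_iff[OF assms(2)] by blast
qed

lemma cover_mono:
  "S \<in> M_topology C M A \<Longrightarrow> S \<subseteq> T \<Longrightarrow> is_sieve C A T \<Longrightarrow> T \<in> M_topology C M A"
  unfolding M_topology_def by blast

lemma cover_maximal:
  assumes "A \<in> Obj C"
  shows "{f \<in> Arr C. Cod C f = A} \<in> M_topology C M A"
proof -
  have "basic_cover C M A {Ide C A}"
    using assms by (simp add: basic_cover_iff Ide_M)
  moreover have "is_sieve C A {f \<in> Arr C. Cod C f = A}"
    by (simp add: is_sieve_def)
  ultimately show ?thesis
    using assms unfolding M_topology_def by (auto intro!: exI[of _ "{Ide C A}"])
qed

text \<open>Let \<open>R\<close> be a basic cover inside \<open>S\<close> and \<open>m\<close> its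
  join as given by \<open>M_join\<close>. The criterion at the identity shows that the identity
  factors through \<open>m\<close>; hence so does \<open>f\<close>, and the criterion at
  \<open>f\<close> says that the pulled-back sieve covers.\<close>

lemma cover_pullback:
  assumes "S \<in> M_topology C M A" "A \<in> Obj C" "f \<in> Arr C" "Cod C f = A"
  shows "{g \<in> Arr C. Cod C g = Dom C f \<and> f \<cdot> g \<in> S} \<in> M_topology C M (Dom C f)"
proof -
  obtain R where R: "R \<subseteq> S" "basic_cover C M A R"
    using assms(1) unfolding M_topology_def by blast
  then have RM: "R \<subseteq> {m \<in> M. Cod C m = A}"
    by (simp add: basic_cover_def)
  obtain m where m: "m \<in> M" "Cod C m = A"
    "\<And>f. f \<in> Arr C \<Longrightarrow> Cod C f = A \<Longrightarrow> factors_through C f m \<longleftrightarrow>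
      {g \<in> Arr C. Cod C g = Dom C f \<and> (\<exists>r\<in>R. factors_through C (f \<cdot> g) r)} \<in> M_topology C M (Dom C f)"
    using M_join[OF RM assms(2)] by blast
  let ?T = "{g \<in> Arr C. Cod C g = Dom C (Ide C A) \<and> (\<exists>r\<in>R. factors_through C (Ide C A \<cdot> g) r)}"
  have "R \<subseteq> ?T"
    using RM M_Arr assms(2) by (auto intro!: bexI factors_through_refl)
  moreover have "is_sieve C (Dom C (Ide C A)) ?T"
    by (rule sieve_generated) (use RM M_Arr assms(2) in auto)
  ultimately have "?T \<in> M_topology C M (Dom C (Ide C A))"
    using R(2) assms(2) unfolding M_topology_def by auto
  then have "factors_through C (Ide C A) m"
    using m(3)[of "Ide C A"] assms(2) by simp
  then have "factors_through C f m"
    using factors_through_Ide_iff[of m A] m M_Arr assms by auto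
  then have "{g \<in> Arr C. Cod C g = Dom C f \<and> (\<exists>r\<in>R. factors_through C (f \<cdot> g) r)} \<in> M_topology C M (Dom C f)"
    using m(3) assms by blast
  moreover have "is_sieve C (Dom C f) {g \<in> Arr C. Cod C g = Dom C f \<and> f \<cdot> g \<in> S}"
    using assms cover_sieve[OF assms(1)] unfolding is_sieve_def by (auto simp: comp_assoc[symmetric])
  moreover have "factors_through C (f \<cdot> g) r \<Longrightarrow> r \<in> R \<Longrightarrow> f \<cdot> g \<in> S" for g r
    using R(1) cover_sieve[OF assms(1)] by (auto elim!: factors_throughE)
  ultimately show ?thesis
    by (elim cover_mono) auto
qed

text \<open>The partial maps \<open>(r, u \<cdot> r)\<close>, for \<open>r\<close> in a basic cover,
  have a join \<open>(m, t)\<close>. Both total maps \<open>u\<close> and \<open>v\<close> are upper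
  bounds, so \<open>t\<close> is the restriction of each to \<open>m\<close>. Since \<open>R\<close>
  covers, \<open>m\<close> has a right inverse \<open>k\<close>, which cancels it.\<close>

lemma cover_separates:
  assumes S: "S \<in> M_topology C M A" and A: "A \<in> Obj C"
    and u: "u \<in> Arr C" "Dom C u = A" and v: "v \<in> Arr C" "Dom C v = A" "Cod C u = Cod C v"
    and eq: "\<And>f. f \<in> S \<Longrightarrow> u \<cdot> f = v \<cdot> f"
  shows "u = v"
proof -
  let ?B = "Cod C u"
  obtain R where R: "R \<subseteq> S" "basic_cover C M A R"
    using S unfolding M_topology_def by blast
  have RM: "R \<subseteq> {m \<in> M. Cod C m = A}"
    using R by (simp add: basic_cover_def)
  have RA: "r \<in> M" "r \<in> Arr C" "Cod C r = A" "r \<in> S" if "r \<in> R" for r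
    using that RM R M_Arr by auto
  have B: "?B \<in> Obj C"
    using u Cod_Obj by blast
  obtain m t where m: "m \<in> M" "Cod C m = A" and t: "t \<in> Arr C" "Dom C t = Dom C m" "Cod C t = ?B"
    and j: "is_join (hom_poset (Par C M) Par_rst A ?B) ((\<lambda>r. span_class C (r, u \<cdot> r)) ` R) (span_class C (m, t))"
      "is_join (hom_poset (Par C M) Par_rst A A) ((\<lambda>r. span_class C (r, r)) ` R) (span_class C (m, m))"
  proof (rule Par_joins[OF RM A B, of "\<lambda>r. u \<cdot> r"])
    show "u \<cdot> r \<in> Arr C \<and> Dom C (u \<cdot> r) = Dom C r \<and> Cod C (u \<cdot> r) = ?B" if "r \<in> R" for r
      using that RA u by simp
    show "(u \<cdot> r) \<cdot> p = (u \<cdot> r') \<cdot> q" if "r \<in> R" "r' \<in> R" "p \<in> Arr C" "q \<in> Arr C" "Dom C p = Dom C q"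
      "Cod C p = Dom C r" "Cod C q = Dom C r'" "r \<cdot> p = r' \<cdot> q" for r r' p q
      using that RA u by (simp add: comp_assoc)
  qed
  have sub: "(\<lambda>r. span_class C (r, u \<cdot> r)) ` R \<subseteq> carrier (hom_poset (Par C M) Par_rst A ?B)"
    using RA u by (auto simp: hom_poset_def intro!: Par_HomI)
  have "factors_through C (Ide C A) m"
    using Sub_join_of_Par_join[OF RM m j(2)] R(2) m unfolding basic_cover_iff[OF A] Sub_join_def
    by blast
  then obtain k where k: "k \<in> Arr C" "Dom C (Ide C A) = Dom C k" "Cod C k = Dom C m" "Ide C A = m \<cdot> k"
    by (rule factors_throughE)
  have mA: "m \<in> Arr C"
    using m M_Arr by blast
  \<comment> \<open>Stated for every \<open>w\<close> that agrees with \<open>u\<close> on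
    \<open>R\<close>, so that it applies to \<open>u\<close> and to \<open>v\<close>: the join lies
    below the total map \<open>(Ide C A, w)\<close>.\<close>
  have "t = w \<cdot> m" if w: "w \<in> Arr C" "Dom C w = A" "Cod C w = ?B" "\<And>r. r \<in> R \<Longrightarrow> u \<cdot> r = w \<cdot> r" for w
  proof -
    have "le (hom_poset (Par C M) Par_rst A ?B) (span_class C (m, t)) (span_class C (Ide C A, w))"
    proof (rule is_joinD(3)[OF j(1) sub])
      show "span_class C (Ide C A, w) \<in> carrier (hom_poset (Par C M) Par_rst A ?B)"
        using w A by (auto simp: hom_poset_def Ide_M intro!: Par_HomI)
      fix s assume "s \<in> (\<lambda>r. span_class C (r, u \<cdot> r)) ` R"
      then obtain r where r: "r \<in> R" "s = span_class C (r, u \<cdot> r)"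
        by blast
      have "\<exists>k\<in>Arr C. Dom C r = Dom C k \<and> Cod C k = Dom C (Ide C A) \<and> r = Ide C A \<cdot> k \<and> u \<cdot> r = w \<cdot> k"
        using r(1) RA w(4) A by (intro bexI[of _ r]) simp_all
      then show "le (hom_poset (Par C M) Par_rst A ?B) s (span_class C (Ide C A, w))"
        using r RA[OF r(1)] u w A Par_le_iff[of r "u \<cdot> r" A "Ide C A" w ?B] by (simp add: Ide_M)
    qed
    moreover have "le (hom_poset (Par C M) Par_rst A ?B) (span_class C (m, t)) (span_class C (Ide C A, w)) \<longleftrightarrow>
        (\<exists>h\<in>Arr C. Dom C m = Dom C h \<and> Cod C h = Dom C (Ide C A) \<and> m = Ide C A \<cdot> h \<and> t = w \<cdot> h)"
      by (rule Par_le_iff) (use m t w A in \<open>simp_all add: Ide_M\<close>)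
    ultimately obtain h where "h \<in> Arr C" "Cod C h = A" "m = Ide C A \<cdot> h" "t = w \<cdot> h"
      using A by (metis ide_Arr(2))
    then show ?thesis
      using A by simp
  qed
  then have "u \<cdot> m = v \<cdot> m"
    using u v eq RA by metis
  then have "(u \<cdot> m) \<cdot> k = (v \<cdot> m) \<cdot> k"
    by simp
  moreover have "(w \<cdot> m) \<cdot> k = w" if "w \<in> Arr C" "Dom C w = A" for w
    using that k(1,3) k(4)[symmetric] mA m by (simp add: comp_assoc)
  ultimately show "u = v"
    using u v by simp
qed

text \<open>The join \<open>(m, t)\<close> of the partial maps \<open>(r, x r)\<close>, for
  \<open>r\<close> in a basic cover, has a domain through which the identity factors by some
  \<open>k\<close>; the glued arrow is \<open>t \<cdot> k\<close>. It has the right restrictions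
  along \<open>R\<close>, and separation extends this to the whole sieve.\<close>

lemma cover_glues:
  assumes S: "S \<in> M_topology C M A" and A: "A \<in> Obj C" and B: "B \<in> Obj C"
    and x: "\<And>f. f \<in> S \<Longrightarrow> x f \<in> Arr C \<and> Dom C (x f) = Dom C f \<and> Cod C (x f) = B"
    and match: "\<And>f g. f \<in> S \<Longrightarrow> g \<in> Arr C \<Longrightarrow> Cod C g = Dom C f \<Longrightarrow> x f \<cdot> g = x (f \<cdot> g)"
  obtains t where "t \<in> Arr C" "Dom C t = A" "Cod C t = B" "\<And>f. f \<in> S \<Longrightarrow> t \<cdot> f = x f"
proof -
  obtain R where R: "R \<subseteq> S" "basic_cover C M A R"
    using S unfolding M_topology_def by blast
  have RM: "R \<subseteq> {m \<in> M. Cod C m = A}"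
    using R by (simp add: basic_cover_def)
  have RA: "r \<in> M" "r \<in> Arr C" "Cod C r = A" "r \<in> S" if "r \<in> R" for r
    using that RM R M_Arr by auto
  obtain m t where m: "m \<in> M" "Cod C m = A" and t: "t \<in> Arr C" "Dom C t = Dom C m" "Cod C t = B"
    and j: "is_join (hom_poset (Par C M) Par_rst A B) ((\<lambda>r. span_class C (r, x r)) ` R) (span_class C (m, t))"
      "is_join (hom_poset (Par C M) Par_rst A A) ((\<lambda>r. span_class C (r, r)) ` R) (span_class C (m, m))"
  proof (rule Par_joins[OF RM A B, of x])
    show "x r \<in> Arr C \<and> Dom C (x r) = Dom C r \<and> Cod C (x r) = B" if "r \<in> R" for r
      using that RA x by blast
    \<comment> \<open>Both sides are the value of \<open>x\<close> at the common arrow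
      \<open>r \<cdot> p = r' \<cdot> q\<close> of the sieve.\<close>
    show "x r \<cdot> p = x r' \<cdot> q" if "r \<in> R" "r' \<in> R" "p \<in> Arr C" "q \<in> Arr C" "Dom C p = Dom C q"
      "Cod C p = Dom C r" "Cod C q = Dom C r'" "r \<cdot> p = r' \<cdot> q" for r r' p q
      using that RA match[of r p] match[of r' q] by simp
  qed
  have sub: "(\<lambda>r. span_class C (r, x r)) ` R \<subseteq> carrier (hom_poset (Par C M) Par_rst A B)"
    using RA x by (auto simp: hom_poset_def intro!: Par_HomI)
  have "factors_through C (Ide C A) m"
    using Sub_join_of_Par_join[OF RM m j(2)] R(2) m unfolding basic_cover_iff[OF A] Sub_join_def
    by blast
  then obtain k where k: "k \<in> Arr C" "Dom C k = A" "Cod C k = Dom C m" "m \<cdot> k = Ide C A"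
    using A by (metis factors_throughE ide_Arr(2))
  have mA: "m \<in> Arr C"
    using m M_Arr by blast
  have tR: "(t \<cdot> k) \<cdot> r = x r" if r: "r \<in> R" for r
  proof -
    have "le (hom_poset (Par C M) Par_rst A B) (span_class C (r, x r)) (span_class C (m, t))"
      using is_joinD(2)[OF j(1) sub] r by blast
    moreover have "le (hom_poset (Par C M) Par_rst A B) (span_class C (r, x r)) (span_class C (m, t)) \<longleftrightarrow>
        (\<exists>h\<in>Arr C. Dom C r = Dom C h \<and> Cod C h = Dom C m \<and> r = m \<cdot> h \<and> x r = t \<cdot> h)"
      by (rule Par_le_iff) (use m t RA[OF r] x[of r] in simp_all)
    ultimately obtain h where h: "h \<in> Arr C" "Dom C r = Dom C h" "Cod C h = Dom C m"
        "r = m \<cdot> h" "x r = t \<cdot> h"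
      by blast
    have "m \<cdot> (k \<cdot> r) = (m \<cdot> k) \<cdot> r"
      using k(1-3) mA RA[OF r] by (simp add: comp_assoc)
    then have "m \<cdot> (k \<cdot> r) = m \<cdot> h"
      using k(4) RA[OF r] h(4) by simp
    then have "k \<cdot> r = h"
      using k(1-3) mA RA[OF r] h(1-3) M_cancel[OF m(1), of "k \<cdot> r" h] by simp
    then show ?thesis
      using k(1-3) t RA[OF r] h(5) by (simp add: comp_assoc)
  qed
  have tk: "t \<cdot> k \<in> Arr C" "Dom C (t \<cdot> k) = A" "Cod C (t \<cdot> k) = B"
    using k(1-3) t by simp_all
  let ?G = "{g \<in> Arr C. Cod C g = A \<and> (\<exists>r\<in>R. factors_through C g r)}"
  have "is_sieve C A ?G"
    using sieve_generated[of "Ide C A" R] RA A by (simp cong: conj_cong)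
  moreover have "R \<subseteq> ?G"
    using RA factors_through_refl by blast
  ultimately have G: "?G \<in> M_topology C M A"
    using R(2) unfolding M_topology_def by blast
  \<comment> \<open>An arrow \<open>f\<close> of \<open>S\<close> need not factor through a member
    of \<open>R\<close>, but the arrows \<open>g\<close> for which \<open>f \<cdot> g\<close> does
    form a cover of its domain; equality is tested there.\<close>
  have "(t \<cdot> k) \<cdot> f = x f" if f: "f \<in> S" for f
  proof (rule cover_separates)
    note fA = cover_sieve[OF S f]
    show "{g \<in> Arr C. Cod C g = Dom C f \<and> f \<cdot> g \<in> ?G} \<in> M_topology C M (Dom C f)"
      using cover_pullback[OF G A] fA by blast
    show "Dom C f \<in> Obj C"
      using fA Dom_Obj by blast
    fix g assume "g \<in> {g \<in> Arr C. Cod C g = Dom C f \<and> f \<cdot> g \<in> ?G}"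
    then obtain r where g: "g \<in> Arr C" "Cod C g = Dom C f" and r: "r \<in> R" "factors_through C (f \<cdot> g) r"
      by blast
    obtain h where h: "h \<in> Arr C" "Dom C (f \<cdot> g) = Dom C h" "Cod C h = Dom C r" "f \<cdot> g = r \<cdot> h"
      using r(2) by (rule factors_throughE)
    have "((t \<cdot> k) \<cdot> f) \<cdot> g = (t \<cdot> k) \<cdot> (r \<cdot> h)"
      using h(4) g fA tk by (simp add: comp_assoc)
    also have "\<dots> = x r \<cdot> h"
      using tR[OF r(1)] h(1,3) RA[OF r(1)] tk by (metis comp_assoc)
    also have "\<dots> = x (f \<cdot> g)"
      using match[of r h] RA[OF r(1)] h by simp
    also have "\<dots> = x f \<cdot> g"
      using match[OF f] g by simp
    finally show "((t \<cdot> k) \<cdot> f) \<cdot> g = x f \<cdot> g" .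
  qed (use cover_sieve[OF S f] tk x[OF f] in simp_all)
  then show thesis
    using that tk by blast
qed

end


section \<open>Sheaves\<close>

text \<open>The components are restricted because \<open>is_nat_trans\<close> asks for extensional
  functions, so that equal transformations are equal in HOL.\<close>

definition nat_of ::
  "('o, 'a, 'v) presheaf \<Rightarrow> ('o, 'a, 'v) presheaf \<Rightarrow> ('o \<Rightarrow> 'v \<Rightarrow> 'v) \<Rightarrow> ('o, 'a, 'v) nat_trans" where
  "nat_of P Q h = \<lparr>src = P, tgt = Q, cmp = (\<lambda>A. \<lambda>x\<in>sec P A. h A x)\<rparr>"

lemma nat_of_simps [simp]:
  "src (nat_of P Q h) = P" "tgt (nat_of P Q h) = Q"
  "x \<in> sec P A \<Longrightarrow> cmp (nat_of P Q h) A x = h A x"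
  by (simp_all add: nat_of_def)

text \<open>For each \<open>q\<close>, the sieve of arrows along which \<open>q\<close> restricts
  into \<open>T\<close> is the principal sieve of an \<open>M\<close>-subobject. With
  \<open>T\<close> the image of a map this is the pullback condition on \<open>M\<close>-maps under
  Yoneda; with \<open>T\<close> the domain of a partial map it makes the inclusion of that domain an
  \<open>M\<close>-map.\<close>

definition classified ::
  "('o, 'a) cat \<Rightarrow> 'a set \<Rightarrow> ('o, 'a, 'v) presheaf \<Rightarrow> ('o \<Rightarrow> 'v set) \<Rightarrow> bool" where
  "classified C M P T \<longleftrightarrow> (\<forall>D\<in>Obj C. \<forall>q\<in>sec P D. \<exists>m\<in>M. Cod C m = D \<and>
     (\<forall>f\<in>Arr C. Cod C f = D \<longrightarrow> (res P f q \<in> T (Dom C f) \<longleftrightarrow> factors_through C f m)))"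

lemma classifiedE:
  assumes "classified C M P T" "D \<in> Obj C" "q \<in> sec P D"
  obtains m where "m \<in> M" "Cod C m = D"
    "\<And>f. f \<in> Arr C \<Longrightarrow> Cod C f = D \<Longrightarrow> res P f q \<in> T (Dom C f) \<longleftrightarrow> factors_through C f m"
  using assms unfolding classified_def by blast

definition sub_presheaf ::
  "('o, 'a) cat \<Rightarrow> ('o, 'a, 'v) presheaf \<Rightarrow> ('o \<Rightarrow> 'v set) \<Rightarrow> ('o, 'a, 'v) presheaf" where
  "sub_presheaf C P T =
     \<lparr>sec = T, res = (\<lambda>f. if f \<in> Arr C then restrict (res P f) (T (Cod C f)) else (\<lambda>_. undefined))\<rparr>"

section \<open>The categories of presheaves and of sheaves\<close>

context category
begin

lemma presheafD:
  assumes "is_presheaf U C P"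
  shows presheaf_sec_Obj: "x \<in> sec P A \<Longrightarrow> A \<in> Obj C"
    and presheaf_sec: "A \<in> Obj C \<Longrightarrow> sec P A \<in> U"
    and presheaf_res: "f \<in> Arr C \<Longrightarrow> x \<in> sec P (Cod C f) \<Longrightarrow> res P f x \<in> sec P (Dom C f)"
    and presheaf_res_Ide: "x \<in> sec P A \<Longrightarrow> res P (Ide C A) x = x"
    and presheaf_res_comp: "f \<in> Arr C \<Longrightarrow> g \<in> Arr C \<Longrightarrow> Cod C f = Dom C g \<Longrightarrow>
      x \<in> sec P (Cod C g) \<Longrightarrow> res P (g \<cdot> f) x = res P f (res P g x)"
proof -
  have a: "if A \<in> Obj C then sec P A \<in> U else sec P A = {}" for A
    using assms unfolding is_presheaf_def by blast
  show o: "A \<in> Obj C" if "x \<in> sec P A" for x A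
    using a[of A] that by (auto split: if_splits)
  show "sec P A \<in> U" if "A \<in> Obj C" for A
    using a[of A] that by simp
  have "if f \<in> Arr C then res P f \<in> sec P (Cod C f) \<rightarrow>\<^sub>E sec P (Dom C f) else res P f = (\<lambda>_. undefined)" for f
    using assms unfolding is_presheaf_def by blast
  then show "res P f x \<in> sec P (Dom C f)" if "f \<in> Arr C" "x \<in> sec P (Cod C f)" for f x
    using that by (metis PiE_mem)
  show "res P (Ide C A) x = x" if "x \<in> sec P A" for x A
    using assms o[OF that] that unfolding is_presheaf_def by blast
  show "res P (g \<cdot> f) x = res P f (res P g x)" if "f \<in> Arr C" "g \<in> Arr C" "Cod C f = Dom C g"
    "x \<in> sec P (Cod C g)" for f g x
    using assms that unfolding is_presheaf_def by blast
qed

lemma nat_transD: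
  assumes "is_nat_trans U C \<phi>"
  shows nat_src: "is_presheaf U C (src \<phi>)" and nat_tgt: "is_presheaf U C (tgt \<phi>)"
    and nat_cmp: "x \<in> sec (src \<phi>) A \<Longrightarrow> cmp \<phi> A x \<in> sec (tgt \<phi>) A"
    and nat_res: "f \<in> Arr C \<Longrightarrow> x \<in> sec (src \<phi>) (Cod C f) \<Longrightarrow>
      cmp \<phi> (Dom C f) (res (src \<phi>) f x) = res (tgt \<phi>) f (cmp \<phi> (Cod C f) x)"
  using assms unfolding is_nat_trans_def by (blast, blast, meson PiE_mem, blast)

lemma nat_trans_eqI:
  assumes "is_nat_trans U C \<phi>" "is_nat_trans U C \<psi>" "src \<phi> = src \<psi>" "tgt \<phi> = tgt \<psi>"
    "\<And>A x. x \<in> sec (src \<phi>) A \<Longrightarrow> cmp \<phi> A x = cmp \<psi> A x"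
  shows "\<phi> = \<psi>"
proof -
  have "cmp \<phi> A = cmp \<psi> A" for A
  proof (rule PiE_ext)
    show "cmp \<phi> A \<in> sec (src \<phi>) A \<rightarrow>\<^sub>E sec (tgt \<phi>) A" "cmp \<psi> A \<in> sec (src \<phi>) A \<rightarrow>\<^sub>E sec (tgt \<phi>) A"
      using assms(1-4) unfolding is_nat_trans_def by simp_all
  qed (use assms(5) in blast)
  then show ?thesis
    using assms(3,4) by (intro nat_trans.equality ext) auto
qed

lemma nat_of_nat_trans:
  assumes "is_presheaf U C P" "is_presheaf U C Q"
    "\<And>A x. x \<in> sec P A \<Longrightarrow> h A x \<in> sec Q A"
    "\<And>f x. f \<in> Arr C \<Longrightarrow> x \<in> sec P (Cod C f) \<Longrightarrow> h (Dom C f) (res P f x) = res Q f (h (Cod C f) x)"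
  shows "is_nat_trans U C (nat_of P Q h)"
  unfolding is_nat_trans_def
  using assms presheaf_res[OF assms(1)] by (auto simp: nat_of_def)

lemma PSh_sel [simp]:
  "Obj (PSh U C) = {P. is_presheaf U C P}" "Arr (PSh U C) = {\<phi>. is_nat_trans U C \<phi>}"
  "Dom (PSh U C) = src" "Cod (PSh U C) = tgt"
  by (simp_all add: PSh_def)

lemma Sh_sel [simp]:
  "Obj (Sh U C J) = {P. is_sheaf U C J P}"
  "Arr (Sh U C J) = {\<phi>. is_nat_trans U C \<phi> \<and> is_sheaf U C J (src \<phi>) \<and> is_sheaf U C J (tgt \<phi>)}"
  "Dom (Sh U C J) = src" "Cod (Sh U C J) = tgt" "Ide (Sh U C J) = Ide (PSh U C)"
  "Comp (Sh U C J) = Comp (PSh U C)"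
  by (auto simp: Sh_def full_subcat_def is_sheaf_def)

lemma PSh_comp_sel [simp]:
  "src (\<psi> \<cdot>\<^bsub>PSh U C\<^esub> \<phi>) = src \<phi>" "tgt (\<psi> \<cdot>\<^bsub>PSh U C\<^esub> \<phi>) = tgt \<psi>"
  "x \<in> sec (src \<phi>) A \<Longrightarrow> cmp (\<psi> \<cdot>\<^bsub>PSh U C\<^esub> \<phi>) A x = cmp \<psi> A (cmp \<phi> A x)"
  by (simp_all add: PSh_def compose_def)

lemma PSh_ide_sel [simp]:
  "src (Ide (PSh U C) P) = P" "tgt (Ide (PSh U C) P) = P"
  "x \<in> sec P A \<Longrightarrow> cmp (Ide (PSh U C) P) A x = x"
  by (simp_all add: PSh_def)

lemma PSh_comp_nat:
  assumes "is_nat_trans U C \<phi>" "is_nat_trans U C \<psi>" "tgt \<phi> = src \<psi>"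
  shows "is_nat_trans U C (\<psi> \<cdot>\<^bsub>PSh U C\<^esub> \<phi>)"
proof -
  have "\<psi> \<cdot>\<^bsub>PSh U C\<^esub> \<phi> = nat_of (src \<phi>) (tgt \<psi>) (\<lambda>A x. cmp \<psi> A (cmp \<phi> A x))"
    by (simp add: PSh_def nat_of_def compose_def)
  moreover have "is_nat_trans U C (nat_of (src \<phi>) (tgt \<psi>) (\<lambda>A x. cmp \<psi> A (cmp \<phi> A x)))"
  proof (rule nat_of_nat_trans)
    show "is_presheaf U C (src \<phi>)" "is_presheaf U C (tgt \<psi>)"
      using assms nat_src nat_tgt by blast+
    show "cmp \<psi> A (cmp \<phi> A x) \<in> sec (tgt \<psi>) A" if "x \<in> sec (src \<phi>) A" for A x
      using nat_cmp[OF assms(2)] nat_cmp[OF assms(1) that] assms(3) by simp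
    show "cmp \<psi> (Dom C f) (cmp \<phi> (Dom C f) (res (src \<phi>) f x)) =
        res (tgt \<psi>) f (cmp \<psi> (Cod C f) (cmp \<phi> (Cod C f) x))"
      if "f \<in> Arr C" "x \<in> sec (src \<phi>) (Cod C f)" for f x
      using nat_res[OF assms(1) that] nat_res[OF assms(2) that(1), of "cmp \<phi> (Cod C f) x"]
        nat_cmp[OF assms(1) that(2)] assms(3) by simp
  qed
  ultimately show ?thesis by simp
qed

lemma PSh_ide_nat: "is_presheaf U C P \<Longrightarrow> is_nat_trans U C (Ide (PSh U C) P)"
proof -
  assume P: "is_presheaf U C P"
  have "Ide (PSh U C) P = nat_of P P (\<lambda>A x. x)"
    by (simp add: PSh_def nat_of_def)
  moreover have "is_nat_trans U C (nat_of P P (\<lambda>A x. x))"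
    using P by (intro nat_of_nat_trans) simp_all
  ultimately show ?thesis by simp
qed

lemma sheaf_presheaf: "is_sheaf U C J P \<Longrightarrow> is_presheaf U C P"
  by (simp add: is_sheaf_def)

text \<open>The restrictions of \<open>t'\<close> form a matching family, and both \<open>t\<close>
  and \<open>t'\<close> amalgamate it.\<close>

lemma sheaf_sep:
  assumes "is_sheaf U C J P" "A \<in> Obj C" "S \<in> J A" "is_sieve C A S" "t \<in> sec P A" "t' \<in> sec P A"
    "\<And>f. f \<in> S \<Longrightarrow> res P f t = res P f t'"
  shows "t = t'"
proof -
  note P = sheaf_presheaf[OF assms(1)]
  have S: "f \<in> Arr C" "Cod C f = A" if "f \<in> S" for f
    using assms(4) that unfolding is_sieve_def by blast+
  have "is_matching C P S (\<lambda>f. res P f t')"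
    unfolding is_matching_def
  proof (intro conjI ballI impI)
    fix f assume f: "f \<in> S"
    then show "res P f t' \<in> sec P (Dom C f)"
      using presheaf_res[OF P] S assms(6) by blast
    fix g assume "g \<in> Arr C" "Cod C g = Dom C f"
    then show "res P g (res P f t') = res P (f \<cdot> g) t'"
      using presheaf_res_comp[OF P, of g f t'] S[OF f] assms(6) by simp
  qed
  then have "\<exists>!t. t \<in> sec P A \<and> (\<forall>f\<in>S. res P f t = res P f t')"
    using assms(1-3) unfolding is_sheaf_def by blast
  then show ?thesis
    using assms(5-7) by blast
qed

lemma Sh_category: "category (Sh U C J)"
proof
  fix f A B g D h E
  assume "f \<in> Hom (Sh U C J) A B" "g \<in> Hom (Sh U C J) B D" "h \<in> Hom (Sh U C J) D E"
  then show "(h \<cdot>\<^bsub>Sh U C J\<^esub> g) \<cdot>\<^bsub>Sh U C J\<^esub> f = h \<cdot>\<^bsub>Sh U C J\<^esub> (g \<cdot>\<^bsub>Sh U C J\<^esub> f)"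
    by (intro nat_trans_eqI) (auto simp: in_Hom_iff nat_cmp intro!: PSh_comp_nat)
next
  fix f A B g D
  assume "f \<in> Hom (Sh U C J) A B" "g \<in> Hom (Sh U C J) B D"
  then show "g \<cdot>\<^bsub>Sh U C J\<^esub> f \<in> Hom (Sh U C J) A D"
    by (auto simp: in_Hom_iff intro!: PSh_comp_nat)
next
  fix f A B
  assume "f \<in> Hom (Sh U C J) A B"
  then show "f \<cdot>\<^bsub>Sh U C J\<^esub> Ide (Sh U C J) A = f" "Ide (Sh U C J) B \<cdot>\<^bsub>Sh U C J\<^esub> f = f"
    by (auto simp: in_Hom_iff nat_cmp sheaf_presheaf
        intro!: nat_trans_eqI PSh_comp_nat PSh_ide_nat)
qed (auto simp: in_Hom_iff sheaf_presheaf intro!: PSh_ide_nat)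

lemma sub_presheaf_sel [simp]:
  "sec (sub_presheaf C P T) = T"
  "f \<in> Arr C \<Longrightarrow> x \<in> T (Cod C f) \<Longrightarrow> res (sub_presheaf C P T) f x = res P f x"
  by (simp_all add: sub_presheaf_def)

end

section \<open>Subsheaves given by classified families\<close>

locale sheaf_site = geometric_M_category U C M
  for U :: "'v set set" and C :: "('o, 'v) cat" (structure) and M :: "'v set" +
  assumes universe: "set_universe U" and small_Objs: "small U (Obj C)" and small_Arrs: "small U (Arr C)"
begin

abbreviation "J \<equiv> M_topology C M"
abbreviation "SH \<equiv> Sh U C J"

sublocale SH: category SH
  by (rule Sh_category)

lemma cover_sep:
  assumes "is_sheaf U C J P" "A \<in> Obj C" "S \<in> J A" "t \<in> sec P A" "t' \<in> sec P A"
    "\<And>f. f \<in> S \<Longrightarrow> res P f t = res P f t'"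
  shows "t = t'"
proof -
  have "is_sieve C A S"
    using assms(3) by (simp add: M_topology_def)
  then show ?thesis
    using sheaf_sep assms by metis
qed

text \<open>The covering sieve is contained in the principal sieve of the classifying
  \<open>m\<close>, so the identity factors through \<open>m\<close>.\<close>

lemma classified_local:
  assumes P: "is_sheaf U C J P" and T: "classified C M P T" and A: "A \<in> Obj C"
    and S: "S \<in> J A" and x: "x \<in> sec P A" "\<And>f. f \<in> S \<Longrightarrow> res P f x \<in> T (Dom C f)"
  shows "x \<in> T A"
proof -
  obtain m where m: "m \<in> M" "Cod C m = A"
    "\<And>f. f \<in> Arr C \<Longrightarrow> Cod C f = A \<Longrightarrow> res P f x \<in> T (Dom C f) \<longleftrightarrow> factors_through C f m"
    using classifiedE[OF T A x(1)] by blast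
  have "factors_through C (Ide C A) m"
    using cover_factors[OF S A m(1,2)] x(2) m(3) cover_sieve[OF S] by blast
  then have "res P (Ide C A) x \<in> T A"
    using m(3)[of "Ide C A"] A by simp
  then show ?thesis
    using presheaf_res_Ide[OF sheaf_presheaf[OF P] x(1)] by simp
qed

text \<open>That \<open>x\<close> lies in \<open>T\<close> means that the identity factors through
  the classifying subobject, and then every arrow does.\<close>

lemma classified_res:
  assumes P: "is_sheaf U C J P" and T: "classified C M P T" and f: "f \<in> Arr C"
    and x: "x \<in> sec P (Cod C f)" "x \<in> T (Cod C f)"
  shows "res P f x \<in> T (Dom C f)"
proof -
  let ?A = "Cod C f"
  have A: "?A \<in> Obj C"
    using f Cod_Obj by blast
  obtain m where m: "m \<in> M" "Cod C m = ?A"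
    "\<And>f. f \<in> Arr C \<Longrightarrow> Cod C f = ?A \<Longrightarrow> res P f x \<in> T (Dom C f) \<longleftrightarrow> factors_through C f m"
    using classifiedE[OF T A x(1)] by blast
  have "factors_through C (Ide C ?A) m"
    using m(3)[of "Ide C ?A"] A x presheaf_res_Ide[OF sheaf_presheaf[OF P] x(1)] by simp
  then show ?thesis
    using factors_through_Ide_iff[of m ?A] m M_Arr f by auto
qed

text \<open>A matching family in \<open>T\<close> is amalgamated in \<open>P\<close>, and the
  amalgamation lies in \<open>T\<close> because membership is local. Uniqueness is inherited from
  \<open>P\<close>.\<close>

lemma sub_presheaf_sheaf:
  assumes P: "is_sheaf U C J P" and T: "classified C M P T" and sub: "\<And>A. T A \<subseteq> sec P A"
  shows "is_sheaf U C J (sub_presheaf C P T)" (is "is_sheaf U C J ?T")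
proof -
  note P' = sheaf_presheaf[OF P]
  have res: "res P f x \<in> T (Dom C f)" if "f \<in> Arr C" "x \<in> T (Cod C f)" for f x
    using classified_res[OF P T that(1)] that sub by blast
  have "is_presheaf U C ?T"
    unfolding is_presheaf_def
  proof (intro conjI allI ballI impI)
    show "if A \<in> Obj C then sec ?T A \<in> U else sec ?T A = {}" for A
    proof (cases "A \<in> Obj C")
      case True
      then show ?thesis
        using universe_subset[OF universe presheaf_sec[OF P' True] sub] by simp
    next
      case False
      then show ?thesis
        using presheaf_sec_Obj[OF P'] sub by auto
    qed
    show "if f \<in> Arr C then res ?T f \<in> sec ?T (Cod C f) \<rightarrow>\<^sub>E sec ?T (Dom C f) else res ?T f = (\<lambda>_. undefined)" for f
      using res by (auto simp: sub_presheaf_def)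
    show "res ?T (Ide C A) x = x" if "A \<in> Obj C" "x \<in> sec ?T A" for A x
      using that sub presheaf_res_Ide[OF P', of x A] by auto
    show "res ?T (g \<cdot> f) x = res ?T f (res ?T g x)"
      if "f \<in> Arr C" "g \<in> Arr C" "Cod C f = Dom C g" "x \<in> sec ?T (Cod C g)" for f g x
      using that sub res[of g x] presheaf_res_comp[OF P', of f g x] by auto
  qed
  moreover have "\<exists>!t. t \<in> sec ?T A \<and> (\<forall>f\<in>S. res ?T f t = x f)"
    if A: "A \<in> Obj C" and S: "S \<in> J A" and x: "is_matching C ?T S x" for A S x
  proof -
    note cs = cover_sieve[OF S]
    have xT: "x f \<in> T (Dom C f)" if "f \<in> S" for f
      using x that unfolding is_matching_def by simp
    have "is_matching C P S x"
      unfolding is_matching_def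
    proof (intro conjI ballI impI)
      show "x f \<in> sec P (Dom C f)" if "f \<in> S" for f
        using xT[OF that] sub by blast
      fix f g assume f: "f \<in> S" "g \<in> Arr C" "Cod C g = Dom C f"
      then have "res ?T g (x f) = x (f \<cdot> g)"
        using x unfolding is_matching_def by blast
      then show "res P g (x f) = x (f \<cdot> g)"
        using f xT by simp
    qed
    then have *: "\<exists>!t. t \<in> sec P A \<and> (\<forall>f\<in>S. res P f t = x f)"
      using P A S unfolding is_sheaf_def by blast
    then obtain t where t: "t \<in> sec P A" "\<And>f. f \<in> S \<Longrightarrow> res P f t = x f"
      by blast
    have tT: "t \<in> T A"
      by (rule classified_local[OF P T A S t(1)]) (use t(2) xT in simp)
    have r: "res ?T f s = res P f s" if "f \<in> S" "s \<in> T A" for f s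
      using cs(1,2)[OF that(1)] that(2) by simp
    show ?thesis
    proof (rule ex1I[of _ t])
      show "t \<in> sec ?T A \<and> (\<forall>f\<in>S. res ?T f t = x f)"
        using tT t(2) r by simp
      fix s assume "s \<in> sec ?T A \<and> (\<forall>f\<in>S. res ?T f s = x f)"
      then have "s \<in> sec P A" "\<forall>f\<in>S. res P f s = x f"
        using r sub by auto
      then show "s = t"
        using * t by blast
    qed
  qed
  ultimately show ?thesis
    unfolding is_sheaf_def by blast
qed

section \<open>Representable sheaves, the Yoneda lemma, and pullbacks on sections\<close>

lemma yo_sel [simp]:
  "A \<in> Obj C \<Longrightarrow> sec (yo_obj C D) A = Hom C A D"
  "f \<in> Arr C \<Longrightarrow> g \<in> Hom C (Cod C f) D \<Longrightarrow> res (yo_obj C D) f g = g \<cdot> f"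
  by (simp_all add: yo_obj_def)

lemma in_yo_iff: "g \<in> sec (yo_obj C D) A \<longleftrightarrow> g \<in> Arr C \<and> Dom C g = A \<and> Cod C g = D"
  using Dom_Obj by (auto simp: yo_obj_def in_Hom_iff)

lemma yo_presheaf: "is_presheaf U C (yo_obj C D)"
  unfolding is_presheaf_def
proof (intro conjI allI ballI impI)
  show "if A \<in> Obj C then sec (yo_obj C D) A \<in> U else sec (yo_obj C D) A = {}" for A
  proof (cases "A \<in> Obj C")
    case True
    have "Hom C A D \<subseteq> Arr C"
      by (auto simp: in_Hom_iff)
    then have "Hom C A D \<in> U"
      using small_subset[OF small_Arrs] small_iff_mem[OF universe] by blast
    then show ?thesis
      using True by simp
  qed (simp add: yo_obj_def)
  show "if f \<in> Arr C then res (yo_obj C D) f \<in> sec (yo_obj C D) (Cod C f) \<rightarrow>\<^sub>E sec (yo_obj C D) (Dom C f)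
      else res (yo_obj C D) f = (\<lambda>_. undefined)" for f
    using Dom_Obj Cod_Obj by (auto simp: yo_obj_def in_Hom_iff)
  show "res (yo_obj C D) (Ide C A) x = x" if "A \<in> Obj C" "x \<in> sec (yo_obj C D) A" for A x
    using that by (simp add: in_Hom_iff)
  show "res (yo_obj C D) (g \<cdot> f) x = res (yo_obj C D) f (res (yo_obj C D) g x)"
    if "f \<in> Arr C" "g \<in> Arr C" "Cod C f = Dom C g" "x \<in> sec (yo_obj C D) (Cod C g)" for f g x
    using that by (simp add: in_yo_iff in_Hom_iff comp_assoc)
qed

lemma yo_sheaf:
  assumes "D \<in> Obj C"
  shows "is_sheaf U C J (yo_obj C D)"
  unfolding is_sheaf_def
proof (intro conjI yo_presheaf ballI allI impI)
  fix A S x assume A: "A \<in> Obj C" and S: "S \<in> J A" and m: "is_matching C (yo_obj C D) S x"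
  note cs = cover_sieve[OF S]
  have x: "x f \<in> Arr C \<and> Dom C (x f) = Dom C f \<and> Cod C (x f) = D" if "f \<in> S" for f
    using m that in_yo_iff unfolding is_matching_def by blast
  have match: "x f \<cdot> g = x (f \<cdot> g)" if "f \<in> S" "g \<in> Arr C" "Cod C g = Dom C f" for f g
  proof -
    have "res (yo_obj C D) g (x f) = x (f \<cdot> g)"
      using m that unfolding is_matching_def by blast
    then show ?thesis
      using x[OF that(1)] that by (simp add: in_Hom_iff)
  qed
  obtain t where t: "t \<in> Arr C" "Dom C t = A" "Cod C t = D" "\<And>f. f \<in> S \<Longrightarrow> t \<cdot> f = x f"
    using cover_glues[OF S A assms x match] by blast
  have r: "res (yo_obj C D) f s = s \<cdot> f" if "f \<in> S" "s \<in> sec (yo_obj C D) A" for f s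
    using cs(1,2)[OF that(1)] that(2) by (simp add: in_yo_iff in_Hom_iff)
  show "\<exists>!t. t \<in> sec (yo_obj C D) A \<and> (\<forall>f\<in>S. res (yo_obj C D) f t = x f)"
  proof (rule ex1I[of _ t])
    have tA: "t \<in> sec (yo_obj C D) A"
      using t by (simp add: in_yo_iff)
    then show "t \<in> sec (yo_obj C D) A \<and> (\<forall>f\<in>S. res (yo_obj C D) f t = x f)"
      using t r[OF _ tA] by simp
    fix s assume s: "s \<in> sec (yo_obj C D) A \<and> (\<forall>f\<in>S. res (yo_obj C D) f s = x f)"
    show "s = t"
    proof (rule cover_separates[OF S A])
      show "s \<cdot> f = t \<cdot> f" if "f \<in> S" for f
        using s r[OF that] t(4)[OF that] that by metis
    qed (use s t in \<open>simp_all add: in_yo_iff\<close>)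
  qed
qed

text \<open>The map from a representable that corresponds to the section \<open>q\<close> under the
  Yoneda lemma.\<close>

definition yo_elem :: "('o, 'v, 'v) presheaf \<Rightarrow> 'o \<Rightarrow> 'v \<Rightarrow> ('o, 'v, 'v) nat_trans" where
  "yo_elem P D q = nat_of (yo_obj C D) P (\<lambda>A f. res P f q)"

lemma yo_elem:
  assumes "is_presheaf U C P" "q \<in> sec P D"
  shows "is_nat_trans U C (yo_elem P D q)" "src (yo_elem P D q) = yo_obj C D" "tgt (yo_elem P D q) = P"
    "f \<in> Arr C \<Longrightarrow> Cod C f = D \<Longrightarrow> cmp (yo_elem P D q) (Dom C f) f = res P f q"
proof -
  show "is_nat_trans U C (yo_elem P D q)"
    unfolding yo_elem_def
  proof (rule nat_of_nat_trans[OF yo_presheaf assms(1)])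
    show "res P f q \<in> sec P A" if "f \<in> sec (yo_obj C D) A" for A f
      using that presheaf_res[OF assms(1), of f q] assms(2) by (auto simp: in_yo_iff)
    show "res P (res (yo_obj C D) f g) q = res P f (res P g q)"
      if "f \<in> Arr C" "g \<in> sec (yo_obj C D) (Cod C f)" for f g
      using that presheaf_res_comp[OF assms(1), of f g q] assms(2) by (simp add: in_yo_iff in_Hom_iff)
  qed
qed (simp_all add: yo_elem_def in_yo_iff)

lemma Sh_Hom_iff: "\<phi> \<in> Hom SH P Q \<longleftrightarrow>
  is_nat_trans U C \<phi> \<and> is_sheaf U C J P \<and> is_sheaf U C J Q \<and> src \<phi> = P \<and> tgt \<phi> = Q"
  by (auto simp: in_Hom_iff)

text \<open>Sections over \<open>A\<close> are maps out of the representable at \<open>A\<close>.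
  This representable is a sheaf, so the universal property in \<open>SH\<close> may be tested on it,
  and the pullback is computed pointwise.\<close>

lemma Sh_pullback_elem:
  assumes pb: "is_pullback SH \<alpha> \<mu> \<pi> \<beta>" and a: "a \<in> sec (src \<alpha>) A" and x: "x \<in> sec (src \<mu>) A"
    and eq: "cmp \<alpha> A a = cmp \<mu> A x"
  shows "\<exists>!e. e \<in> sec (src \<pi>) A \<and> cmp \<pi> A e = a \<and> cmp \<beta> A e = x"
proof -
  note D = SH.pullbackD[OF pb, simplified]
  have N: "is_nat_trans U C \<alpha>" "is_nat_trans U C \<mu>" "is_nat_trans U C \<pi>" "is_nat_trans U C \<beta>"
    using D by simp_all
  have PS: "is_presheaf U C (src \<alpha>)" "is_presheaf U C (src \<mu>)" "is_presheaf U C (src \<pi>)" "is_presheaf U C (tgt \<alpha>)"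
    using N nat_src nat_tgt by blast+
  have A: "A \<in> Obj C"
    using presheaf_sec_Obj[OF PS(1) a] .
  note ya = yo_elem[OF PS(1) a] and yx = yo_elem[OF PS(2) x]
  have yA: "is_sheaf U C J (yo_obj C A)"
    by (rule yo_sheaf[OF A])
  have I: "cmp (yo_elem P A q) A (Ide C A) = q" if "is_presheaf U C P" "q \<in> sec P A" for P q
    using yo_elem(4)[OF that, of "Ide C A"] A presheaf_res_Ide[OF that] by simp
  have IA: "Ide C A \<in> sec (yo_obj C A) A"
    using A by (simp add: in_Hom_iff)
  have "\<exists>w. w \<in> Arr SH \<and> Dom SH w = Dom SH (yo_elem (src \<alpha>) A a) \<and> Cod SH w = Dom SH \<pi> \<and>
      \<pi> \<cdot>\<^bsub>SH\<^esub> w = yo_elem (src \<alpha>) A a \<and> \<beta> \<cdot>\<^bsub>SH\<^esub> w = yo_elem (src \<mu>) A x"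
  proof (rule SH.pullback_univ[OF pb])
    show "\<alpha> \<cdot>\<^bsub>SH\<^esub> yo_elem (src \<alpha>) A a = \<mu> \<cdot>\<^bsub>SH\<^esub> yo_elem (src \<mu>) A x"
    proof (rule nat_trans_eqI[where U = U])
      fix B f assume "f \<in> sec (src (\<alpha> \<cdot>\<^bsub>SH\<^esub> yo_elem (src \<alpha>) A a)) B"
      then have f: "f \<in> sec (yo_obj C A) B" "f \<in> Arr C" "Dom C f = B" "Cod C f = A"
        using ya(2) by (simp_all add: in_yo_iff)
      have "cmp \<alpha> B (res (src \<alpha>) f a) = cmp \<mu> B (res (src \<mu>) f x)"
        using nat_res[OF N(1) f(2), of a] nat_res[OF N(2) f(2), of x] f a x eq D by simp
      then show "cmp (\<alpha> \<cdot>\<^bsub>SH\<^esub> yo_elem (src \<alpha>) A a) B f = cmp (\<mu> \<cdot>\<^bsub>SH\<^esub> yo_elem (src \<mu>) A x) B f"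
        using ya(2) ya(4)[OF f(2,4)] yx(2) yx(4)[OF f(2,4)] f by simp
    qed (use D N ya yx in \<open>auto intro!: PSh_comp_nat\<close>)
  qed (use D N ya yx yA in simp_all)
  then obtain w where w: "is_nat_trans U C w" "src w = yo_obj C A" "tgt w = src \<pi>"
    "\<pi> \<cdot>\<^bsub>SH\<^esub> w = yo_elem (src \<alpha>) A a" "\<beta> \<cdot>\<^bsub>SH\<^esub> w = yo_elem (src \<mu>) A x"
    using ya(2) by auto
  \<comment> \<open>The section corresponding to the mediating map \<open>w\<close> is its value at
    the identity.\<close>
  let ?e = "cmp w A (Ide C A)"
  have e: "?e \<in> sec (src \<pi>) A"
    using nat_cmp[OF w(1), of "Ide C A" A] w IA by simp
  have "cmp (\<pi> \<cdot>\<^bsub>SH\<^esub> w) A (Ide C A) = a" "cmp (\<beta> \<cdot>\<^bsub>SH\<^esub> w) A (Ide C A) = x"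
    using w(4,5) I PS a x by simp_all
  then have ee: "cmp \<pi> A ?e = a" "cmp \<beta> A ?e = x"
    using w(2) IA by simp_all
  show ?thesis
  proof (rule ex1I[of _ ?e])
    fix e' assume e': "e' \<in> sec (src \<pi>) A \<and> cmp \<pi> A e' = a \<and> cmp \<beta> A e' = x"
    then have e'1: "e' \<in> sec (src \<pi>) A" by blast
    note y = yo_elem[OF PS(3) e] and y' = yo_elem[OF PS(3) e'1]
    \<comment> \<open>Equality of values at the single object \<open>A\<close> becomes equality of
      maps out of the representable, by naturality; this is the form in which joint monicity of the
      legs can be applied.\<close>
    have *: "\<gamma> \<cdot>\<^bsub>SH\<^esub> yo_elem (src \<pi>) A e' = \<gamma> \<cdot>\<^bsub>SH\<^esub> yo_elem (src \<pi>) A ?e"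
      if g: "is_nat_trans U C \<gamma>" "src \<gamma> = src \<pi>" "cmp \<gamma> A e' = cmp \<gamma> A ?e" for \<gamma>
    proof (rule nat_trans_eqI[where U = U])
      fix B f assume "f \<in> sec (src (\<gamma> \<cdot>\<^bsub>SH\<^esub> yo_elem (src \<pi>) A e')) B"
      then have f: "f \<in> sec (yo_obj C A) B" "f \<in> Arr C" "Dom C f = B" "Cod C f = A"
        using y'(2) by (simp_all add: in_yo_iff)
      have "cmp \<gamma> B (res (src \<pi>) f e') = cmp \<gamma> B (res (src \<pi>) f ?e)"
        using nat_res[OF g(1) f(2), of e'] nat_res[OF g(1) f(2), of ?e] f g e e'1 by simp
      then show "cmp (\<gamma> \<cdot>\<^bsub>SH\<^esub> yo_elem (src \<pi>) A e') B f = cmp (\<gamma> \<cdot>\<^bsub>SH\<^esub> yo_elem (src \<pi>) A ?e) B f"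
        using y(2) y(4)[OF f(2,4)] y'(2) y'(4)[OF f(2,4)] f by simp
    qed (use g y y' in \<open>auto intro!: PSh_comp_nat\<close>)
    have "yo_elem (src \<pi>) A e' = yo_elem (src \<pi>) A ?e"
    proof (rule SH.pullback_unique[OF pb])
      show "\<pi> \<cdot>\<^bsub>SH\<^esub> yo_elem (src \<pi>) A e' = \<pi> \<cdot>\<^bsub>SH\<^esub> yo_elem (src \<pi>) A ?e"
        by (rule *) (use N e' ee in simp_all)
      show "\<beta> \<cdot>\<^bsub>SH\<^esub> yo_elem (src \<pi>) A e' = \<beta> \<cdot>\<^bsub>SH\<^esub> yo_elem (src \<pi>) A ?e"
        by (rule *) (use N D e' ee in simp_all)
    qed (use y y' yA D in simp_all)
    then show "e' = ?e"
      using I[OF PS(3) e] I[OF PS(3) e'1] by simp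
  qed (use e ee in blast)
qed

text \<open>The mediating map is found pointwise by unique choice. Uniqueness of the chosen sections
  also yields naturality.\<close>

lemma Sh_pullbackI:
  assumes arr: "\<alpha> \<in> Arr SH" "\<mu> \<in> Arr SH" "\<pi> \<in> Arr SH" "\<beta> \<in> Arr SH"
    and D: "tgt \<alpha> = tgt \<mu>" "src \<beta> = src \<pi>" "tgt \<pi> = src \<alpha>" "tgt \<beta> = src \<mu>"
    and comm: "\<And>A e. e \<in> sec (src \<pi>) A \<Longrightarrow> cmp \<alpha> A (cmp \<pi> A e) = cmp \<mu> A (cmp \<beta> A e)"
    and univ: "\<And>A a x. a \<in> sec (src \<alpha>) A \<Longrightarrow> x \<in> sec (src \<mu>) A \<Longrightarrow> cmp \<alpha> A a = cmp \<mu> A x \<Longrightarrow>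
      \<exists>!e. e \<in> sec (src \<pi>) A \<and> cmp \<pi> A e = a \<and> cmp \<beta> A e = x"
  shows "is_pullback SH \<alpha> \<mu> \<pi> \<beta>"
proof (rule SH.pullbackI)
  have N: "is_nat_trans U C \<alpha>" "is_nat_trans U C \<mu>" "is_nat_trans U C \<pi>" "is_nat_trans U C \<beta>"
    using arr by simp_all
  show "\<alpha> \<cdot>\<^bsub>SH\<^esub> \<pi> = \<mu> \<cdot>\<^bsub>SH\<^esub> \<beta>"
  proof (rule nat_trans_eqI[where U = U])
    fix A e assume "e \<in> sec (src (\<alpha> \<cdot>\<^bsub>SH\<^esub> \<pi>)) A"
    then show "cmp (\<alpha> \<cdot>\<^bsub>SH\<^esub> \<pi>) A e = cmp (\<mu> \<cdot>\<^bsub>SH\<^esub> \<beta>) A e"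
      using comm D by simp
  qed (use N D in \<open>auto intro!: PSh_comp_nat\<close>)
  have uniq: "e = e'" if "e \<in> sec (src \<pi>) A" "e' \<in> sec (src \<pi>) A" "cmp \<pi> A e = cmp \<pi> A e'"
    "cmp \<beta> A e = cmp \<beta> A e'" for A e e'
  proof -
    have "cmp \<pi> A e \<in> sec (src \<alpha>) A" "cmp \<beta> A e \<in> sec (src \<mu>) A"
      using nat_cmp[OF N(3) that(1)] nat_cmp[OF N(4), of e A] that(1) D by simp_all
    then show ?thesis
      using univ[OF _ _ comm[OF that(1)]] that by metis
  qed
  {
    fix w w'
    assume w: "w \<in> Arr SH" "w' \<in> Arr SH" "Dom SH w = Dom SH w'" "Cod SH w = Dom SH \<pi>"
      "Cod SH w' = Dom SH \<pi>" "\<pi> \<cdot>\<^bsub>SH\<^esub> w = \<pi> \<cdot>\<^bsub>SH\<^esub> w'" "\<beta> \<cdot>\<^bsub>SH\<^esub> w = \<beta> \<cdot>\<^bsub>SH\<^esub> w'"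
    show "w = w'"
    proof (rule nat_trans_eqI[where U = U])
      fix A x assume x: "x \<in> sec (src w) A"
      have "cmp (\<pi> \<cdot>\<^bsub>SH\<^esub> w) A x = cmp (\<pi> \<cdot>\<^bsub>SH\<^esub> w') A x" "cmp (\<beta> \<cdot>\<^bsub>SH\<^esub> w) A x = cmp (\<beta> \<cdot>\<^bsub>SH\<^esub> w') A x"
        by (simp_all only: w)
      moreover have "cmp w A x \<in> sec (src \<pi>) A" "cmp w' A x \<in> sec (src \<pi>) A"
        using w x nat_cmp[of U w x A] nat_cmp[of U w' x A] by simp_all
      ultimately show "cmp w A x = cmp w' A x"
        using x w(3) uniq[of "cmp w A x" A "cmp w' A x"] by simp
    qed (use w in simp_all)
  }
  {
    fix u v
    assume u: "u \<in> Arr SH" "v \<in> Arr SH" "Dom SH u = Dom SH v" "Cod SH u = Dom SH \<alpha>"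
      "Cod SH v = Dom SH \<mu>" "\<alpha> \<cdot>\<^bsub>SH\<^esub> u = \<mu> \<cdot>\<^bsub>SH\<^esub> v"
    have uN: "is_nat_trans U C u" "is_nat_trans U C v" and suv: "src v = src u"
      using u by simp_all
    have ex: "\<exists>!e. e \<in> sec (src \<pi>) A \<and> cmp \<pi> A e = cmp u A x \<and> cmp \<beta> A e = cmp v A x"
      if "x \<in> sec (src u) A" for A x
    proof (rule univ)
      have "cmp (\<alpha> \<cdot>\<^bsub>SH\<^esub> u) A x = cmp (\<mu> \<cdot>\<^bsub>SH\<^esub> v) A x"
        by (simp only: u(6))
      then show "cmp \<alpha> A (cmp u A x) = cmp \<mu> A (cmp v A x)"
        using that suv by simp
    qed (use that nat_cmp[OF uN(1), of x A] nat_cmp[OF uN(2), of x A] u in simp_all)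
    define h where "h A x = (THE e. e \<in> sec (src \<pi>) A \<and> cmp \<pi> A e = cmp u A x \<and> cmp \<beta> A e = cmp v A x)" for A x
    have h: "h A x \<in> sec (src \<pi>) A" "cmp \<pi> A (h A x) = cmp u A x" "cmp \<beta> A (h A x) = cmp v A x"
      if "x \<in> sec (src u) A" for A x
      using theI'[OF ex[OF that]] unfolding h_def by blast+
    let ?w = "nat_of (src u) (src \<pi>) h"
    have w: "is_nat_trans U C ?w"
    proof (rule nat_of_nat_trans)
      show "is_presheaf U C (src u)" "is_presheaf U C (src \<pi>)"
        using uN N nat_src by blast+
      show "h A x \<in> sec (src \<pi>) A" if "x \<in> sec (src u) A" for A x
        using h[OF that] by blast
      fix f x assume f: "f \<in> Arr C" "x \<in> sec (src u) (Cod C f)"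
      have r: "res (src u) f x \<in> sec (src u) (Dom C f)"
        using presheaf_res[OF nat_src[OF uN(1)] f] .
      note hx = h[OF f(2)]
      show "h (Dom C f) (res (src u) f x) = res (src \<pi>) f (h (Cod C f) x)"
      \<comment> \<open>Both sides have the same images under the two legs, because these,
        \<open>u\<close> and \<open>v\<close> are natural.\<close>
      proof (rule uniq)
        show "res (src \<pi>) f (h (Cod C f) x) \<in> sec (src \<pi>) (Dom C f)"
          using presheaf_res[OF nat_src[OF N(3)] f(1) hx(1)] .
        show "cmp \<pi> (Dom C f) (h (Dom C f) (res (src u) f x)) =
            cmp \<pi> (Dom C f) (res (src \<pi>) f (h (Cod C f) x))"
          using h(2)[OF r] nat_res[OF N(3) f(1) hx(1)] nat_res[OF uN(1) f] hx(2) D u(4) by simp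
        have "cmp \<beta> (Dom C f) (res (src \<pi>) f (h (Cod C f) x)) = res (tgt \<beta>) f (cmp \<beta> (Cod C f) (h (Cod C f) x))"
          using nat_res[OF N(4) f(1), of "h (Cod C f) x"] hx(1) D(2) by simp
        then show "cmp \<beta> (Dom C f) (h (Dom C f) (res (src u) f x)) =
            cmp \<beta> (Dom C f) (res (src \<pi>) f (h (Cod C f) x))"
          using h(3)[OF r] nat_res[OF uN(2) f(1), of x] f(2) hx(3) D u(5) suv by simp
      qed (rule h(1)[OF r])
    qed
    have "\<pi> \<cdot>\<^bsub>SH\<^esub> ?w = u"
    proof (rule nat_trans_eqI[where U = U])
      show "cmp (\<pi> \<cdot>\<^bsub>SH\<^esub> ?w) A x = cmp u A x" if "x \<in> sec (src (\<pi> \<cdot>\<^bsub>SH\<^esub> ?w)) A" for A x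
        using that h by simp
    qed (use w N uN u D in \<open>auto intro!: PSh_comp_nat\<close>)
    moreover have "\<beta> \<cdot>\<^bsub>SH\<^esub> ?w = v"
    proof (rule nat_trans_eqI[where U = U])
      show "cmp (\<beta> \<cdot>\<^bsub>SH\<^esub> ?w) A x = cmp v A x" if "x \<in> sec (src (\<beta> \<cdot>\<^bsub>SH\<^esub> ?w)) A" for A x
        using that h by simp
    qed (use w N uN u D in \<open>auto intro!: PSh_comp_nat\<close>)
    ultimately show "\<exists>w. w \<in> Arr SH \<and> Dom SH w = Dom SH u \<and> Cod SH w = Dom SH \<pi> \<and>
        \<pi> \<cdot>\<^bsub>SH\<^esub> w = u \<and> \<beta> \<cdot>\<^bsub>SH\<^esub> w = v"
      using w u arr by (intro exI[of _ ?w]) simp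
  }
qed (use arr D in simp_all)

lemma pullback_comm_elem:
  assumes "is_pullback SH \<alpha> \<mu> \<pi> \<beta>" "e \<in> sec (src \<pi>) A"
  shows "cmp \<alpha> A (cmp \<pi> A e) = cmp \<mu> A (cmp \<beta> A e)"
proof -
  have "cmp (\<alpha> \<cdot>\<^bsub>SH\<^esub> \<pi>) A e = cmp (\<mu> \<cdot>\<^bsub>SH\<^esub> \<beta>) A e"
    by (simp only: SH.pullbackD(9)[OF assms(1)])
  then show ?thesis
    using assms(2) SH.pullbackD(7)[OF assms(1)] by simp
qed

end


section \<open>The class of \<open>\<M>\<close>-maps between sheaves\<close>

text \<open>Provides a witness for the choice in \<open>shf_unit\<close> at a sheaf, in particular
  at every representable.\<close>

lemma (in category) reflection_Ide:
  assumes "is_sheaf U C J P"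
  shows "is_reflection U C J P (Ide (PSh U C) P)"
proof -
  interpret SH: category "Sh U C J" by (rule Sh_category)
  note P = sheaf_presheaf[OF assms]
  have eq: "\<psi> \<cdot>\<^bsub>PSh U C\<^esub> Ide (PSh U C) P = \<psi>" if "\<psi> \<in> Hom (Sh U C J) P Q" for \<psi> Q
    using SH.Comp_Ide[OF that] by simp
  show ?thesis
    unfolding is_reflection_def
  proof (intro conjI ballI)
    fix Q \<phi> assume "Q \<in> Obj (Sh U C J)" "\<phi> \<in> Hom (PSh U C) P Q"
    then have "\<phi> \<in> Hom (Sh U C J) P Q"
      using assms by (simp add: in_Hom_iff)
    then show "\<exists>!\<psi>. \<psi> \<in> Hom (Sh U C J) (tgt (Ide (PSh U C) P)) Q \<and> \<psi> \<cdot>\<^bsub>PSh U C\<^esub> Ide (PSh U C) P = \<phi>"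
      using eq by (intro ex1I[of _ \<phi>]) auto
  qed (use assms P in \<open>simp_all add: in_Hom_iff PSh_ide_nat\<close>)
qed

text \<open>The identity of \<open>P\<close> extends along the unit to a retraction
  \<open>\<rho>\<close>. The composite of \<open>\<eta>\<close> after \<open>\<rho>\<close> and the
  identity agree after precomposition with \<open>\<eta>\<close>, so uniqueness of extensions makes
  them equal.\<close>

lemma (in category) reflection_of_sheaf:
  assumes P: "is_sheaf U C J P" and r: "is_reflection U C J P \<eta>"
  obtains \<rho> where "is_nat_trans U C \<rho>" "src \<rho> = tgt \<eta>" "tgt \<rho> = P"
    "\<And>A x. x \<in> sec P A \<Longrightarrow> cmp \<rho> A (cmp \<eta> A x) = x"
    "\<And>A y. y \<in> sec (tgt \<eta>) A \<Longrightarrow> cmp \<eta> A (cmp \<rho> A y) = y"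
proof -
  interpret SH: category "Sh U C J" by (rule Sh_category)
  have \<eta>: "is_nat_trans U C \<eta>" "src \<eta> = P" "is_sheaf U C J (tgt \<eta>)"
    using r unfolding is_reflection_def by (simp_all add: in_Hom_iff)
  have univ: "\<exists>!\<psi>. \<psi> \<in> Hom (Sh U C J) (tgt \<eta>) Q \<and> \<psi> \<cdot>\<^bsub>PSh U C\<^esub> \<eta> = \<phi>"
    if "is_sheaf U C J Q" "\<phi> \<in> Hom (PSh U C) P Q" for Q \<phi>
    using r that unfolding is_reflection_def by simp
  have I: "Ide (PSh U C) P \<in> Hom (PSh U C) P P"
    using PSh_ide_nat[OF sheaf_presheaf[OF P]] by (simp add: in_Hom_iff)
  obtain \<rho> where \<rho>: "\<rho> \<in> Hom (Sh U C J) (tgt \<eta>) P" "\<rho> \<cdot>\<^bsub>PSh U C\<^esub> \<eta> = Ide (PSh U C) P"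
    using univ[OF P I] by blast
  then have \<rho>': "is_nat_trans U C \<rho>" "src \<rho> = tgt \<eta>" "tgt \<rho> = P"
    by (simp_all add: in_Hom_iff)
  have e1: "cmp \<rho> A (cmp \<eta> A x) = x" if "x \<in> sec P A" for A x
  proof -
    have "cmp (\<rho> \<cdot>\<^bsub>PSh U C\<^esub> \<eta>) A x = cmp (Ide (PSh U C) P) A x"
      by (simp only: \<rho>(2))
    then show ?thesis
      using that \<eta>(2) by simp
  qed
  have \<eta>A: "\<eta> \<in> Hom (Sh U C J) P (tgt \<eta>)"
    using \<eta> P by (simp add: in_Hom_iff)
  have "(\<eta> \<cdot>\<^bsub>Sh U C J\<^esub> \<rho>) \<cdot>\<^bsub>Sh U C J\<^esub> \<eta> = \<eta> \<cdot>\<^bsub>Sh U C J\<^esub> (\<rho> \<cdot>\<^bsub>Sh U C J\<^esub> \<eta>)"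
    by (rule SH.Comp_assoc[OF \<eta>A \<rho>(1) \<eta>A])
  then have "(\<eta> \<cdot>\<^bsub>PSh U C\<^esub> \<rho>) \<cdot>\<^bsub>PSh U C\<^esub> \<eta> = \<eta>"
    using \<rho>(2) SH.Comp_Ide[OF \<eta>A] by simp
  moreover have "\<eta> \<cdot>\<^bsub>PSh U C\<^esub> \<rho> \<in> Hom (Sh U C J) (tgt \<eta>) (tgt \<eta>)"
    using SH.Comp_Hom[OF \<rho>(1) \<eta>A] by simp
  moreover have "Ide (Sh U C J) (tgt \<eta>) \<in> Hom (Sh U C J) (tgt \<eta>) (tgt \<eta>)"
    using \<eta>(3) by (intro SH.Ide_Hom) simp
  moreover have "Ide (Sh U C J) (tgt \<eta>) \<cdot>\<^bsub>PSh U C\<^esub> \<eta> = \<eta>"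
    using SH.Ide_Comp[OF \<eta>A] by simp
  moreover have "\<eta> \<in> Hom (PSh U C) P (tgt \<eta>)"
    using \<eta> by (simp add: in_Hom_iff)
  ultimately have eq: "\<eta> \<cdot>\<^bsub>PSh U C\<^esub> \<rho> = Ide (Sh U C J) (tgt \<eta>)"
    using univ[OF \<eta>(3)] by blast
  have e2: "cmp \<eta> A (cmp \<rho> A y) = y" if "y \<in> sec (tgt \<eta>) A" for A y
  proof -
    have "cmp (\<eta> \<cdot>\<^bsub>PSh U C\<^esub> \<rho>) A y = cmp (Ide (Sh U C J) (tgt \<eta>)) A y"
      by (simp only: eq)
    then show ?thesis
      using that \<rho>'(2) by simp
  qed
  show thesis
    using that \<rho>' e1 e2 by blast
qed

lemma (in category) subobj_eq_span_class: "subobj C m = fst ` span_class C (m, m)"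
  unfolding subobj_def span_class_def by force

lemma (in category) subobj_iso:
  assumes "m \<in> Arr C" "is_iso C i" "Cod C i = Dom C m"
  shows "subobj C (m \<cdot> i) = subobj C m"
  unfolding subobj_eq_span_class using span_class_iso[OF assms(1) assms(1) refl assms(2,3)] by simp

section \<open>Associated sheaves of representables, described by arrows of the base\<close>

context sheaf_site
begin

abbreviation ay_unit where "ay_unit D \<equiv> shf_unit U C J (yo_obj C D)"
abbreviation ay where "ay D \<equiv> shf_obj U C J (yo_obj C D)"

lemma ay_unit_reflection:
  assumes "D \<in> Obj C"
  shows "is_reflection U C J (yo_obj C D) (ay_unit D)"
  unfolding shf_unit_def using reflection_Ide[OF yo_sheaf[OF assms]] by (rule someI)

lemma ay_unit:
  assumes "D \<in> Obj C"
  shows "is_nat_trans U C (ay_unit D)" "src (ay_unit D) = yo_obj C D" "tgt (ay_unit D) = ay D"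
    "is_sheaf U C J (ay D)"
  using ay_unit_reflection[OF assms] unfolding is_reflection_def shf_obj_def
  by (simp_all add: in_Hom_iff)

lemma ay_unit_mem:
  assumes "f \<in> Arr C"
  shows "cmp (ay_unit (Cod C f)) (Dom C f) f \<in> sec (ay (Cod C f)) (Dom C f)"
  using nat_cmp[OF ay_unit(1), of "Cod C f" f "Dom C f"] ay_unit(2,3)[of "Cod C f"] assms Cod_Obj
  by (simp add: in_yo_iff)

definition ay_inv where
  "ay_inv D = (SOME \<rho>. is_nat_trans U C \<rho> \<and> src \<rho> = ay D \<and> tgt \<rho> = yo_obj C D \<and>
    (\<forall>A. \<forall>f\<in>sec (yo_obj C D) A. cmp \<rho> A (cmp (ay_unit D) A f) = f) \<and>
    (\<forall>A. \<forall>y\<in>sec (ay D) A. cmp (ay_unit D) A (cmp \<rho> A y) = y))"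

lemma ay_inv:
  assumes "D \<in> Obj C"
  shows "is_nat_trans U C (ay_inv D)" "src (ay_inv D) = ay D" "tgt (ay_inv D) = yo_obj C D"
    "f \<in> Arr C \<Longrightarrow> Cod C f = D \<Longrightarrow> cmp (ay_inv D) (Dom C f) (cmp (ay_unit D) (Dom C f) f) = f"
    "y \<in> sec (ay D) A \<Longrightarrow> cmp (ay_unit D) A (cmp (ay_inv D) A y) = y"
proof -
  have "\<exists>\<rho>. is_nat_trans U C \<rho> \<and> src \<rho> = ay D \<and> tgt \<rho> = yo_obj C D \<and>
      (\<forall>A. \<forall>f\<in>sec (yo_obj C D) A. cmp \<rho> A (cmp (ay_unit D) A f) = f) \<and>
      (\<forall>A. \<forall>y\<in>sec (ay D) A. cmp (ay_unit D) A (cmp \<rho> A y) = y)"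
    by (rule reflection_of_sheaf[OF yo_sheaf[OF assms] ay_unit_reflection[OF assms]])
      (unfold ay_unit(3)[OF assms], blast)
  from someI_ex[OF this] have *: "is_nat_trans U C (ay_inv D)" "src (ay_inv D) = ay D"
    "tgt (ay_inv D) = yo_obj C D"
    "\<And>A f. f \<in> sec (yo_obj C D) A \<Longrightarrow> cmp (ay_inv D) A (cmp (ay_unit D) A f) = f"
    "\<And>A y. y \<in> sec (ay D) A \<Longrightarrow> cmp (ay_unit D) A (cmp (ay_inv D) A y) = y"
    unfolding ay_inv_def[symmetric] by blast+
  show "is_nat_trans U C (ay_inv D)" "src (ay_inv D) = ay D" "tgt (ay_inv D) = yo_obj C D"
    "y \<in> sec (ay D) A \<Longrightarrow> cmp (ay_unit D) A (cmp (ay_inv D) A y) = y"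
    by (fact *)+
  show "cmp (ay_inv D) (Dom C f) (cmp (ay_unit D) (Dom C f) f) = f" if "f \<in> Arr C" "Cod C f = D"
    using *(4)[of f "Dom C f"] that by (simp add: in_yo_iff)
qed

lemma ay_unit_surj:
  assumes "D \<in> Obj C" "a \<in> sec (ay D) X"
  obtains f where "f \<in> Arr C" "Dom C f = X" "Cod C f = D" "a = cmp (ay_unit D) X f"
proof -
  define \<rho> where "\<rho> = ay_inv D"
  note \<rho> = ay_inv[OF assms(1), folded \<rho>_def]
  have "cmp \<rho> X a \<in> sec (yo_obj C D) X"
    using nat_cmp[OF \<rho>(1), of a X] \<rho> assms by simp
  then show thesis
    using that[of "cmp \<rho> X a"] \<rho>(5)[OF assms(2)] by (simp add: in_yo_iff)
qed

lemma ay_unit_inj: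
  assumes "f \<in> Arr C" "g \<in> Arr C" "Dom C f = Dom C g" "Cod C f = D" "Cod C g = D"
    "cmp (ay_unit D) (Dom C g) f = cmp (ay_unit D) (Dom C g) g"
  shows "f = g"
proof -
  have "D \<in> Obj C"
    using Cod_Obj[OF assms(1)] assms(4) by simp
  note \<rho> = ay_inv(4)[OF this]
  have "f = cmp (ay_inv D) (Dom C g) (cmp (ay_unit D) (Dom C g) f)"
    using \<rho>[OF assms(1,4)] by (simp only: assms(3))
  also have "\<dots> = g"
    using \<rho>[OF assms(2,5)] by (simp only: assms(6))
  finally show ?thesis .
qed

text \<open>The universal property of the unit makes the description in \<open>shf_arr\<close> well
  defined; the second claim is the naturality square of the unit evaluated at
  \<open>k\<close>.\<close>

lemma ay_arr:
  assumes m: "m \<in> Arr C"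
  shows "shf_arr U C J (yo_arr C m) \<in> Hom SH (ay (Dom C m)) (ay (Cod C m))"
    and "k \<in> Arr C \<Longrightarrow> Cod C k = Dom C m \<Longrightarrow>
      cmp (shf_arr U C J (yo_arr C m)) (Dom C k) (cmp (ay_unit (Dom C m)) (Dom C k) k) =
      cmp (ay_unit (Cod C m)) (Dom C k) (m \<cdot> k)"
proof -
  have O: "Dom C m \<in> Obj C" "Cod C m \<in> Obj C"
    using m Dom_Obj Cod_Obj by blast+
  have yo: "yo_arr C m = nat_of (yo_obj C (Dom C m)) (yo_obj C (Cod C m)) (\<lambda>A g. m \<cdot> g)"
    by (simp add: yo_arr_def nat_of_def)
  have "is_nat_trans U C (nat_of (yo_obj C (Dom C m)) (yo_obj C (Cod C m)) (\<lambda>A g. m \<cdot> g))"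
  proof (rule nat_of_nat_trans[OF yo_presheaf yo_presheaf])
    show "m \<cdot> x \<in> sec (yo_obj C (Cod C m)) A" if "x \<in> sec (yo_obj C (Dom C m)) A" for A x
      using that m by (simp add: in_yo_iff)
    show "m \<cdot> res (yo_obj C (Dom C m)) f x = res (yo_obj C (Cod C m)) f (m \<cdot> x)"
      if "f \<in> Arr C" "x \<in> sec (yo_obj C (Dom C m)) (Cod C f)" for f x
      using that m by (simp add: in_yo_iff in_Hom_iff comp_assoc)
  qed
  then have ym: "is_nat_trans U C (yo_arr C m)" "src (yo_arr C m) = yo_obj C (Dom C m)"
    "tgt (yo_arr C m) = yo_obj C (Cod C m)"
    by (simp_all add: yo)
  let ?\<phi> = "ay_unit (Cod C m) \<cdot>\<^bsub>PSh U C\<^esub> yo_arr C m"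
  have "?\<phi> \<in> Hom (PSh U C) (yo_obj C (Dom C m)) (ay (Cod C m))"
    using ym ay_unit[OF O(2)] PSh_comp_nat[of U "yo_arr C m" "ay_unit (Cod C m)"] by (simp add: in_Hom_iff)
  then have "\<exists>!\<psi>. \<psi> \<in> Hom SH (tgt (ay_unit (Dom C m))) (ay (Cod C m)) \<and>
      \<psi> \<cdot>\<^bsub>PSh U C\<^esub> ay_unit (Dom C m) = ?\<phi>"
    using ay_unit_reflection[OF O(1)] ay_unit(4)[OF O(2)] unfolding is_reflection_def by simp
  then have "\<exists>!\<psi>. \<psi> \<in> Hom SH (ay (Dom C m)) (ay (Cod C m)) \<and>
      \<psi> \<cdot>\<^bsub>PSh U C\<^esub> ay_unit (Dom C m) = ?\<phi>"
    using ay_unit(3)[OF O(1)] by simp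
  from theI'[OF this] have *: "shf_arr U C J (yo_arr C m) \<in> Hom SH (ay (Dom C m)) (ay (Cod C m))"
    "shf_arr U C J (yo_arr C m) \<cdot>\<^bsub>PSh U C\<^esub> ay_unit (Dom C m) = ?\<phi>"
    unfolding shf_arr_def ym by blast+
  then show "shf_arr U C J (yo_arr C m) \<in> Hom SH (ay (Dom C m)) (ay (Cod C m))"
    by blast
  assume k: "k \<in> Arr C" "Cod C k = Dom C m"
  have "cmp (shf_arr U C J (yo_arr C m) \<cdot>\<^bsub>PSh U C\<^esub> ay_unit (Dom C m)) (Dom C k) k = cmp ?\<phi> (Dom C k) k"
    by (simp only: *)
  then show "cmp (shf_arr U C J (yo_arr C m)) (Dom C k) (cmp (ay_unit (Dom C m)) (Dom C k) k) =
      cmp (ay_unit (Cod C m)) (Dom C k) (m \<cdot> k)"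
    using k ay_unit(2)[OF O(1)] ym(2) by (simp add: in_yo_iff yo)
qed

section \<open>Membership in the class of \<open>M\<close>-maps on sections\<close>

definition image_of :: "('o, 'v, 'v) nat_trans \<Rightarrow> 'o \<Rightarrow> 'v set" where
  "image_of \<mu> A = cmp \<mu> A ` sec (src \<mu>) A"

lemma image_ofI: "x \<in> sec (src \<mu>) A \<Longrightarrow> cmp \<mu> A x \<in> image_of \<mu> A"
  by (simp add: image_of_def)

text \<open>A section \<open>q\<close> of the target is a test map out of a representable. The arrow
  \<open>m\<close> supplied by the definition of \<open>M_Sh\<close> for this map classifies the
  restrictions of \<open>q\<close> that lie in the image, and monicity of \<open>m\<close> makes
  preimages unique.\<close>

lemma M_Sh_imp:
  assumes \<mu>: "\<mu> \<in> M_Sh U C M"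
  shows "\<mu> \<in> Arr SH"
    and "x \<in> sec (src \<mu>) A \<Longrightarrow> y \<in> sec (src \<mu>) A \<Longrightarrow> cmp \<mu> A x = cmp \<mu> A y \<Longrightarrow> x = y"
    and "classified C M (tgt \<mu>) (image_of \<mu>)"
proof -
  show arr: "\<mu> \<in> Arr SH"
    using \<mu> by (simp add: M_Sh_def)
  then have N: "is_nat_trans U C \<mu>" "is_sheaf U C J (src \<mu>)" "is_sheaf U C J (tgt \<mu>)"
    by simp_all
  \<comment> \<open>The defining pullback square read off on sections: along
    \<open>m \<cdot> k\<close> the section \<open>q\<close> has the preimage that
    \<open>\<beta>\<close> takes at \<open>k\<close>, and every preimage of a restriction of
    \<open>q\<close> arises in this way.\<close>
  have main: "\<exists>m \<beta>. m \<in> M \<and> Cod C m = D \<and> is_nat_trans U C \<beta> \<and> src \<beta> = ay (Dom C m) \<and>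
      (\<forall>k\<in>Arr C. Cod C k = Dom C m \<longrightarrow> res (tgt \<mu>) (m \<cdot> k) q =
          cmp \<mu> (Dom C k) (cmp \<beta> (Dom C k) (cmp (ay_unit (Dom C m)) (Dom C k) k))) \<and>
      tgt \<beta> = src \<mu> \<and>
      (\<forall>f\<in>Arr C. \<forall>x\<in>sec (src \<mu>) (Dom C f). Cod C f = D \<longrightarrow> res (tgt \<mu>) f q = cmp \<mu> (Dom C f) x \<longrightarrow>
        (\<exists>k\<in>Arr C. Dom C k = Dom C f \<and> Cod C k = Dom C m \<and> m \<cdot> k = f \<and>
          cmp \<beta> (Dom C f) (cmp (ay_unit (Dom C m)) (Dom C f) k) = x))"
    if D: "D \<in> Obj C" and q: "q \<in> sec (tgt \<mu>) D" for D q
  proof -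
    note ye = yo_elem[OF sheaf_presheaf[OF N(3)] q]
    note e = ay_unit[OF D]
    define \<rho> where "\<rho> = ay_inv D"
    note \<rho> = ay_inv[OF D, folded \<rho>_def]
    \<comment> \<open>The Yoneda lemma gives a map out of \<open>yo_obj C D\<close>, whereas
      \<open>M_Sh\<close> tests maps out of \<open>ay D\<close>; the inverse \<open>\<rho>\<close>
      of the unit mediates.\<close>
    let ?\<alpha> = "yo_elem (tgt \<mu>) D q \<cdot>\<^bsub>PSh U C\<^esub> \<rho>"
    have \<alpha>: "is_nat_trans U C ?\<alpha>" "src ?\<alpha> = ay D" "tgt ?\<alpha> = tgt \<mu>"
      using ye \<rho> by (auto intro!: PSh_comp_nat)
    then have "?\<alpha> \<in> Hom SH (ay D) (tgt \<mu>)"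
      using N e by (simp add: Sh_Hom_iff)
    then obtain m \<beta> where m: "m \<in> M" "Cod C m = D"
      and pb: "is_pullback SH ?\<alpha> \<mu> (shf_arr U C J (yo_arr C m)) \<beta>"
      using \<mu> D unfolding M_Sh_def by blast
    have \<alpha>f: "cmp ?\<alpha> (Dom C f) (cmp (ay_unit D) (Dom C f) f) = res (tgt \<mu>) f q"
      if "f \<in> Arr C" "Cod C f = D" for f
      using that \<rho>(2) \<rho>(4)[OF that] ye(4)[OF that] ay_unit_mem[OF that(1)] by simp
    have mA: "m \<in> Arr C" and O: "Dom C m \<in> Obj C"
      using m M_Arr Dom_Obj by blast+
    note am = ay_arr[OF mA]
    note PD = SH.pullbackD[OF pb]
    have am': "src (shf_arr U C J (yo_arr C m)) = ay (Dom C m)"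
      "tgt (shf_arr U C J (yo_arr C m)) = ay D"
      using am(1) m by (simp_all add: in_Hom_iff)
    have \<beta>: "is_nat_trans U C \<beta>" "src \<beta> = ay (Dom C m)" "tgt \<beta> = src \<mu>"
      using PD(4,7,8) am' by simp_all
    have "res (tgt \<mu>) (m \<cdot> k) q =
          cmp \<mu> (Dom C k) (cmp \<beta> (Dom C k) (cmp (ay_unit (Dom C m)) (Dom C k) k))"
      if k: "k \<in> Arr C" "Cod C k = Dom C m" for k
      using pullback_comm_elem[OF pb, of "cmp (ay_unit (Dom C m)) (Dom C k) k" "Dom C k"]
        am(2)[OF k] \<alpha>f[of "m \<cdot> k"] ay_unit_mem[OF k(1)] k mA m am' by simp
    moreover have "\<exists>k\<in>Arr C. Dom C k = Dom C f \<and> Cod C k = Dom C m \<and> m \<cdot> k = f \<and>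
          cmp \<beta> (Dom C f) (cmp (ay_unit (Dom C m)) (Dom C f) k) = x"
      if f: "f \<in> Arr C" "Cod C f = D" and x: "x \<in> sec (src \<mu>) (Dom C f)"
        and eq: "res (tgt \<mu>) f q = cmp \<mu> (Dom C f) x" for f x
    proof -
      have "\<exists>!e. e \<in> sec (src (shf_arr U C J (yo_arr C m))) (Dom C f) \<and>
          cmp (shf_arr U C J (yo_arr C m)) (Dom C f) e = cmp (ay_unit D) (Dom C f) f \<and>
          cmp \<beta> (Dom C f) e = x"
      proof (rule Sh_pullback_elem[OF pb _ x])
        show "cmp (ay_unit D) (Dom C f) f \<in> sec (src ?\<alpha>) (Dom C f)"
          using ay_unit_mem[OF f(1)] f \<alpha> by simp
        show "cmp ?\<alpha> (Dom C f) (cmp (ay_unit D) (Dom C f) f) = cmp \<mu> (Dom C f) x"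
          using \<alpha>f[OF f] eq by simp
      qed
      then obtain e where e: "e \<in> sec (ay (Dom C m)) (Dom C f)"
          "cmp (shf_arr U C J (yo_arr C m)) (Dom C f) e = cmp (ay_unit D) (Dom C f) f"
          "cmp \<beta> (Dom C f) e = x"
        using am' by auto
      obtain k where k: "k \<in> Arr C" "Dom C k = Dom C f" "Cod C k = Dom C m"
          "e = cmp (ay_unit (Dom C m)) (Dom C f) k"
        using ay_unit_surj[OF O e(1)] .
      have "m \<cdot> k = f"
      proof (rule ay_unit_inj)
        show "cmp (ay_unit D) (Dom C f) (m \<cdot> k) = cmp (ay_unit D) (Dom C f) f"
          using e(2) am(2)[OF k(1,3)] k(2,4) m(2) by simp
      qed (use k mA m f in simp_all)
      then show ?thesis
        using k e(3) by blast
    qed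
    ultimately show ?thesis
      using m \<beta> by blast
  qed
  show "x = y" if xy: "x \<in> sec (src \<mu>) A" "y \<in> sec (src \<mu>) A" "cmp \<mu> A x = cmp \<mu> A y"
  proof -
    have A: "A \<in> Obj C"
      using presheaf_sec_Obj[OF nat_src[OF N(1)] xy(1)] .
    have q: "cmp \<mu> A x \<in> sec (tgt \<mu>) A"
      using nat_cmp[OF N(1) xy(1)] .
    obtain m \<beta> where m: "m \<in> M" "Cod C m = A"
      and \<beta>: "is_nat_trans U C \<beta>" "src \<beta> = ay (Dom C m)"
      and sq: "\<forall>k\<in>Arr C. Cod C k = Dom C m \<longrightarrow> res (tgt \<mu>) (m \<cdot> k) (cmp \<mu> A x) =
          cmp \<mu> (Dom C k) (cmp \<beta> (Dom C k) (cmp (ay_unit (Dom C m)) (Dom C k) k))"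
      and \<beta>t: "tgt \<beta> = src \<mu>"
      and ex: "\<forall>f\<in>Arr C. \<forall>z\<in>sec (src \<mu>) (Dom C f). Cod C f = A \<longrightarrow>
        res (tgt \<mu>) f (cmp \<mu> A x) = cmp \<mu> (Dom C f) z \<longrightarrow>
        (\<exists>k\<in>Arr C. Dom C k = Dom C f \<and> Cod C k = Dom C m \<and> m \<cdot> k = f \<and>
          cmp \<beta> (Dom C f) (cmp (ay_unit (Dom C m)) (Dom C f) k) = z)"
      using main[OF A q] by blast
    have I: "res (tgt \<mu>) (Ide C A) (cmp \<mu> A x) = cmp \<mu> A x"
      using presheaf_res_Ide[OF nat_tgt[OF N(1)] q] .
    \<comment> \<open>Over the identity, \<open>x\<close> and \<open>y\<close> are preimages of the
      same section, so each comes from a right inverse of \<open>m\<close>. As \<open>m\<close> is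
      monic the two right inverses agree, and \<open>\<beta>\<close> takes them to \<open>x\<close>
      and to \<open>y\<close>.\<close>
    obtain k where k: "k \<in> Arr C" "Dom C k = A" "Cod C k = Dom C m" "m \<cdot> k = Ide C A"
        "cmp \<beta> A (cmp (ay_unit (Dom C m)) A k) = x"
      using bspec[OF bspec[OF ex, of "Ide C A"], of x] A I xy(1) by auto
    obtain l where l: "l \<in> Arr C" "Dom C l = A" "Cod C l = Dom C m" "m \<cdot> l = Ide C A"
        "cmp \<beta> A (cmp (ay_unit (Dom C m)) A l) = y"
      using bspec[OF bspec[OF ex, of "Ide C A"], of y] A I xy(2,3) by auto
    have "k = l"
      using M_cancel[OF m(1), of k l] k l by simp
    then show ?thesis
      using k l by simp
  qed
  show "classified C M (tgt \<mu>) (image_of \<mu>)"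
    unfolding classified_def
  proof (intro ballI)
    fix D q assume D: "D \<in> Obj C" and q: "q \<in> sec (tgt \<mu>) D"
    obtain m \<beta> where m: "m \<in> M" "Cod C m = D"
      and \<beta>: "is_nat_trans U C \<beta>" "src \<beta> = ay (Dom C m)"
      and sq: "\<forall>k\<in>Arr C. Cod C k = Dom C m \<longrightarrow> res (tgt \<mu>) (m \<cdot> k) q =
          cmp \<mu> (Dom C k) (cmp \<beta> (Dom C k) (cmp (ay_unit (Dom C m)) (Dom C k) k))"
      and \<beta>t: "tgt \<beta> = src \<mu>"
      and ex: "\<forall>f\<in>Arr C. \<forall>z\<in>sec (src \<mu>) (Dom C f). Cod C f = D \<longrightarrow>
        res (tgt \<mu>) f q = cmp \<mu> (Dom C f) z \<longrightarrow>
        (\<exists>k\<in>Arr C. Dom C k = Dom C f \<and> Cod C k = Dom C m \<and> m \<cdot> k = f \<and>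
          cmp \<beta> (Dom C f) (cmp (ay_unit (Dom C m)) (Dom C f) k) = z)"
      using main[OF D q] by blast
    have "res (tgt \<mu>) f q \<in> image_of \<mu> (Dom C f) \<longleftrightarrow> factors_through C f m"
      if f: "f \<in> Arr C" "Cod C f = D" for f
    proof
      assume "res (tgt \<mu>) f q \<in> image_of \<mu> (Dom C f)"
      then obtain x where "x \<in> sec (src \<mu>) (Dom C f)" "res (tgt \<mu>) f q = cmp \<mu> (Dom C f) x"
        unfolding image_of_def by blast
      then obtain k where "k \<in> Arr C" "Dom C k = Dom C f" "Cod C k = Dom C m" "m \<cdot> k = f"
        using ex f by metis
      then show "factors_through C f m"
        by (intro factors_throughI[of k]) simp_all
    next
      assume "factors_through C f m"
      then obtain k where k: "k \<in> Arr C" "Dom C f = Dom C k" "Cod C k = Dom C m" "f = m \<cdot> k"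
        by (rule factors_throughE)
      have "cmp \<beta> (Dom C k) (cmp (ay_unit (Dom C m)) (Dom C k) k) \<in> sec (src \<mu>) (Dom C k)"
        using nat_cmp[OF \<beta>(1), of "cmp (ay_unit (Dom C m)) (Dom C k) k" "Dom C k"] \<beta> \<beta>t
          ay_unit_mem[OF k(1)] k(3) by simp
      then show "res (tgt \<mu>) f q \<in> image_of \<mu> (Dom C f)"
        unfolding k(2) k(4) sq[rule_format, OF k(1,3)] using k(2,4) by (simp add: image_of_def)
    qed
    then show "\<exists>m\<in>M. Cod C m = D \<and> (\<forall>f\<in>Arr C. Cod C f = D \<longrightarrow>
        (res (tgt \<mu>) f q \<in> image_of \<mu> (Dom C f) \<longleftrightarrow> factors_through C f m))"
      using m by blast
  qed
qed

text \<open>A test map amounts to a section of the target, and the subobject classifying this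
  section gives the opposite side of the square. Injectivity makes the remaining leg commute and,
  together with monicity of \<open>m\<close>, gives the universal property.\<close>

lemma M_ShI:
  assumes arr: "\<mu> \<in> Arr SH"
    and inj: "\<And>A x y. x \<in> sec (src \<mu>) A \<Longrightarrow> y \<in> sec (src \<mu>) A \<Longrightarrow> cmp \<mu> A x = cmp \<mu> A y \<Longrightarrow> x = y"
    and cl: "classified C M (tgt \<mu>) (image_of \<mu>)"
  shows "\<mu> \<in> M_Sh U C M"
  unfolding M_Sh_def
proof (intro CollectI conjI arr ballI)
  have N: "is_nat_trans U C \<mu>" "is_sheaf U C J (src \<mu>)" "is_sheaf U C J (tgt \<mu>)"
    using arr by simp_all
  fix D \<alpha> assume D: "D \<in> Obj C" and "\<alpha> \<in> Hom SH (ay D) (tgt \<mu>)"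
  then have \<alpha>: "is_nat_trans U C \<alpha>" "src \<alpha> = ay D" "tgt \<alpha> = tgt \<mu>" "\<alpha> \<in> Arr SH"
    by (simp_all add: Sh_Hom_iff)
  \<comment> \<open>The section that corresponds to the test map under Yoneda, with the unit at
    \<open>D\<close> as identification.\<close>
  let ?q = "cmp \<alpha> D (cmp (ay_unit D) D (Ide C D))"
  have ID: "cmp (ay_unit D) D (Ide C D) \<in> sec (ay D) D"
    using ay_unit_mem[of "Ide C D"] D by simp
  then have q: "?q \<in> sec (tgt \<mu>) D"
    using nat_cmp[OF \<alpha>(1), of _ D] \<alpha> by simp
  have \<alpha>f: "cmp \<alpha> (Dom C f) (cmp (ay_unit D) (Dom C f) f) = res (tgt \<mu>) f ?q"
    if f: "f \<in> Arr C" "Cod C f = D" for f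
  proof -
    have I: "Ide C D \<in> sec (yo_obj C D) D"
      using D by (simp add: in_Hom_iff)
    have "cmp (ay_unit D) (Dom C f) f = res (ay D) f (cmp (ay_unit D) D (Ide C D))"
      using nat_res[OF ay_unit(1)[OF D] f(1), of "Ide C D"] ay_unit(2,3)[OF D] I D f Ide_Hom[OF D] by simp
    then show ?thesis
      using nat_res[OF \<alpha>(1) f(1), of "cmp (ay_unit D) D (Ide C D)"] \<alpha> f ID by simp
  qed
  obtain m where m: "m \<in> M" "Cod C m = D"
    "\<And>f. f \<in> Arr C \<Longrightarrow> Cod C f = D \<Longrightarrow>
      res (tgt \<mu>) f ?q \<in> image_of \<mu> (Dom C f) \<longleftrightarrow> factors_through C f m"
    using classifiedE[OF cl D q] by blast
  have mA: "m \<in> Arr C" and O: "Dom C m \<in> Obj C"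
    using m M_Arr Dom_Obj by blast+
  have "res (tgt \<mu>) m ?q \<in> image_of \<mu> (Dom C m)"
    using m(3)[OF mA m(2)] factors_through_refl[OF mA] by simp
  \<comment> \<open>Because \<open>m\<close> factors through itself, the restriction of
    \<open>?q\<close> along \<open>m\<close> lies in the image. Its preimage \<open>p\<close>
    determines the leg \<open>?\<beta>\<close>.\<close>
  then obtain p where p: "p \<in> sec (src \<mu>) (Dom C m)" "cmp \<mu> (Dom C m) p = res (tgt \<mu>) m ?q"
    unfolding image_of_def by auto
  note yp = yo_elem[OF nat_src[OF N(1)] p(1)]
  define \<rho> where "\<rho> = ay_inv (Dom C m)"
  note \<rho> = ay_inv[OF O, folded \<rho>_def]
  let ?\<beta> = "yo_elem (src \<mu>) (Dom C m) p \<cdot>\<^bsub>PSh U C\<^esub> \<rho>"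
  let ?\<pi> = "shf_arr U C J (yo_arr C m)"
  have \<beta>: "is_nat_trans U C ?\<beta>" "src ?\<beta> = ay (Dom C m)" "tgt ?\<beta> = src \<mu>"
    using yp \<rho> by (auto intro!: PSh_comp_nat)
  have \<beta>k: "cmp ?\<beta> (Dom C k) (cmp (ay_unit (Dom C m)) (Dom C k) k) = res (src \<mu>) k p"
    if "k \<in> Arr C" "Cod C k = Dom C m" for k
    using that \<rho>(2) \<rho>(4)[OF that] yp(4)[OF that] ay_unit_mem[OF that(1)] by simp
  note am = ay_arr[OF mA]
  have \<pi>: "is_nat_trans U C ?\<pi>" "src ?\<pi> = ay (Dom C m)" "tgt ?\<pi> = ay D" "?\<pi> \<in> Arr SH"
    using am(1) m by (simp_all add: Sh_Hom_iff)
  have \<mu>k: "cmp \<mu> (Dom C k) (res (src \<mu>) k p) = res (tgt \<mu>) (m \<cdot> k) ?q"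
    if "k \<in> Arr C" "Cod C k = Dom C m" for k
    using that nat_res[OF N(1) that(1), of p] p presheaf_res_comp[OF nat_tgt[OF N(1)] that(1) mA, of ?q] q m by simp
  have "is_pullback SH \<alpha> \<mu> ?\<pi> ?\<beta>"
  proof (rule Sh_pullbackI)
    fix X e assume "e \<in> sec (src ?\<pi>) X"
    then obtain k where k: "k \<in> Arr C" "Dom C k = X" "Cod C k = Dom C m"
        "e = cmp (ay_unit (Dom C m)) X k"
      using ay_unit_surj[OF O] \<pi>(2) by metis
    show "cmp \<alpha> X (cmp ?\<pi> X e) = cmp \<mu> X (cmp ?\<beta> X e)"
      using am(2)[OF k(1,3)] \<alpha>f[of "m \<cdot> k"] \<beta>k[OF k(1,3)] \<mu>k[OF k(1,3)] k m mA by simp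
  next
    fix X a x assume a: "a \<in> sec (src \<alpha>) X" and x: "x \<in> sec (src \<mu>) X" and eq: "cmp \<alpha> X a = cmp \<mu> X x"
    obtain f where f: "f \<in> Arr C" "Dom C f = X" "Cod C f = D" "a = cmp (ay_unit D) X f"
      using ay_unit_surj[OF D] a \<alpha>(2) by metis
    have fq: "res (tgt \<mu>) f ?q = cmp \<mu> X x"
      using \<alpha>f[OF f(1,3)] f(2,4) eq by simp
    then have "factors_through C f m"
      using m(3)[OF f(1,3)] image_ofI[OF x] f(2) by simp
    then obtain k where k: "k \<in> Arr C" "Dom C f = Dom C k" "Cod C k = Dom C m" "f = m \<cdot> k"
      by (rule factors_throughE)
    have kX: "Dom C k = X"
      using k(2) f(2) by simp
    show "\<exists>!e. e \<in> sec (src ?\<pi>) X \<and> cmp ?\<pi> X e = a \<and> cmp ?\<beta> X e = x"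
    proof (rule ex1I[of _ "cmp (ay_unit (Dom C m)) X k"], intro conjI)
      show "cmp (ay_unit (Dom C m)) X k \<in> sec (src ?\<pi>) X"
        using ay_unit_mem[OF k(1)] k(3) kX \<pi>(2) by simp
      show "cmp ?\<pi> X (cmp (ay_unit (Dom C m)) X k) = a"
        using am(2)[OF k(1,3)] kX f(4) k(4) m(2) by simp
      have "cmp \<mu> X (res (src \<mu>) k p) = cmp \<mu> X x"
        using \<mu>k[OF k(1,3)] kX k(4) fq by simp
      moreover have "res (src \<mu>) k p \<in> sec (src \<mu>) X"
        using presheaf_res[OF nat_src[OF N(1)] k(1), of p] p k(3) kX by simp
      ultimately have "res (src \<mu>) k p = x"
        using inj x by blast
      then show "cmp ?\<beta> X (cmp (ay_unit (Dom C m)) X k) = x"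
        using \<beta>k[OF k(1,3)] kX by simp
    next
      fix e assume e: "e \<in> sec (src ?\<pi>) X \<and> cmp ?\<pi> X e = a \<and> cmp ?\<beta> X e = x"
      then obtain l where l: "l \<in> Arr C" "Dom C l = X" "Cod C l = Dom C m"
          "e = cmp (ay_unit (Dom C m)) X l"
        using ay_unit_surj[OF O] \<pi>(2) by metis
      have "cmp (ay_unit D) X (m \<cdot> l) = cmp (ay_unit D) X f"
        using am(2)[OF l(1,3)] l e f(4) m(2) by simp
      then have "m \<cdot> l = f"
        using ay_unit_inj[of "m \<cdot> l" f D] l mA m f by simp
      then have "l = k"
        using M_cancel[OF m(1), of l k] l k(1,3,4) kX by simp
      then show "e = cmp (ay_unit (Dom C m)) X k"
        using l by simp
    qed
  qed (use arr \<alpha> \<beta> \<pi> ay_unit(4)[OF O] N in simp_all)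
  then show "\<exists>m\<in>M. Cod C m = D \<and> (\<exists>\<beta>. is_pullback SH \<alpha> \<mu> (shf_arr U C J (yo_arr C m)) \<beta>)"
    using m by blast
qed

text \<open>Preimages under \<open>\<mu>\<close> are unique, so any pointwise choice of them is
  natural.\<close>

lemma lift_through:
  assumes \<mu>: "\<mu> \<in> M_Sh U C M" and g: "g \<in> Arr SH" "tgt g = tgt \<mu>"
    and im: "\<And>A x. x \<in> sec (src g) A \<Longrightarrow> cmp g A x \<in> image_of \<mu> A"
  obtains h where "h \<in> Arr SH" "src h = src g" "tgt h = src \<mu>"
    "\<And>A x. x \<in> sec (src g) A \<Longrightarrow> cmp \<mu> A (cmp h A x) = cmp g A x"
proof -
  note M = M_Sh_imp[OF \<mu>]
  have N: "is_nat_trans U C \<mu>" "is_nat_trans U C g"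
    using M g by simp_all
  define h where "h A x = (SOME y. y \<in> sec (src \<mu>) A \<and> cmp \<mu> A y = cmp g A x)" for A x
  have h: "h A x \<in> sec (src \<mu>) A" "cmp \<mu> A (h A x) = cmp g A x" if x: "x \<in> sec (src g) A" for A x
  proof -
    have "\<exists>y. y \<in> sec (src \<mu>) A \<and> cmp \<mu> A y = cmp g A x"
      using im[OF x] unfolding image_of_def by auto
    from someI_ex[OF this] show "h A x \<in> sec (src \<mu>) A" "cmp \<mu> A (h A x) = cmp g A x"
      unfolding h_def by blast+
  qed
  have "is_nat_trans U C (nat_of (src g) (src \<mu>) h)"
  proof (rule nat_of_nat_trans)
    show "is_presheaf U C (src g)" "is_presheaf U C (src \<mu>)"
      using N nat_src by blast+
    show "h A x \<in> sec (src \<mu>) A" if "x \<in> sec (src g) A" for A x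
      using h that by blast
    fix f x assume f: "f \<in> Arr C" "x \<in> sec (src g) (Cod C f)"
    have r: "res (src g) f x \<in> sec (src g) (Dom C f)"
      using presheaf_res[OF nat_src[OF N(2)] f] .
    show "h (Dom C f) (res (src g) f x) = res (src \<mu>) f (h (Cod C f) x)"
    proof (rule M(2))
      show "res (src \<mu>) f (h (Cod C f) x) \<in> sec (src \<mu>) (Dom C f)"
        using presheaf_res[OF nat_src[OF N(1)] f(1) h(1)[OF f(2)]] .
      show "cmp \<mu> (Dom C f) (h (Dom C f) (res (src g) f x)) =
          cmp \<mu> (Dom C f) (res (src \<mu>) f (h (Cod C f) x))"
        using h(2)[OF r] h(2)[OF f(2)] nat_res[OF N(2) f] nat_res[OF N(1) f(1) h(1)[OF f(2)]] g(2) by simp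
    qed (rule h(1)[OF r])
  qed
  then show thesis
    using that[of "nat_of (src g) (src \<mu>) h"] M(1) g h by simp
qed

text \<open>Each of the two maps lifts through the other, and injectivity makes the lifts mutually
  inverse. This is what reduces subobjects to families of subsets and spans to families of partial
  functions.\<close>

lemma M_Sh_iso:
  assumes \<mu>: "\<mu> \<in> M_Sh U C M" and \<nu>: "\<nu> \<in> M_Sh U C M" and t: "tgt \<mu> = tgt \<nu>"
    and im: "\<And>A. image_of \<mu> A = image_of \<nu> A"
  obtains i where "is_iso SH i" "src i = src \<nu>" "tgt i = src \<mu>" "\<nu> = \<mu> \<cdot>\<^bsub>SH\<^esub> i"
proof -
  note M = M_Sh_imp[OF \<mu>] and N = M_Sh_imp[OF \<nu>]
  have m: "cmp \<nu> A x \<in> image_of \<mu> A" if "x \<in> sec (src \<nu>) A" for A x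
    using im image_ofI[OF that] by simp
  have n: "cmp \<mu> A x \<in> image_of \<nu> A" if "x \<in> sec (src \<mu>) A" for A x
    using im[symmetric] image_ofI[OF that] by simp
  obtain i where i: "i \<in> Arr SH" "src i = src \<nu>" "tgt i = src \<mu>"
    "\<And>A x. x \<in> sec (src \<nu>) A \<Longrightarrow> cmp \<mu> A (cmp i A x) = cmp \<nu> A x"
    using lift_through[OF \<mu> N(1) t[symmetric] m] by blast
  obtain j where j: "j \<in> Arr SH" "src j = src \<mu>" "tgt j = src \<nu>"
    "\<And>A x. x \<in> sec (src \<mu>) A \<Longrightarrow> cmp \<nu> A (cmp j A x) = cmp \<mu> A x"
    using lift_through[OF \<nu> M(1) t n] by blast
  have ij: "is_nat_trans U C i" "is_nat_trans U C j" "is_presheaf U C (src \<mu>)" "is_presheaf U C (src \<nu>)"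
    using i(1) j(1) M(1) N(1) nat_src by (simp_all, blast+)
  have "j \<cdot>\<^bsub>SH\<^esub> i = Ide SH (src \<nu>)"
  proof (rule nat_trans_eqI[where U = U])
    fix A x assume "x \<in> sec (src (j \<cdot>\<^bsub>SH\<^esub> i)) A"
    then have x: "x \<in> sec (src \<nu>) A" "cmp i A x \<in> sec (src \<mu>) A"
      using i(2,3) nat_cmp[OF ij(1), of x A] by simp_all
    then have "cmp j A (cmp i A x) \<in> sec (src \<nu>) A"
      using nat_cmp[OF ij(2), of _ A] j by simp
    moreover have "cmp \<nu> A (cmp j A (cmp i A x)) = cmp \<nu> A x"
      using i(4)[OF x(1)] j(4)[OF x(2)] by simp
    ultimately have "cmp j A (cmp i A x) = x"
      using N(2) x(1) by blast
    then show "cmp (j \<cdot>\<^bsub>SH\<^esub> i) A x = cmp (Ide SH (src \<nu>)) A x"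
      using x i by simp
  qed (use i j ij in \<open>auto intro!: PSh_comp_nat PSh_ide_nat\<close>)
  moreover have "i \<cdot>\<^bsub>SH\<^esub> j = Ide SH (src \<mu>)"
  proof (rule nat_trans_eqI[where U = U])
    fix A x assume "x \<in> sec (src (i \<cdot>\<^bsub>SH\<^esub> j)) A"
    then have x: "x \<in> sec (src \<mu>) A" "cmp j A x \<in> sec (src \<nu>) A"
      using j(2,3) nat_cmp[OF ij(2), of x A] by simp_all
    then have "cmp i A (cmp j A x) \<in> sec (src \<mu>) A"
      using nat_cmp[OF ij(1), of _ A] i by simp
    moreover have "cmp \<mu> A (cmp i A (cmp j A x)) = cmp \<mu> A x"
      using j(4)[OF x(1)] i(4)[OF x(2)] by simp
    ultimately have "cmp i A (cmp j A x) = x"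
      using M(2) x(1) by blast
    then show "cmp (i \<cdot>\<^bsub>SH\<^esub> j) A x = cmp (Ide SH (src \<mu>)) A x"
      using x j by simp
  qed (use i j ij in \<open>auto intro!: PSh_comp_nat PSh_ide_nat\<close>)
  ultimately have "is_iso SH i"
    using i j by (intro SH.isoI[of i j]) simp_all
  moreover have "\<nu> = \<mu> \<cdot>\<^bsub>SH\<^esub> i"
  proof (rule nat_trans_eqI[where U = U])
    show "cmp \<nu> A x = cmp (\<mu> \<cdot>\<^bsub>SH\<^esub> i) A x" if "x \<in> sec (src \<nu>) A" for A x
      using that i by simp
  qed (use M(1) N(1) i t ij in \<open>auto intro!: PSh_comp_nat\<close>)
  ultimately show thesis
    using that i by blast
qed

section \<open>Inclusions of subsheaves and the axioms of an \<open>M\<close>-category\<close>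

definition incl :: "('o, 'v, 'v) presheaf \<Rightarrow> ('o \<Rightarrow> 'v set) \<Rightarrow> ('o, 'v, 'v) nat_trans" where
  "incl P T = nat_of (sub_presheaf C P T) P (\<lambda>A x. x)"

lemma incl_sel [simp]:
  "src (incl P T) = sub_presheaf C P T" "tgt (incl P T) = P" "x \<in> T A \<Longrightarrow> cmp (incl P T) A x = x"
  by (simp_all add: incl_def)

lemma image_of_incl [simp]: "image_of (incl P T) = T"
  by (rule ext) (force simp: image_of_def)

lemma incl_M_Sh:
  assumes "is_sheaf U C J P" "classified C M P T" "\<And>A. T A \<subseteq> sec P A"
  shows "incl P T \<in> M_Sh U C M"
proof (rule M_ShI)
  have T: "is_sheaf U C J (sub_presheaf C P T)"
    by (rule sub_presheaf_sheaf[OF assms])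
  have "is_nat_trans U C (incl P T)"
    unfolding incl_def
  proof (rule nat_of_nat_trans[OF sheaf_presheaf[OF T] sheaf_presheaf[OF assms(1)]])
    show "x \<in> sec P A" if "x \<in> sec (sub_presheaf C P T) A" for A x
      using that assms(3) by auto
  qed simp
  then show "incl P T \<in> Arr SH"
    using assms T by simp
qed (use assms in simp_all)

lemma small_Sh_Hom:
  assumes "is_presheaf U C P" "is_presheaf U C Q"
  shows "small U (Hom SH P Q)"
proof -
  let ?X = "\<lambda>P :: ('o, 'v, 'v) presheaf. \<Union>A\<in>Obj C. sec P A"
  \<comment> \<open>The value \<open>None\<close> off \<open>sec P A\<close> keeps the graph inside
    the sections; \<open>cmp \<phi> A\<close> itself has the default value \<open>undefined\<close>
    there.\<close>
  let ?g = "\<lambda>\<phi> A x. if x \<in> sec P A then Some (cmp \<phi> A x) else None"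
  have "?X P \<in> U" "?X Q \<in> U"
    using assms presheaf_sec by (auto intro!: universe_UN[OF universe small_Objs])
  then have "small U (?X P)" "small U (?X Q)"
    by (auto intro: small_mem)
  from small_partial_families[OF universe small_Objs this] show ?thesis
  proof (rule small_inj_on)
    show "inj_on ?g (Hom SH P Q)"
    proof (rule inj_onI)
      fix \<phi> \<psi> assume *: "\<phi> \<in> Hom SH P Q" "\<psi> \<in> Hom SH P Q" "?g \<phi> = ?g \<psi>"
      have "cmp \<phi> A x = cmp \<psi> A x" if "x \<in> sec P A" for A x
        using fun_cong[OF fun_cong[OF *(3), of A], of x] that by simp
      then show "\<phi> = \<psi>"
        using *(1,2) by (intro nat_trans_eqI[where U = U]) (auto simp: Sh_Hom_iff)
    qed
    show "?g ` Hom SH P Q \<subseteq> {\<phi>. \<forall>i x y. \<phi> i x = Some y \<longrightarrow> i \<in> Obj C \<and> x \<in> ?X P \<and> y \<in> ?X Q}"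
      using presheaf_sec_Obj[OF assms(1)] nat_cmp
      by (fastforce simp: Sh_Hom_iff split: if_splits)
  qed
qed

text \<open>The pullback is realized as the inclusion of the preimage \<open>?T\<close> of the image
  of \<open>\<mu>\<close>. By naturality of \<open>f\<close>, the subobject that classifies the
  value of \<open>f\<close> at \<open>r\<close> also classifies \<open>r\<close> with respect to
  \<open>?T\<close>.\<close>

lemma Sh_pullback_M:
  assumes \<mu>: "\<mu> \<in> M_Sh U C M" and f: "f \<in> Arr SH" "tgt f = tgt \<mu>"
  shows "\<exists>\<mu>' f'. \<mu>' \<in> M_Sh U C M \<and> is_pullback SH f \<mu> \<mu>' f'"
proof -
  note M = M_Sh_imp[OF \<mu>]
  have N: "is_nat_trans U C \<mu>" "is_nat_trans U C f" "is_sheaf U C J (src f)"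
    using M f by simp_all
  let ?T = "\<lambda>A. {r \<in> sec (src f) A. cmp f A r \<in> image_of \<mu> A}"
  have T: "classified C M (src f) ?T"
    unfolding classified_def
  proof (intro ballI)
    fix D r assume D: "D \<in> Obj C" "r \<in> sec (src f) D"
    then have "cmp f D r \<in> sec (tgt \<mu>) D"
      using nat_cmp[OF N(2), of r D] f by simp
    then obtain m where m: "m \<in> M" "Cod C m = D" "\<And>g. g \<in> Arr C \<Longrightarrow> Cod C g = D \<Longrightarrow>
        res (tgt \<mu>) g (cmp f D r) \<in> image_of \<mu> (Dom C g) \<longleftrightarrow> factors_through C g m"
      using classifiedE[OF M(3) D(1)] by blast
    have "res (src f) g r \<in> ?T (Dom C g) \<longleftrightarrow> factors_through C g m" if "g \<in> Arr C" "Cod C g = D" for g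
      using m(3)[OF that] nat_res[OF N(2) that(1), of r] presheaf_res[OF nat_src[OF N(2)] that(1), of r] D that f(2)
      by simp
    then show "\<exists>m\<in>M. Cod C m = D \<and> (\<forall>g\<in>Arr C. Cod C g = D \<longrightarrow>
        (res (src f) g r \<in> ?T (Dom C g) \<longleftrightarrow> factors_through C g m))"
      using m by blast
  qed
  have inc: "incl (src f) ?T \<in> M_Sh U C M"
    by (rule incl_M_Sh[OF N(3) T]) blast
  have incA: "incl (src f) ?T \<in> Arr SH"
    using M_Sh_imp(1)[OF inc] .
  let ?g = "f \<cdot>\<^bsub>SH\<^esub> incl (src f) ?T"
  have g: "?g \<in> Arr SH" "tgt ?g = tgt \<mu>" "src ?g = sub_presheaf C (src f) ?T"
    using SH.comp_Arr[OF incA f(1)] f(2) by simp_all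
  have gx: "cmp ?g A x = cmp f A x" if "x \<in> ?T A" for A x
    using that by simp
  have im: "cmp ?g A x \<in> image_of \<mu> A" if "x \<in> sec (src ?g) A" for A x
    using that gx[of x A] g(3) by simp
  obtain h where h: "h \<in> Arr SH" "src h = sub_presheaf C (src f) ?T" "tgt h = src \<mu>"
    "\<And>A x. x \<in> ?T A \<Longrightarrow> cmp \<mu> A (cmp h A x) = cmp f A x"
    using lift_through[OF \<mu> g(1,2) im] g(3) gx by auto
  have "is_pullback SH f \<mu> (incl (src f) ?T) h"
  proof (rule Sh_pullbackI)
    show "cmp f A (cmp (incl (src f) ?T) A e) = cmp \<mu> A (cmp h A e)"
      if "e \<in> sec (src (incl (src f) ?T)) A" for A e
      using that h(4)[of e A] by simp
    fix A a x assume a: "a \<in> sec (src f) A" and x: "x \<in> sec (src \<mu>) A" and eq: "cmp f A a = cmp \<mu> A x"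
    have aT: "a \<in> ?T A"
      using a image_ofI[OF x] eq by simp
    have "cmp h A a \<in> sec (src \<mu>) A"
      using nat_cmp[of U h a A] h aT by simp
    moreover have "cmp \<mu> A (cmp h A a) = cmp \<mu> A x"
      using h(4)[OF aT] eq by simp
    ultimately have ha: "cmp h A a = x"
      by (rule M(2)[OF _ x])
    show "\<exists>!e. e \<in> sec (src (incl (src f) ?T)) A \<and> cmp (incl (src f) ?T) A e = a \<and> cmp h A e = x"
    proof (rule ex1I[of _ a])
      show "a \<in> sec (src (incl (src f) ?T)) A \<and> cmp (incl (src f) ?T) A a = a \<and> cmp h A a = x"
        using aT ha incl_sel(3)[of a ?T A "src f", OF aT] by simp
      fix e assume e: "e \<in> sec (src (incl (src f) ?T)) A \<and> cmp (incl (src f) ?T) A e = a \<and> cmp h A e = x"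
      then have "e \<in> ?T A"
        by simp
      from incl_sel(3)[of e ?T A "src f", OF this] show "e = a"
        using e by simp
    qed
  qed (use f M(1) incA h in simp_all)
  then show ?thesis
    using inc by blast
qed

text \<open>Let \<open>n\<close> classify the section \<open>r\<close> with respect to
  \<open>\<nu>\<close>. Restricted along \<open>n\<close>, \<open>r\<close> has a preimage
  \<open>y\<close>; let \<open>m\<close> classify \<open>y\<close> with respect to
  \<open>\<mu>\<close>. Then \<open>n \<cdot> m\<close> classifies \<open>r\<close> with respect to
  the composite.\<close>

lemma Sh_comp_M:
  assumes \<mu>: "\<mu> \<in> M_Sh U C M" and \<nu>: "\<nu> \<in> M_Sh U C M" and t: "tgt \<mu> = src \<nu>"
  shows "\<nu> \<cdot>\<^bsub>SH\<^esub> \<mu> \<in> M_Sh U C M"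
proof (rule M_ShI)
  note M = M_Sh_imp[OF \<mu>] and N = M_Sh_imp[OF \<nu>]
  have nat: "is_nat_trans U C \<mu>" "is_nat_trans U C \<nu>"
    using M N by simp_all
  show "\<nu> \<cdot>\<^bsub>SH\<^esub> \<mu> \<in> Arr SH"
    using SH.comp_Arr(1)[OF M(1) N(1)] t by simp
  show "x = y" if "x \<in> sec (src (\<nu> \<cdot>\<^bsub>SH\<^esub> \<mu>)) A" "y \<in> sec (src (\<nu> \<cdot>\<^bsub>SH\<^esub> \<mu>)) A"
    "cmp (\<nu> \<cdot>\<^bsub>SH\<^esub> \<mu>) A x = cmp (\<nu> \<cdot>\<^bsub>SH\<^esub> \<mu>) A y" for A x y
    using that M(2)[of x A y] N(2)[of "cmp \<mu> A x" A "cmp \<mu> A y"] nat_cmp[OF nat(1), of _ A] t by simp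
  show "classified C M (tgt (\<nu> \<cdot>\<^bsub>SH\<^esub> \<mu>)) (image_of (\<nu> \<cdot>\<^bsub>SH\<^esub> \<mu>))"
    unfolding classified_def
  proof (intro ballI)
    fix D r assume "D \<in> Obj C" "r \<in> sec (tgt (\<nu> \<cdot>\<^bsub>SH\<^esub> \<mu>)) D"
    then have D: "D \<in> Obj C" "r \<in> sec (tgt \<nu>) D"
      by simp_all
    obtain n where n: "n \<in> M" "Cod C n = D" "\<And>f. f \<in> Arr C \<Longrightarrow> Cod C f = D \<Longrightarrow>
        res (tgt \<nu>) f r \<in> image_of \<nu> (Dom C f) \<longleftrightarrow> factors_through C f n"
      using classifiedE[OF N(3) D] by blast
    have nA: "n \<in> Arr C" "Dom C n \<in> Obj C"
      using n M_Arr Dom_Obj by blast+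
    have "res (tgt \<nu>) n r \<in> image_of \<nu> (Dom C n)"
      using n(3)[OF nA(1) n(2)] factors_through_refl[OF nA(1)] by simp
    then obtain y where y: "y \<in> sec (src \<nu>) (Dom C n)" "cmp \<nu> (Dom C n) y = res (tgt \<nu>) n r"
      unfolding image_of_def by auto
    obtain m where m: "m \<in> M" "Cod C m = Dom C n" "\<And>f. f \<in> Arr C \<Longrightarrow> Cod C f = Dom C n \<Longrightarrow>
        res (tgt \<mu>) f y \<in> image_of \<mu> (Dom C f) \<longleftrightarrow> factors_through C f m"
      using classifiedE[OF M(3) nA(2)] y(1) t by metis
    have mA: "m \<in> Arr C"
      using m M_Arr by blast
    have y_w: "cmp \<nu> (Dom C w) (res (src \<nu>) w y) = res (tgt \<nu>) (n \<cdot> w) r" "res (src \<nu>) w y \<in> sec (src \<nu>) (Dom C w)"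
      if "w \<in> Arr C" "Cod C w = Dom C n" for w
      using nat_res[OF nat(2) that(1), of y] y that presheaf_res[OF nat_src[OF nat(2)] that(1), of y]
        presheaf_res_comp[OF nat_tgt[OF nat(2)] that(1) nA(1), of r] D n(2) by simp_all
    \<comment> \<open>Along an arrow that factors through \<open>n\<close>, injectivity of
      \<open>\<nu>\<close> turns the question about \<open>r\<close> into one about
      \<open>y\<close>.\<close>
    have key: "res (tgt \<nu>) (n \<cdot> w) r \<in> image_of (\<nu> \<cdot>\<^bsub>SH\<^esub> \<mu>) (Dom C w) \<longleftrightarrow> factors_through C w m"
      if w: "w \<in> Arr C" "Cod C w = Dom C n" for w
    proof -
      have "res (tgt \<nu>) (n \<cdot> w) r \<in> image_of (\<nu> \<cdot>\<^bsub>SH\<^esub> \<mu>) (Dom C w) \<longleftrightarrow>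
          (\<exists>x\<in>sec (src \<mu>) (Dom C w). cmp \<nu> (Dom C w) (cmp \<mu> (Dom C w) x) = cmp \<nu> (Dom C w) (res (src \<nu>) w y))"
        unfolding y_w(1)[OF w] image_of_def by (auto simp: image_iff intro: sym)
      also have "\<dots> \<longleftrightarrow> (\<exists>x\<in>sec (src \<mu>) (Dom C w). cmp \<mu> (Dom C w) x = res (src \<nu>) w y)"
        using N(2)[OF _ y_w(2)[OF w]] nat_cmp[OF nat(1), of _ "Dom C w"] t by metis
      also have "\<dots> \<longleftrightarrow> res (tgt \<mu>) w y \<in> image_of \<mu> (Dom C w)"
        unfolding image_of_def using t by (auto simp: image_iff intro: sym)
      finally show ?thesis
        using m(3)[OF w] by simp
    qed
    have "res (tgt \<nu>) f r \<in> image_of (\<nu> \<cdot>\<^bsub>SH\<^esub> \<mu>) (Dom C f) \<longleftrightarrow> factors_through C f (n \<cdot> m)"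
      if f: "f \<in> Arr C" "Cod C f = D" for f
    proof
      assume a: "res (tgt \<nu>) f r \<in> image_of (\<nu> \<cdot>\<^bsub>SH\<^esub> \<mu>) (Dom C f)"
      then obtain x where "x \<in> sec (src \<mu>) (Dom C f)"
          "res (tgt \<nu>) f r = cmp \<nu> (Dom C f) (cmp \<mu> (Dom C f) x)"
        unfolding image_of_def by auto
      then have "res (tgt \<nu>) f r \<in> image_of \<nu> (Dom C f)"
        using nat_cmp[OF nat(1), of x "Dom C f"] t by (simp add: image_ofI)
      then obtain w where w: "w \<in> Arr C" "Dom C f = Dom C w" "Cod C w = Dom C n" "f = n \<cdot> w"
        using n(3)[OF f] factors_throughE by metis
      then have "factors_through C w m"
        using key[OF w(1,3)] a by simp
      then obtain v where v: "v \<in> Arr C" "Dom C w = Dom C v" "Cod C v = Dom C m" "w = m \<cdot> v"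
        by (rule factors_throughE)
      have "f = (n \<cdot> m) \<cdot> v"
        using w(4) v nA mA m(2) by (simp add: comp_assoc)
      then show "factors_through C f (n \<cdot> m)"
        using v w(2) nA mA m(2) by (intro factors_throughI[of v]) simp_all
    next
      assume "factors_through C f (n \<cdot> m)"
      then obtain v where v: "v \<in> Arr C" "Dom C f = Dom C v" "Cod C v = Dom C (n \<cdot> m)" "f = (n \<cdot> m) \<cdot> v"
        by (rule factors_throughE)
      then have w: "m \<cdot> v \<in> Arr C" "Cod C (m \<cdot> v) = Dom C n" "f = n \<cdot> (m \<cdot> v)" "Dom C (m \<cdot> v) = Dom C f"
        using nA mA m(2) by (simp_all add: comp_assoc)
      have "factors_through C (m \<cdot> v) m"
        using v nA mA m(2) by (intro factors_throughI[of v]) simp_all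
      then show "res (tgt \<nu>) f r \<in> image_of (\<nu> \<cdot>\<^bsub>SH\<^esub> \<mu>) (Dom C f)"
        using key[OF w(1,2)] w(3,4) by simp
    qed
    then show "\<exists>m\<in>M. Cod C m = D \<and> (\<forall>f\<in>Arr C. Cod C f = D \<longrightarrow>
        (res (tgt (\<nu> \<cdot>\<^bsub>SH\<^esub> \<mu>)) f r \<in> image_of (\<nu> \<cdot>\<^bsub>SH\<^esub> \<mu>) (Dom C f) \<longleftrightarrow> factors_through C f m))"
      using Comp_M[OF m(1) n(1) m(2)] nA mA m(2) n(2) by (intro bexI[of _ "n \<cdot> m"]) simp_all
  qed
qed

text \<open>The inverse makes every section of the target lie in the image, so the identity
  classifies every section.\<close>

lemma Sh_iso_M:
  assumes "is_iso SH i"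
  shows "i \<in> M_Sh U C M"
proof -
  obtain j where "i \<in> Arr SH" "j \<in> Arr SH" "Dom SH j = Cod SH i" "Cod SH j = Dom SH i"
    "j \<cdot>\<^bsub>SH\<^esub> i = Ide SH (Dom SH i)" "i \<cdot>\<^bsub>SH\<^esub> j = Ide SH (Cod SH i)"
    using assms by (rule SH.isoE)
  then have i: "i \<in> Arr SH" "is_nat_trans U C i" "is_nat_trans U C j" "src j = tgt i" "tgt j = src i"
    "j \<cdot>\<^bsub>PSh U C\<^esub> i = Ide (PSh U C) (src i)" "i \<cdot>\<^bsub>PSh U C\<^esub> j = Ide (PSh U C) (tgt i)"
    by simp_all
  have ji: "cmp j A (cmp i A x) = x" if "x \<in> sec (src i) A" for A x
    using that PSh_comp_sel(3)[OF that, of U j] PSh_ide_sel(3)[OF that, of U] i(6) by simp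
  have im: "y \<in> image_of i A" if y: "y \<in> sec (tgt i) A" for A y
  proof -
    have "cmp (i \<cdot>\<^bsub>PSh U C\<^esub> j) A y = y"
      unfolding i(7) using y by simp
    then have "cmp i A (cmp j A y) = y"
      using y i(4) by simp
    moreover have "cmp j A y \<in> sec (src i) A"
      using nat_cmp[OF i(3), of y A] i(4,5) y by simp
    ultimately show ?thesis
      using image_ofI[of "cmp j A y" i A] by simp
  qed
  show ?thesis
  proof (rule M_ShI[OF i(1)])
    show "x = y" if "x \<in> sec (src i) A" "y \<in> sec (src i) A" "cmp i A x = cmp i A y" for A x y
      using ji[OF that(1)] ji[OF that(2)] unfolding that(3) by (rule trans[OF sym])
    show "classified C M (tgt i) (image_of i)"
      unfolding classified_def
    proof (intro ballI)
      fix D q assume D: "D \<in> Obj C" "q \<in> sec (tgt i) D"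
      have "res (tgt i) f q \<in> image_of i (Dom C f) \<longleftrightarrow> factors_through C f (Ide C D)"
        if "f \<in> Arr C" "Cod C f = D" for f
        using im[OF presheaf_res[OF nat_tgt[OF i(2)] that(1)], of q] that D
          factors_throughI[of f C f "Ide C D"] by simp
      then show "\<exists>m\<in>M. Cod C m = D \<and> (\<forall>f\<in>Arr C. Cod C f = D \<longrightarrow>
          (res (tgt i) f q \<in> image_of i (Dom C f) \<longleftrightarrow> factors_through C f m))"
        using D by (intro bexI[of _ "Ide C D"]) (simp_all add: Ide_M)
    qed
  qed
qed

lemma Sh_M_monic:
  assumes \<mu>: "\<mu> \<in> M_Sh U C M"
  shows "is_monic SH \<mu>"
  unfolding is_monic_def
proof (intro conjI ballI impI)
  note M = M_Sh_imp[OF \<mu>]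
  show "\<mu> \<in> Arr SH" by (rule M(1))
  fix f g assume fg: "f \<in> Arr SH" "g \<in> Arr SH" "Dom SH f = Dom SH g" "Cod SH f = Dom SH \<mu>"
    "Cod SH g = Dom SH \<mu>" "\<mu> \<cdot>\<^bsub>SH\<^esub> f = \<mu> \<cdot>\<^bsub>SH\<^esub> g"
  show "f = g"
  proof (rule nat_trans_eqI[where U = U])
    fix A x assume x: "x \<in> sec (src f) A"
    have "cmp (\<mu> \<cdot>\<^bsub>SH\<^esub> f) A x = cmp (\<mu> \<cdot>\<^bsub>SH\<^esub> g) A x"
      by (simp only: fg(6))
    then have "cmp \<mu> A (cmp f A x) = cmp \<mu> A (cmp g A x)"
      using x fg(3) by simp
    then show "cmp f A x = cmp g A x"
      using M(2)[of "cmp f A x" A "cmp g A x"] nat_cmp[of U f x A] nat_cmp[of U g x A] fg(1-5) x by simp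
  qed (use fg in simp_all)
qed

text \<open>Every subobject is represented by the inclusion of its image, so the subobjects are
  indexed by families of subsets of \<open>P\<close>. Such a family is coded by its partial identity
  functions.\<close>

lemma small_Sh_Sub:
  assumes "is_presheaf U C P"
  shows "small U (carrier (Sub_poset SH (M_Sh U C M) P))"
proof -
  let ?F = "{T. \<forall>A. T A \<subseteq> sec P A}"
  let ?X = "\<Union>A\<in>Obj C. sec P A"
  let ?g = "\<lambda>(T :: 'o \<Rightarrow> 'v set) A x. if x \<in> T A then Some x else None"
  have "?X \<in> U"
    using assms presheaf_sec by (auto intro!: universe_UN[OF universe small_Objs])
  then have "small U ?X"
    by (rule small_mem)
  from small_partial_families[OF universe small_Objs this this] have "small U ?F"
  proof (rule small_inj_on)
    show "inj_on ?g ?F"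
    proof (rule inj_onI)
      fix T T' assume eq: "?g T = ?g T'"
      have "x \<in> T A \<longleftrightarrow> x \<in> T' A" for A x
        using fun_cong[OF fun_cong[OF eq, of A], of x] by (simp split: if_splits)
      then show "T = T'"
        by blast
    qed
    show "?g ` ?F \<subseteq> {\<phi>. \<forall>i x y. \<phi> i x = Some y \<longrightarrow> i \<in> Obj C \<and> x \<in> ?X \<and> y \<in> ?X}"
      using presheaf_sec_Obj[OF assms] by (fastforce split: if_splits)
  qed
  then have "small U ((\<lambda>T. subobj SH (incl P T)) ` ?F)"
    by (rule small_image)
  moreover have "carrier (Sub_poset SH (M_Sh U C M) P) \<subseteq> (\<lambda>T. subobj SH (incl P T)) ` ?F"
  proof
    fix X assume "X \<in> carrier (Sub_poset SH (M_Sh U C M) P)"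
    then obtain \<mu> where \<mu>: "\<mu> \<in> M_Sh U C M" "tgt \<mu> = P" "X = subobj SH \<mu>"
      by (auto simp: Sub_poset_def)
    note M = M_Sh_imp[OF \<mu>(1)]
    have T: "image_of \<mu> A \<subseteq> sec P A" for A
      using nat_cmp[of U \<mu>] M(1) \<mu>(2) by (auto simp: image_of_def)
    have inc: "incl P (image_of \<mu>) \<in> M_Sh U C M"
      using M \<mu>(2) T by (intro incl_M_Sh) simp_all
    obtain i where "is_iso SH i" "tgt i = src (incl P (image_of \<mu>))" "\<mu> = incl P (image_of \<mu>) \<cdot>\<^bsub>SH\<^esub> i"
      using M_Sh_iso[OF inc \<mu>(1)] \<mu>(2) by auto
    then have "X = subobj SH (incl P (image_of \<mu>))"
      using SH.subobj_iso[OF M_Sh_imp(1)[OF inc], of i] \<mu>(3) by (simp del: incl_sel)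
    then show "X \<in> (\<lambda>T. subobj SH (incl P T)) ` ?F"
      using T by blast
  qed
  ultimately show ?thesis
    by (rule small_subset)
qed

sublocale ShM: M_category U SH "M_Sh U C M"
proof
  show "small U (Hom SH A B)" if "A \<in> Obj SH" "B \<in> Obj SH" for A B
    using that sheaf_presheaf by (intro small_Sh_Hom) auto
  show "n \<cdot>\<^bsub>SH\<^esub> m \<in> M_Sh U C M" if "m \<in> M_Sh U C M" "n \<in> M_Sh U C M" "Cod SH m = Dom SH n" for m n
    using Sh_comp_M that by simp
  show "\<exists>m' f'. m' \<in> M_Sh U C M \<and> is_pullback SH f m m' f'"
    if "m \<in> M_Sh U C M" "f \<in> Arr SH" "Cod SH f = Cod SH m" for m f
    using Sh_pullback_M[OF that(1,2)] that(3) by simp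
  show "small U (carrier (Sub_poset SH (M_Sh U C M) A))" if "A \<in> Obj SH" for A
    using that sheaf_presheaf by (intro small_Sh_Sub) auto
qed (fact Sh_M_monic Sh_iso_M)+

end


section \<open>Transfer of join restriction structure\<close>

text \<open>The map \<open>F\<close> is a bijection on arrows that preserves all the structure, with
  objects fixed; injectivity reflects each equation from \<open>Y\<close> to \<open>X\<close>. The
  category axioms of \<open>X\<close> are also among what is transported, so that associativity and
  the identity laws for classes of spans come from the partial functions.\<close>

lemma join_restriction_category_transfer:
  fixes X :: "('o, 'a) cat" and Y :: "('o, 'b) cat"
  assumes Y: "join_restriction_category U Y r'"
    and Obj: "Obj X = Obj Y"
    and F: "\<And>f. f \<in> Arr X \<Longrightarrow> F f \<in> Arr Y \<and> Dom Y (F f) = Dom X f \<and> Cod Y (F f) = Cod X f"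
    and inj: "inj_on F (Arr X)"
    and surj: "\<And>g. g \<in> Arr Y \<Longrightarrow> \<exists>f\<in>Arr X. F f = g"
    and Ide: "\<And>A. A \<in> Obj X \<Longrightarrow> Ide X A \<in> Arr X \<and> F (Ide X A) = Ide Y A"
    and Comp: "\<And>f g. f \<in> Arr X \<Longrightarrow> g \<in> Arr X \<Longrightarrow> Cod X f = Dom X g \<Longrightarrow>
      g \<cdot>\<^bsub>X\<^esub> f \<in> Arr X \<and> F (g \<cdot>\<^bsub>X\<^esub> f) = F g \<cdot>\<^bsub>Y\<^esub> F f"
    and rst: "\<And>f. f \<in> Arr X \<Longrightarrow> r f \<in> Arr X \<and> F (r f) = r' (F f)"
  shows "join_restriction_category U X r"
proof -
  interpret Y: join_restriction_category U Y r' by (rule Y)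
  have H: "f \<in> Hom X A B \<Longrightarrow> F f \<in> Hom Y A B" for f A B
    using F by (auto simp: in_Hom_iff)
  have H': "f \<in> Arr X \<Longrightarrow> F f \<in> Hom Y A B \<Longrightarrow> f \<in> Hom X A B" for f A B
    using F by (auto simp: in_Hom_iff)
  have HA: "f \<in> Hom X A B \<Longrightarrow> f \<in> Arr X" for f A B
    by (simp add: in_Hom_iff)
  have CA: "g \<cdot>\<^bsub>X\<^esub> f \<in> Arr X" "F (g \<cdot>\<^bsub>X\<^esub> f) = F g \<cdot>\<^bsub>Y\<^esub> F f"
    if "f \<in> Hom X A B" "g \<in> Hom X B D" for f g A B D
    using Comp that by (auto simp: in_Hom_iff)
  have CH: "g \<cdot>\<^bsub>X\<^esub> f \<in> Hom X A D" if "f \<in> Hom X A B" "g \<in> Hom X B D" for f g A B D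
    using H'[OF CA(1)[OF that]] CA(2)[OF that] Y.Comp_Hom[OF H[OF that(1)] H[OF that(2)]] by simp
  have IH: "Ide X A \<in> Hom X A A" if "A \<in> Obj X" for A
    using H'[of "Ide X A" A A] Ide[OF that] Y.Ide_Hom[of A] that Obj by simp
  have RH: "r f \<in> Hom X A A" if "f \<in> Hom X A B" for f A B
    using H'[of "r f" A A] rst[OF HA[OF that]] Y.rst_Hom[OF H[OF that]] by simp
  have Fr: "F (r f) = r' (F f)" if "f \<in> Hom X A B" for f A B
    using rst[OF HA[OF that]] by blast
  have eqI: "f = g" if "f \<in> Hom X A B" "g \<in> Hom X A' B'" "F f = F g" for f g A B A' B'
    using inj that HA unfolding inj_on_def by blast
  have surjH: "\<exists>f\<in>Hom X A B. F f = g" if "g \<in> Hom Y A B" for g A B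
  proof -
    obtain f where "f \<in> Arr X" "F f = g"
      using surj[of g] \<open>g \<in> Hom Y A B\<close> by (auto simp: in_Hom_iff)
    then show ?thesis
      using H'[of f A B] that by auto
  qed
  let ?L = "hom_poset X r" and ?L' = "hom_poset Y r'"
  \<comment> \<open>The order is defined by composition and restriction, both preserved, so
    \<open>F\<close> is an isomorphism of hom-posets and transports joins in both
    directions.\<close>
  have le: "le (?L A B) f g \<longleftrightarrow> le (?L' A B) (F f) (F g)" if "f \<in> Hom X A B" "g \<in> Hom X A B" for f g A B
  proof -
    have "F (g \<cdot>\<^bsub>X\<^esub> r f) = F g \<cdot>\<^bsub>Y\<^esub> r' (F f)"
      using CA(2)[OF RH[OF that(1)] that(2)] Fr[OF that(1)] by simp
    then show ?thesis
      using eqI[OF that(1) CH[OF RH[OF that(1)] that(2)]] by (auto simp: hom_poset_def)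
  qed
  have car: "carrier (?L A B) = Hom X A B" "carrier (?L' A B) = Hom Y A B" for A B
    by (simp_all add: hom_poset_def)
  have join: "is_join (?L A B) S j \<longleftrightarrow> j \<in> Hom X A B \<and> is_join (?L' A B) (F ` S) (F j)"
    if S: "S \<subseteq> Hom X A B" for A B S j
  proof -
    have sub: "S \<subseteq> carrier (?L A B)" "F ` S \<subseteq> carrier (?L' A B)"
      using S H by (auto simp: car)
    show ?thesis
    proof
      assume j: "is_join (?L A B) S j"
      note J = is_joinD[OF j sub(1), unfolded car]
      have "is_join (?L' A B) (F ` S) (F j)"
      proof (rule is_joinI[OF _ _ sub(2)])
        show "F j \<in> carrier (?L' A B)"
          using H[OF J(1)] by (simp add: car)
        show "le (?L' A B) s (F j)" if "s \<in> F ` S" for s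
          using that J(2) le[OF _ J(1)] S by blast
        fix k assume k: "k \<in> carrier (?L' A B)" "\<And>s. s \<in> F ` S \<Longrightarrow> le (?L' A B) s k"
        then obtain l where l: "l \<in> Hom X A B" "F l = k"
          using surjH[of k A B] by (auto simp: car)
        have "le (?L A B) s l" if "s \<in> S" for s
          using le[of s A B l] l k(2)[of "F s"] that S by blast
        then show "le (?L' A B) (F j) k"
          using J(3)[OF l(1)] le[OF J(1) l(1)] l(2) by simp
      qed
      then show "j \<in> Hom X A B \<and> is_join (?L' A B) (F ` S) (F j)"
        using J(1) by blast
    next
      assume "j \<in> Hom X A B \<and> is_join (?L' A B) (F ` S) (F j)"
      then have jH: "j \<in> Hom X A B" and j: "is_join (?L' A B) (F ` S) (F j)"
        by blast+
      note J = is_joinD[OF j sub(2), unfolded car]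
      show "is_join (?L A B) S j"
      proof (rule is_joinI[OF _ _ sub(1)])
        show "j \<in> carrier (?L A B)"
          using jH by (simp add: car)
        show "le (?L A B) s j" if "s \<in> S" for s
          using that J(2)[of "F s"] le[of s A B j] jH S by blast
        fix k assume k: "k \<in> carrier (?L A B)" "\<And>s. s \<in> S \<Longrightarrow> le (?L A B) s k"
        then have kH: "k \<in> Hom X A B"
          by (simp add: car)
        have "le (?L' A B) s (F k)" if "s \<in> F ` S" for s
          using that k(2) le[OF _ kH] S by blast
        then show "le (?L A B) j k"
          using J(3)[OF H[OF kH]] le[OF jH kH] by simp
      qed
    qed
  qed
  have compat: "compatible_set Y r' (F ` S)" if S: "S \<subseteq> Hom X A B" "compatible_set X r S" for S A B
    unfolding compatible_set_def
  proof (clarify)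
    fix f g assume "f \<in> S" "g \<in> S"
    then have fg: "f \<in> Hom X A B" "g \<in> Hom X A B" "f \<cdot>\<^bsub>X\<^esub> r g = g \<cdot>\<^bsub>X\<^esub> r f"
      using S unfolding compatible_set_def by blast+
    show "F f \<cdot>\<^bsub>Y\<^esub> r' (F g) = F g \<cdot>\<^bsub>Y\<^esub> r' (F f)"
      using CA(2)[OF RH[OF fg(2)] fg(1)] CA(2)[OF RH[OF fg(1)] fg(2)] Fr[OF fg(1)] Fr[OF fg(2)] fg(3)
      by simp
  qed
  show ?thesis
  proof
    show "Dom X f \<in> Obj X" "Cod X f \<in> Obj X" if "f \<in> Arr X" for f
      using F[OF that] Y.Dom_Obj[of "F f"] Y.Cod_Obj[of "F f"] Obj by simp_all
    show "Ide X A \<in> Hom X A A" if "A \<in> Obj X" for A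
      by (rule IH[OF that])
    show "g \<cdot>\<^bsub>X\<^esub> f \<in> Hom X A D" if "f \<in> Hom X A B" "g \<in> Hom X B D" for f A B g D
      by (rule CH[OF that])
    show "f \<cdot>\<^bsub>X\<^esub> Ide X A = f" "Ide X B \<cdot>\<^bsub>X\<^esub> f = f" if f: "f \<in> Hom X A B" for f A B
    proof -
      have O: "A \<in> Obj X" "B \<in> Obj X"
        using H[OF f] Y.Dom_Obj[of "F f"] Y.Cod_Obj[of "F f"] Obj by (auto simp: in_Hom_iff)
      show "f \<cdot>\<^bsub>X\<^esub> Ide X A = f"
        using eqI[OF CH[OF IH[OF O(1)] f] f] CA(2)[OF IH[OF O(1)] f] Ide[OF O(1)] Y.Comp_Ide[OF H[OF f]] by simp
      show "Ide X B \<cdot>\<^bsub>X\<^esub> f = f"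
        using eqI[OF CH[OF f IH[OF O(2)]] f] CA(2)[OF f IH[OF O(2)]] Ide[OF O(2)] Y.Ide_Comp[OF H[OF f]] by simp
    qed
    show "(h \<cdot>\<^bsub>X\<^esub> g) \<cdot>\<^bsub>X\<^esub> f = h \<cdot>\<^bsub>X\<^esub> (g \<cdot>\<^bsub>X\<^esub> f)"
      if f: "f \<in> Hom X A B" and g: "g \<in> Hom X B D" and h: "h \<in> Hom X D E" for f A B g D h E
      using eqI[OF CH[OF f CH[OF g h]] CH[OF CH[OF f g] h]] CA(2)[OF f CH[OF g h]] CA(2)[OF CH[OF f g] h]
        CA(2)[OF f g] CA(2)[OF g h] Y.Comp_assoc[OF H[OF f] H[OF g] H[OF h]] by simp
    show "small U (Hom X A B)" if "A \<in> Obj X" "B \<in> Obj X" for A B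
    proof (rule small_inj_on)
      show "small U (Hom Y A B)"
        using Y.small_Hom that Obj by simp
      show "inj_on F (Hom X A B)"
        using inj HA by (auto intro: inj_on_subset)
    qed (use H in blast)
    show "r f \<in> Hom X A A" if "f \<in> Hom X A B" for f A B
      by (rule RH[OF that])
    show "f \<cdot>\<^bsub>X\<^esub> r f = f" if f: "f \<in> Hom X A B" for f A B
      using eqI[OF CH[OF RH[OF f] f] f] CA(2)[OF RH[OF f] f] Fr[OF f] Y.R1[OF H[OF f]] by simp
    show "r g \<cdot>\<^bsub>X\<^esub> r f = r f \<cdot>\<^bsub>X\<^esub> r g" if f: "f \<in> Hom X A B" and g: "g \<in> Hom X A D" for f A B g D
      using eqI[OF CH[OF RH[OF f] RH[OF g]] CH[OF RH[OF g] RH[OF f]]] CA(2)[OF RH[OF f] RH[OF g]]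
        CA(2)[OF RH[OF g] RH[OF f]] Fr[OF f] Fr[OF g] Y.R2[OF H[OF f] H[OF g]] by simp
    show "r (g \<cdot>\<^bsub>X\<^esub> r f) = r g \<cdot>\<^bsub>X\<^esub> r f" if f: "f \<in> Hom X A B" and g: "g \<in> Hom X A D" for f A B g D
    proof -
      note gf = CH[OF RH[OF f] g]
      show ?thesis
        using eqI[OF RH[OF gf] CH[OF RH[OF f] RH[OF g]]] CA(2)[OF RH[OF f] RH[OF g]]
          CA(2)[OF RH[OF f] g] Fr[OF f] Fr[OF g] Fr[OF gf] Y.R3[OF H[OF f] H[OF g]] by simp
    qed
    show "r h \<cdot>\<^bsub>X\<^esub> f = f \<cdot>\<^bsub>X\<^esub> r (h \<cdot>\<^bsub>X\<^esub> f)" if f: "f \<in> Hom X A B" and h: "h \<in> Hom X B D" for f A B h D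
    proof -
      note hf = CH[OF f h]
      show ?thesis
        using eqI[OF CH[OF f RH[OF h]] CH[OF RH[OF hf] f]] CA(2)[OF f RH[OF h]]
          CA(2)[OF RH[OF hf] f] CA(2)[OF f h] Fr[OF h] Fr[OF hf] Y.R4[OF H[OF f] H[OF h]] by simp
    qed
  next
    fix A B S assume AB: "A \<in> Obj X" "B \<in> Obj X" and S: "S \<subseteq> Hom X A B" "compatible_set X r S"
    have FS: "F ` S \<subseteq> Hom Y A B"
      using S H by blast
    have AB': "A \<in> Obj Y" "B \<in> Obj Y"
      using AB Obj by simp_all
    note cS = compat[OF S]
    obtain j where j: "is_join (?L' A B) (F ` S) j"
      using Y.joins[OF AB' FS cS] by blast
    then have "j \<in> Hom Y A B"
      using is_joinD(1)[OF j] FS by (simp add: car)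
    then obtain l where "l \<in> Hom X A B" "F l = j"
      using surjH by blast
    then show "\<exists>j. is_join (?L A B) S j"
      using join[OF S(1)] j by blast
    fix j assume "is_join (?L A B) S j"
    then have j: "j \<in> Hom X A B" "is_join (?L' A B) (F ` S) (F j)"
      using join[OF S(1)] by blast+
    have im: "F ` r ` S = r' ` F ` S"
      using Fr S(1) by (auto simp: image_image intro!: image_cong)
    have "r ` S \<subseteq> Hom X A A"
      using RH S(1) by blast
    then show "is_join (?L A A) (r ` S) (r j)"
      using join[of "r ` S" A A "r j"] Y.J1[OF AB' FS cS j(2)] im Fr[OF j(1)] RH[OF j(1)] by simp
    fix g A' assume g: "g \<in> Hom X A' A"
    have im: "F ` (\<lambda>s. s \<cdot>\<^bsub>X\<^esub> g) ` S = (\<lambda>s. s \<cdot>\<^bsub>Y\<^esub> F g) ` F ` S"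
      unfolding image_image using CA(2)[OF g] S(1) by (intro image_cong) auto
    have "(\<lambda>s. s \<cdot>\<^bsub>X\<^esub> g) ` S \<subseteq> Hom X A' B"
      using CH[OF g] S(1) by blast
    then show "is_join (?L A' B) ((\<lambda>s. s \<cdot>\<^bsub>X\<^esub> g) ` S) (j \<cdot>\<^bsub>X\<^esub> g)"
      using join[of "(\<lambda>s. s \<cdot>\<^bsub>X\<^esub> g) ` S" A' B "j \<cdot>\<^bsub>X\<^esub> g"] Y.J2[OF AB' FS cS j(2) H[OF g]] im
        CA(2)[OF g j(1)] CH[OF g j(1)] by simp
  qed
qed


section \<open>Partial maps of sheaves\<close>

text \<open>A class of spans \<open>(\<mu>, f)\<close> of sheaves is determined by the family of partial functions sending
  \<open>\<mu> y\<close> to \<open>f y\<close>. In terms of these families the restriction structure is pointwise.\<close>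

record ('o, 'a, 'v) pmap =
  psrc :: "('o, 'a, 'v) presheaf"
  ptgt :: "('o, 'a, 'v) presheaf"
  app :: "'o \<Rightarrow> 'v \<Rightarrow> 'v option"

definition pmap_rst :: "('o, 'a, 'v) pmap \<Rightarrow> ('o, 'a, 'v) pmap" where
  "pmap_rst \<phi> = \<lparr>psrc = psrc \<phi>, ptgt = psrc \<phi>,
     app = (\<lambda>A x. if app \<phi> A x = None then None else Some x)\<rparr>"

lemma pmap_rst_sel [simp]:
  "psrc (pmap_rst \<phi>) = psrc \<phi>" "ptgt (pmap_rst \<phi>) = psrc \<phi>"
  "app (pmap_rst \<phi>) A x = (if app \<phi> A x = None then None else Some x)"
  by (simp_all add: pmap_rst_def)

lemma pmap_eqI:
  fixes \<phi> \<psi> :: "('o, 'a, 'v) pmap"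
  assumes "psrc \<phi> = psrc \<psi>" "ptgt \<phi> = ptgt \<psi>"
    "\<And>A x y. app \<phi> A x = Some y \<longleftrightarrow> app \<psi> A x = Some y"
  shows "\<phi> = \<psi>"
proof -
  have "app \<phi> A x = app \<psi> A x" for A x
    using assms(3)[of A x] by (metis not_None_eq)
  then show ?thesis
    using assms(1,2) by (intro pmap.equality ext) simp_all
qed

section \<open>The restriction category of partial maps\<close>

context sheaf_site
begin

text \<open>The clause on restrictions is naturality on the domain together with its closure under
  restriction. The last clause makes the domain a subsheaf whose inclusion is an
  \<open>M\<close>-map.\<close>

definition is_pmap :: "('o, 'v, 'v) pmap \<Rightarrow> bool" where
  "is_pmap \<phi> \<longleftrightarrow> is_sheaf U C J (psrc \<phi>) \<and> is_sheaf U C J (ptgt \<phi>) \<and>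
     (\<forall>A x y. app \<phi> A x = Some y \<longrightarrow> x \<in> sec (psrc \<phi>) A \<and> y \<in> sec (ptgt \<phi>) A) \<and>
     (\<forall>f\<in>Arr C. \<forall>x y. app \<phi> (Cod C f) x = Some y \<longrightarrow>
        app \<phi> (Dom C f) (res (psrc \<phi>) f x) = Some (res (ptgt \<phi>) f y)) \<and>
     classified C M (psrc \<phi>) (\<lambda>A. dom (app \<phi> A))"

lemma is_pmapI:
  assumes "is_sheaf U C J (psrc \<phi>)" "is_sheaf U C J (ptgt \<phi>)"
    "\<And>A x y. app \<phi> A x = Some y \<Longrightarrow> x \<in> sec (psrc \<phi>) A \<and> y \<in> sec (ptgt \<phi>) A"
    "\<And>f x y. f \<in> Arr C \<Longrightarrow> app \<phi> (Cod C f) x = Some y \<Longrightarrow>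
        app \<phi> (Dom C f) (res (psrc \<phi>) f x) = Some (res (ptgt \<phi>) f y)"
    "classified C M (psrc \<phi>) (\<lambda>A. dom (app \<phi> A))"
  shows "is_pmap \<phi>"
  using assms unfolding is_pmap_def by blast

lemma is_pmapD:
  assumes "is_pmap \<phi>"
  shows "is_sheaf U C J (psrc \<phi>)" "is_sheaf U C J (ptgt \<phi>)"
    "app \<phi> A x = Some y \<Longrightarrow> x \<in> sec (psrc \<phi>) A" "app \<phi> A x = Some y \<Longrightarrow> y \<in> sec (ptgt \<phi>) A"
    "f \<in> Arr C \<Longrightarrow> app \<phi> (Cod C f) x = Some y \<Longrightarrow>
        app \<phi> (Dom C f) (res (psrc \<phi>) f x) = Some (res (ptgt \<phi>) f y)"
    "classified C M (psrc \<phi>) (\<lambda>A. dom (app \<phi> A))"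
  using assms unfolding is_pmap_def by blast+

definition PM :: "(('o, 'v, 'v) presheaf, ('o, 'v, 'v) pmap) cat" where
  "PM = \<lparr>Obj = {P. is_sheaf U C J P}, Arr = {\<phi>. is_pmap \<phi>}, Dom = psrc, Cod = ptgt,
     Ide = (\<lambda>P. \<lparr>psrc = P, ptgt = P, app = (\<lambda>A x. if x \<in> sec P A then Some x else None)\<rparr>),
     Comp = (\<lambda>\<psi> \<phi>. \<lparr>psrc = psrc \<phi>, ptgt = ptgt \<psi>, app = (\<lambda>A. app \<psi> A \<circ>\<^sub>m app \<phi> A)\<rparr>)\<rparr>"

lemma PM_sel [simp]:
  "Obj PM = {P. is_sheaf U C J P}" "Arr PM = {\<phi>. is_pmap \<phi>}" "Dom PM = psrc" "Cod PM = ptgt"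
  "psrc (Ide PM P) = P" "ptgt (Ide PM P) = P"
  "app (Ide PM P) A x = (if x \<in> sec P A then Some x else None)"
  "psrc (\<psi> \<cdot>\<^bsub>PM\<^esub> \<phi>) = psrc \<phi>" "ptgt (\<psi> \<cdot>\<^bsub>PM\<^esub> \<phi>) = ptgt \<psi>"
  "app (\<psi> \<cdot>\<^bsub>PM\<^esub> \<phi>) A x = (case app \<phi> A x of None \<Rightarrow> None | Some y \<Rightarrow> app \<psi> A y)"
  by (simp_all add: PM_def map_comp_def)

lemma PM_Hom_iff: "\<phi> \<in> Hom PM P Q \<longleftrightarrow> is_pmap \<phi> \<and> psrc \<phi> = P \<and> ptgt \<phi> = Q"
  by (simp add: in_Hom_iff)

lemma PM_comp_Some:
  "app (\<psi> \<cdot>\<^bsub>PM\<^esub> \<phi>) A x = Some z \<longleftrightarrow> (\<exists>y. app \<phi> A x = Some y \<and> app \<psi> A y = Some z)"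
  by (auto split: option.splits)

lemma PM_ide_Some: "app (Ide PM P) A x = Some z \<longleftrightarrow> x \<in> sec P A \<and> z = x"
  by auto

lemma pmap_rst_Some: "app (pmap_rst \<phi>) A x = Some z \<longleftrightarrow> (\<exists>y. app \<phi> A x = Some y) \<and> z = x"
  by auto

lemma PM_ide_pmap:
  assumes "is_sheaf U C J P"
  shows "is_pmap (Ide PM P)"
proof (rule is_pmapI)
  note P = sheaf_presheaf[OF assms]
  show "app (Ide PM P) (Dom C f) (res (psrc (Ide PM P)) f x) = Some (res (ptgt (Ide PM P)) f y)"
    if "f \<in> Arr C" "app (Ide PM P) (Cod C f) x = Some y" for f x y
    using that presheaf_res[OF P that(1), of x] unfolding PM_ide_Some by simp
  show "classified C M (psrc (Ide PM P)) (\<lambda>A. dom (app (Ide PM P) A))"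
    unfolding classified_def
  proof (intro ballI)
    fix D q assume D: "D \<in> Obj C" "q \<in> sec (psrc (Ide PM P)) D"
    have "res P f q \<in> dom (app (Ide PM P) (Dom C f)) \<longleftrightarrow> factors_through C f (Ide C D)"
      if "f \<in> Arr C" "Cod C f = D" for f
      using presheaf_res[OF P that(1), of q] that D factors_throughI[of f C f "Ide C D"] by (simp add: dom_def)
    then show "\<exists>m\<in>M. Cod C m = D \<and> (\<forall>f\<in>Arr C. Cod C f = D \<longrightarrow>
        (res (psrc (Ide PM P)) f q \<in> dom (app (Ide PM P) (Dom C f)) \<longleftrightarrow> factors_through C f m))"
      using D by (intro bexI[of _ "Ide C D"]) (simp_all add: Ide_M)
  qed
qed (use assms in \<open>simp_all split: if_splits\<close>)

lemma pmap_rst_pmap: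
  assumes "is_pmap \<phi>"
  shows "is_pmap (pmap_rst \<phi>)"
proof (rule is_pmapI)
  note D = is_pmapD[OF assms]
  show "is_sheaf U C J (psrc (pmap_rst \<phi>))" "is_sheaf U C J (ptgt (pmap_rst \<phi>))"
    using D by simp_all
  show "x \<in> sec (psrc (pmap_rst \<phi>)) A \<and> y \<in> sec (ptgt (pmap_rst \<phi>)) A" if "app (pmap_rst \<phi>) A x = Some y" for A x y
    using that D(3) unfolding pmap_rst_Some by auto
  show "app (pmap_rst \<phi>) (Dom C f) (res (psrc (pmap_rst \<phi>)) f x) = Some (res (ptgt (pmap_rst \<phi>)) f y)"
    if "f \<in> Arr C" "app (pmap_rst \<phi>) (Cod C f) x = Some y" for f x y
    using that D(5)[OF that(1)] unfolding pmap_rst_Some by auto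
  have "dom (app (pmap_rst \<phi>) A) = dom (app \<phi> A)" for A
    by (auto simp: dom_def)
  then show "classified C M (psrc (pmap_rst \<phi>)) (\<lambda>A. dom (app (pmap_rst \<phi>) A))"
    using D by simp
qed

text \<open>Let \<open>m\<close> classify \<open>q\<close> for the domain of \<open>\<phi>\<close>,
  let \<open>y\<close> be the value of \<open>\<phi>\<close> at \<open>q\<close> restricted along
  \<open>m\<close>, and let \<open>n\<close> classify \<open>y\<close> for the domain of
  \<open>\<psi>\<close>. The composite is then classified at \<open>q\<close> by
  \<open>m \<cdot> n\<close>.\<close>

lemma PM_comp_pmap:
  assumes \<phi>: "is_pmap \<phi>" and \<psi>: "is_pmap \<psi>" and t: "ptgt \<phi> = psrc \<psi>"
  shows "is_pmap (\<psi> \<cdot>\<^bsub>PM\<^esub> \<phi>)"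
proof (rule is_pmapI)
  note F = is_pmapD[OF \<phi>] and G = is_pmapD[OF \<psi>]
  show "is_sheaf U C J (psrc (\<psi> \<cdot>\<^bsub>PM\<^esub> \<phi>))" "is_sheaf U C J (ptgt (\<psi> \<cdot>\<^bsub>PM\<^esub> \<phi>))"
    using F G by simp_all
  show "x \<in> sec (psrc (\<psi> \<cdot>\<^bsub>PM\<^esub> \<phi>)) A \<and> z \<in> sec (ptgt (\<psi> \<cdot>\<^bsub>PM\<^esub> \<phi>)) A"
    if "app (\<psi> \<cdot>\<^bsub>PM\<^esub> \<phi>) A x = Some z" for A x z
    using that F(3) G(4) unfolding PM_comp_Some by auto
  show "app (\<psi> \<cdot>\<^bsub>PM\<^esub> \<phi>) (Dom C f) (res (psrc (\<psi> \<cdot>\<^bsub>PM\<^esub> \<phi>)) f x) = Some (res (ptgt (\<psi> \<cdot>\<^bsub>PM\<^esub> \<phi>)) f z)"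
    if f: "f \<in> Arr C" "app (\<psi> \<cdot>\<^bsub>PM\<^esub> \<phi>) (Cod C f) x = Some z" for f x z
  proof -
    obtain y where "app \<phi> (Cod C f) x = Some y" "app \<psi> (Cod C f) y = Some z"
      using f(2) unfolding PM_comp_Some by blast
    then show ?thesis
      using F(5)[OF f(1)] G(5)[OF f(1)] t by simp
  qed
  show "classified C M (psrc (\<psi> \<cdot>\<^bsub>PM\<^esub> \<phi>)) (\<lambda>A. dom (app (\<psi> \<cdot>\<^bsub>PM\<^esub> \<phi>) A))"
    unfolding classified_def
  proof (intro ballI)
    fix D q assume "D \<in> Obj C" "q \<in> sec (psrc (\<psi> \<cdot>\<^bsub>PM\<^esub> \<phi>)) D"
    then have D: "D \<in> Obj C" "q \<in> sec (psrc \<phi>) D"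
      by simp_all
    obtain m where m: "m \<in> M" "Cod C m = D" "\<And>f. f \<in> Arr C \<Longrightarrow> Cod C f = D \<Longrightarrow>
        res (psrc \<phi>) f q \<in> dom (app \<phi> (Dom C f)) \<longleftrightarrow> factors_through C f m"
      using classifiedE[OF F(6) D] by blast
    have mA: "m \<in> Arr C" "Dom C m \<in> Obj C"
      using m M_Arr Dom_Obj by blast+
    have "res (psrc \<phi>) m q \<in> dom (app \<phi> (Dom C m))"
      using m(3)[OF mA(1) m(2)] factors_through_refl[OF mA(1)] by simp
    then obtain y where y: "app \<phi> (Dom C m) (res (psrc \<phi>) m q) = Some y"
      by blast
    have yQ: "y \<in> sec (psrc \<psi>) (Dom C m)"
      using F(4)[OF y] t by simp
    obtain n where n: "n \<in> M" "Cod C n = Dom C m" "\<And>f. f \<in> Arr C \<Longrightarrow> Cod C f = Dom C m \<Longrightarrow>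
        res (psrc \<psi>) f y \<in> dom (app \<psi> (Dom C f)) \<longleftrightarrow> factors_through C f n"
      using classifiedE[OF G(6) mA(2) yQ] by blast
    have nA: "n \<in> Arr C"
      using n M_Arr by blast
    \<comment> \<open>Inside \<open>m\<close> the map \<open>\<phi>\<close> is defined and has the
      restrictions of \<open>y\<close> as its values, so definedness of the composite is definedness
      of \<open>\<psi>\<close> at these.\<close>
    have key: "res (psrc \<phi>) (m \<cdot> w) q \<in> dom (app (\<psi> \<cdot>\<^bsub>PM\<^esub> \<phi>) (Dom C w)) \<longleftrightarrow> factors_through C w n"
      if w: "w \<in> Arr C" "Cod C w = Dom C m" for w
    proof -
      have "app \<phi> (Dom C w) (res (psrc \<phi>) (m \<cdot> w) q) = Some (res (psrc \<psi>) w y)"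
        using F(5)[OF w(1), of "res (psrc \<phi>) m q" y] y w t m(2) D(2)
          presheaf_res_comp[OF sheaf_presheaf[OF F(1)] w(1) mA(1), of q] by simp
      then show ?thesis
        using n(3)[OF w] by (simp add: dom_def)
    qed
    have "res (psrc \<phi>) f q \<in> dom (app (\<psi> \<cdot>\<^bsub>PM\<^esub> \<phi>) (Dom C f)) \<longleftrightarrow> factors_through C f (m \<cdot> n)"
      if f: "f \<in> Arr C" "Cod C f = D" for f
    proof
      assume a: "res (psrc \<phi>) f q \<in> dom (app (\<psi> \<cdot>\<^bsub>PM\<^esub> \<phi>) (Dom C f))"
      then have "res (psrc \<phi>) f q \<in> dom (app \<phi> (Dom C f))"
        by (auto simp: dom_def split: option.splits)
      then have "factors_through C f m"
        using m(3)[OF f] by blast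
      then obtain w where w: "w \<in> Arr C" "Dom C f = Dom C w" "Cod C w = Dom C m" "f = m \<cdot> w"
        by (rule factors_throughE)
      then have "factors_through C w n"
        using key[OF w(1,3)] a by simp
      then obtain v where v: "v \<in> Arr C" "Dom C w = Dom C v" "Cod C v = Dom C n" "w = n \<cdot> v"
        by (rule factors_throughE)
      have "f = (m \<cdot> n) \<cdot> v"
        using w(4) v nA mA n(2) by (simp add: comp_assoc)
      then show "factors_through C f (m \<cdot> n)"
        using v w(2) nA mA n(2) by (intro factors_throughI[of v]) simp_all
    next
      assume "factors_through C f (m \<cdot> n)"
      then obtain v where v: "v \<in> Arr C" "Dom C f = Dom C v" "Cod C v = Dom C (m \<cdot> n)" "f = (m \<cdot> n) \<cdot> v"
        by (rule factors_throughE)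
      then have w: "n \<cdot> v \<in> Arr C" "Cod C (n \<cdot> v) = Dom C m" "f = m \<cdot> (n \<cdot> v)" "Dom C (n \<cdot> v) = Dom C f"
        using nA mA n(2) by (simp_all add: comp_assoc)
      have "factors_through C (n \<cdot> v) n"
        using v nA mA n(2) by (intro factors_throughI[of v]) simp_all
      then show "res (psrc \<phi>) f q \<in> dom (app (\<psi> \<cdot>\<^bsub>PM\<^esub> \<phi>) (Dom C f))"
        using key[OF w(1,2)] w(3,4) by simp
    qed
    then show "\<exists>m\<in>M. Cod C m = D \<and> (\<forall>f\<in>Arr C. Cod C f = D \<longrightarrow>
        (res (psrc (\<psi> \<cdot>\<^bsub>PM\<^esub> \<phi>)) f q \<in> dom (app (\<psi> \<cdot>\<^bsub>PM\<^esub> \<phi>) (Dom C f)) \<longleftrightarrow> factors_through C f m))"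
      using Comp_M[OF n(1) m(1) n(2)] nA mA m(2) n(2) by (intro bexI[of _ "m \<cdot> n"]) simp_all
  qed
qed

lemma small_PM_Hom:
  assumes "is_presheaf U C P" "is_presheaf U C Q"
  shows "small U (Hom PM P Q)"
proof -
  let ?X = "\<lambda>P :: ('o, 'v, 'v) presheaf. \<Union>A\<in>Obj C. sec P A"
  have "?X P \<in> U" "?X Q \<in> U"
    using assms presheaf_sec by (auto intro!: universe_UN[OF universe small_Objs])
  then have "small U (?X P)" "small U (?X Q)"
    by (auto intro: small_mem)
  from small_partial_families[OF universe small_Objs this] show ?thesis
  proof (rule small_inj_on)
    show "inj_on app (Hom PM P Q)"
    proof (rule inj_onI)
      fix \<phi> \<psi> assume "\<phi> \<in> Hom PM P Q" "\<psi> \<in> Hom PM P Q" "app \<phi> = app \<psi>"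
      then show "\<phi> = \<psi>"
        by (intro pmap_eqI) (simp_all add: PM_Hom_iff)
    qed
    show "app ` Hom PM P Q \<subseteq> {\<phi>. \<forall>i x y. \<phi> i x = Some y \<longrightarrow> i \<in> Obj C \<and> x \<in> ?X P \<and> y \<in> ?X Q}"
    proof clarify
      fix \<phi> i x y assume "\<phi> \<in> Hom PM P Q" "app \<phi> i x = Some y"
      then have "x \<in> sec P i" "y \<in> sec Q i"
        using is_pmapD(3,4) unfolding PM_Hom_iff by blast+
      then show "i \<in> Obj C \<and> x \<in> ?X P \<and> y \<in> ?X Q"
        using presheaf_sec_Obj[OF assms(1), of x i] by blast
    qed
  qed
qed

lemma PM_restriction: "restriction_category U PM pmap_rst"
proof
  fix f A assume "f \<in> Arr PM"
  then show "Dom PM f \<in> Obj PM" "Cod PM f \<in> Obj PM"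
    using is_pmapD(1,2) by simp_all
next
  fix A assume "A \<in> Obj PM"
  then show "Ide PM A \<in> Hom PM A A"
    using PM_ide_pmap by (simp add: PM_Hom_iff)
next
  fix f A B g D assume "f \<in> Hom PM A B" "g \<in> Hom PM B D"
  then show "g \<cdot>\<^bsub>PM\<^esub> f \<in> Hom PM A D"
    using PM_comp_pmap by (simp add: PM_Hom_iff)
next
  fix f A B assume f: "f \<in> Hom PM A B"
  then have D: "psrc f = A" "ptgt f = B" "\<And>A x y. app f A x = Some y \<Longrightarrow> x \<in> sec (psrc f) A \<and> y \<in> sec (ptgt f) A"
    using is_pmapD(3,4) unfolding PM_Hom_iff by blast+
  show "f \<cdot>\<^bsub>PM\<^esub> Ide PM A = f"
    by (rule pmap_eqI, simp_all only: PM_comp_Some PM_ide_Some) (use D in auto)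
  show "Ide PM B \<cdot>\<^bsub>PM\<^esub> f = f"
    by (rule pmap_eqI, simp_all only: PM_comp_Some PM_ide_Some) (use D in auto)
  show "pmap_rst f \<in> Hom PM A A"
    using f pmap_rst_pmap by (simp add: PM_Hom_iff)
  show "f \<cdot>\<^bsub>PM\<^esub> pmap_rst f = f"
    by (rule pmap_eqI, simp_all only: PM_comp_Some pmap_rst_Some) auto
next
  fix f A B g D h E assume "f \<in> Hom PM A B" "g \<in> Hom PM B D" "h \<in> Hom PM D E"
  show "(h \<cdot>\<^bsub>PM\<^esub> g) \<cdot>\<^bsub>PM\<^esub> f = h \<cdot>\<^bsub>PM\<^esub> (g \<cdot>\<^bsub>PM\<^esub> f)"
    by (rule pmap_eqI, simp_all only: PM_comp_Some) auto
next
  fix A B assume "A \<in> Obj PM" "B \<in> Obj PM"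
  then show "small U (Hom PM A B)"
    using sheaf_presheaf by (intro small_PM_Hom) auto
next
  fix f A B g D assume fg: "f \<in> Hom PM A B" "g \<in> Hom PM A D"
  show "pmap_rst g \<cdot>\<^bsub>PM\<^esub> pmap_rst f = pmap_rst f \<cdot>\<^bsub>PM\<^esub> pmap_rst g"
    by (rule pmap_eqI, simp_all only: PM_comp_Some pmap_rst_Some) (use fg in \<open>auto simp: PM_Hom_iff\<close>)
  show "pmap_rst (g \<cdot>\<^bsub>PM\<^esub> pmap_rst f) = pmap_rst g \<cdot>\<^bsub>PM\<^esub> pmap_rst f"
    by (rule pmap_eqI, simp_all only: PM_comp_Some pmap_rst_Some) (use fg in \<open>auto simp: PM_Hom_iff\<close>)
next
  fix f A B h D assume fh: "f \<in> Hom PM A B" "h \<in> Hom PM B D"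
  show "pmap_rst h \<cdot>\<^bsub>PM\<^esub> f = f \<cdot>\<^bsub>PM\<^esub> pmap_rst (h \<cdot>\<^bsub>PM\<^esub> f)"
    by (rule pmap_eqI, simp_all only: PM_comp_Some pmap_rst_Some) (use fh in \<open>auto simp: PM_Hom_iff\<close>)
qed

section \<open>The order on partial maps and its joins\<close>

lemma PM_le_iff:
  assumes "\<phi> \<in> Hom PM P Q" "\<psi> \<in> Hom PM P Q"
  shows "le (hom_poset PM pmap_rst P Q) \<phi> \<psi> \<longleftrightarrow>
    (\<forall>A x y. app \<phi> A x = Some y \<longrightarrow> app \<psi> A x = Some y)"
proof -
  have "le (hom_poset PM pmap_rst P Q) \<phi> \<psi> \<longleftrightarrow> \<phi> = \<psi> \<cdot>\<^bsub>PM\<^esub> pmap_rst \<phi>"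
    by (simp add: hom_poset_def)
  also have "\<dots> \<longleftrightarrow> (\<forall>A x y. app \<phi> A x = Some y \<longrightarrow> app \<psi> A x = Some y)"
  proof
    assume eq: "\<phi> = \<psi> \<cdot>\<^bsub>PM\<^esub> pmap_rst \<phi>"
    show "\<forall>A x y. app \<phi> A x = Some y \<longrightarrow> app \<psi> A x = Some y"
    proof (intro allI impI)
      fix A x y assume "app \<phi> A x = Some y"
      then have "app (\<psi> \<cdot>\<^bsub>PM\<^esub> pmap_rst \<phi>) A x = Some y"
        using eq by simp
      then show "app \<psi> A x = Some y"
        unfolding PM_comp_Some pmap_rst_Some by blast
    qed
  next
    assume *: "\<forall>A x y. app \<phi> A x = Some y \<longrightarrow> app \<psi> A x = Some y"
    show "\<phi> = \<psi> \<cdot>\<^bsub>PM\<^esub> pmap_rst \<phi>"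
    proof (rule pmap_eqI)
      show "app \<phi> A x = Some y \<longleftrightarrow> app (\<psi> \<cdot>\<^bsub>PM\<^esub> pmap_rst \<phi>) A x = Some y" for A x y
        unfolding PM_comp_Some pmap_rst_Some using * by (metis option.inject)
    qed (use assms in \<open>simp_all add: PM_Hom_iff\<close>)
  qed
  finally show ?thesis .
qed

text \<open>The arrows along which \<open>x\<close> restricts into the domain of some member of
  \<open>S\<close>. A join of a compatible \<open>S\<close> is defined at \<open>x\<close> exactly
  when this sieve covers.\<close>

definition def_sieve :: "('o, 'v, 'v) pmap set \<Rightarrow> ('o, 'v, 'v) presheaf \<Rightarrow> 'o \<Rightarrow> 'v \<Rightarrow> 'v set" where
  "def_sieve S P A x = {f \<in> Arr C. Cod C f = A \<and> (\<exists>s\<in>S. res P f x \<in> dom (app s (Dom C f)))}"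

lemma def_sieve_sieve:
  assumes S: "S \<subseteq> Hom PM P Q" and P: "is_presheaf U C P" and x: "x \<in> sec P A"
  shows "is_sieve C A (def_sieve S P A x)"
  unfolding is_sieve_def
proof (intro conjI ballI impI)
  fix f g assume "f \<in> def_sieve S P A x" and g: "g \<in> Arr C" "Cod C g = Dom C f"
  then obtain s y where f: "f \<in> Arr C" "Cod C f = A" and s: "s \<in> S" "app s (Dom C f) (res P f x) = Some y"
    unfolding def_sieve_def by blast
  then have "is_pmap s" "psrc s = P"
    using S by (auto simp: PM_Hom_iff)
  then have "app s (Dom C g) (res P g (res P f x)) = Some (res (ptgt s) g y)"
    using is_pmapD(5)[of s g "res P f x" y] s g by simp
  then have "app s (Dom C g) (res P (f \<cdot> g) x) = Some (res (ptgt s) g y)"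
    using presheaf_res_comp[OF P g(1) f(1)] g f x by simp
  then show "f \<cdot> g \<in> def_sieve S P A x"
    using s(1) f g unfolding def_sieve_def by (auto intro!: bexI[of _ s])
qed (auto simp: def_sieve_def)

text \<open>Leastness follows from the covering condition. An upper bound \<open>k\<close> is
  defined along a covering sieve of \<open>x\<close>, hence at \<open>x\<close>, since its domain is
  local; its value agrees with that of \<open>j\<close> along the sieve, hence outright, since
  \<open>Q\<close> is separated.\<close>

lemma PM_joinI:
  assumes S: "S \<subseteq> Hom PM P Q" and j: "j \<in> Hom PM P Q"
    and up: "\<And>s A x y. s \<in> S \<Longrightarrow> app s A x = Some y \<Longrightarrow> app j A x = Some y"
    and cov: "\<And>A x y. app j A x = Some y \<Longrightarrow> def_sieve S P A x \<in> J A"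
  shows "is_join (hom_poset PM pmap_rst P Q) S j"
proof (rule is_joinI)
  let ?L = "hom_poset PM pmap_rst P Q"
  show "j \<in> carrier ?L" "S \<subseteq> carrier ?L"
    using j S by (simp_all add: hom_poset_def)
  show "le ?L s j" if "s \<in> S" for s
    using PM_le_iff[OF _ j, of s] up[OF that] that S by blast
  fix k assume k: "k \<in> carrier ?L" "\<And>s. s \<in> S \<Longrightarrow> le ?L s k"
  then have kH: "k \<in> Hom PM P Q"
    by (simp add: hom_poset_def)
  have up': "app k A x = Some y" if "s \<in> S" "app s A x = Some y" for s A x y
    using PM_le_iff[OF _ kH, of s] k(2)[OF that(1)] that S by blast
  have jP: "is_pmap j" "psrc j = P" "ptgt j = Q" and kP: "is_pmap k" "psrc k = P" "ptgt k = Q"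
    using j kH by (simp_all add: PM_Hom_iff)
  note J = is_pmapD[OF jP(1), unfolded jP] and K = is_pmapD[OF kP(1), unfolded kP]
  have "app k A x = Some y" if xy: "app j A x = Some y" for A x y
  proof -
    have x: "x \<in> sec P A" and y: "y \<in> sec Q A"
      using J(3,4)[OF xy] by blast+
    have A: "A \<in> Obj C"
      using presheaf_sec_Obj[OF sheaf_presheaf[OF J(1)] x] .
    have kf: "app k (Dom C f) (res P f x) = Some (res Q f y)" if f: "f \<in> def_sieve S P A x" for f
    proof -
      obtain s z where s: "f \<in> Arr C" "Cod C f = A" "s \<in> S" "app s (Dom C f) (res P f x) = Some z"
        using f unfolding def_sieve_def by blast
      have "app j (Dom C f) (res P f x) = Some (res Q f y)"
        using J(5)[OF s(1)] xy s(2) by simp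
      then show ?thesis
        using up[OF s(3,4)] up'[OF s(3,4)] by simp
    qed
    have "x \<in> dom (app k A)"
      by (rule classified_local[OF K(1) K(6) A cov[OF xy] x]) (use kf in blast)
    then obtain y' where y': "app k A x = Some y'"
      by blast
    have "y' = y"
    proof (rule cover_sep[OF J(2) A cov[OF xy] _ y])
      show "y' \<in> sec Q A"
        using K(4)[OF y'] .
      fix f assume f: "f \<in> def_sieve S P A x"
      then have "f \<in> Arr C" "Cod C f = A"
        by (simp_all add: def_sieve_def)
      then have "app k (Dom C f) (res P f x) = Some (res Q f y')"
        using K(5) y' by simp
      then show "res Q f y' = res Q f y"
        using kf[OF f] by simp
    qed
    then show ?thesis
      using y' by simp
  qed
  then show "le ?L j k"
    using PM_le_iff[OF j kH] by blast
qed

lemma PM_compatible_Some: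
  assumes "compatible_set PM pmap_rst S" "s \<in> S" "s' \<in> S" "app s A x = Some y" "app s' A x = Some z"
  shows "y = z"
proof -
  have "s \<cdot>\<^bsub>PM\<^esub> pmap_rst s' = s' \<cdot>\<^bsub>PM\<^esub> pmap_rst s"
    using assms(1-3) unfolding compatible_set_def by blast
  moreover have "app (s \<cdot>\<^bsub>PM\<^esub> pmap_rst s') A x = Some y" "app (s' \<cdot>\<^bsub>PM\<^esub> pmap_rst s) A x = Some z"
    unfolding PM_comp_Some pmap_rst_Some using assms(4,5) by blast+
  ultimately show ?thesis
    by simp
qed

text \<open>Besides a join, this delivers the two properties by which \<open>PM_joinI\<close>
  recognizes one; \<open>PM_joinD\<close> passes them on to every join.\<close>

lemma PM_join_exists:
  assumes P: "is_sheaf U C J P" and Q: "is_sheaf U C J Q"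
    and S: "S \<subseteq> Hom PM P Q" and comp: "compatible_set PM pmap_rst S"
  obtains j where "j \<in> Hom PM P Q"
    "\<And>s A x y. s \<in> S \<Longrightarrow> app s A x = Some y \<Longrightarrow> app j A x = Some y"
    "\<And>A x y. app j A x = Some y \<Longrightarrow> def_sieve S P A x \<in> J A"
proof -
  note P' = sheaf_presheaf[OF P] and Q' = sheaf_presheaf[OF Q]
  have sS: "is_pmap s" "psrc s = P" "ptgt s = Q" if "s \<in> S" for s
    using that S by (auto simp: PM_Hom_iff)
  have s3: "x \<in> sec P A" "y \<in> sec Q A" if "s \<in> S" "app s A x = Some y" for s A x y
    using is_pmapD(3,4)[OF sS(1)[OF that(1)] that(2)] sS[OF that(1)] by simp_all
  have s5: "app s (Dom C f) (res P f x) = Some (res Q f y)"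
    if "s \<in> S" "f \<in> Arr C" "app s (Cod C f) x = Some y" for s f x y
    using is_pmapD(5)[OF sS(1)[OF that(1)] that(2,3)] sS[OF that(1)] by simp
  \<comment> \<open>The predicate says that \<open>y\<close> amalgamates the values that members of
    \<open>S\<close> take at restrictions of \<open>x\<close>; no choice of a member of
    \<open>S\<close> enters it.\<close>
  define V where "V A x y \<longleftrightarrow> y \<in> sec Q A \<and>
    (\<forall>f\<in>def_sieve S P A x. \<forall>s\<in>S. \<forall>z. app s (Dom C f) (res P f x) = Some z \<longrightarrow> res Q f y = z)" for A x y
  have V_ex: "\<exists>!y. V A x y" if x: "x \<in> sec P A" and c: "def_sieve S P A x \<in> J A" for A x
  proof -
    have A: "A \<in> Obj C"
      using presheaf_sec_Obj[OF P' x] .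
    \<comment> \<open>By compatibility the value does not depend on the member of \<open>S\<close>,
      so the values form a matching family.\<close>
    define g where "g f = (THE z. \<exists>s\<in>S. app s (Dom C f) (res P f x) = Some z)" for f
    have g: "g f = z" if "s \<in> S" "app s (Dom C f) (res P f x) = Some z" for f s z
      unfolding g_def using that PM_compatible_Some[OF comp] by (intro the_equality) blast+
    have "is_matching C Q (def_sieve S P A x) g"
      unfolding is_matching_def
    proof (intro conjI ballI impI)
      fix f assume "f \<in> def_sieve S P A x"
      then obtain s z where s: "f \<in> Arr C" "Cod C f = A" "s \<in> S" "app s (Dom C f) (res P f x) = Some z"
        unfolding def_sieve_def by blast
      show "g f \<in> sec Q (Dom C f)"
        using g[OF s(3,4)] s3[OF s(3,4)] by simp
      fix h assume h: "h \<in> Arr C" "Cod C h = Dom C f"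
      have "app s (Dom C h) (res P h (res P f x)) = Some (res Q h z)"
        using s5[OF s(3) h(1)] s(4) h(2) by simp
      then have "app s (Dom C (f \<cdot> h)) (res P (f \<cdot> h) x) = Some (res Q h z)"
        using presheaf_res_comp[OF P' h(1) s(1)] h(2) s(1,2) x h(1) by simp
      then show "res Q h (g f) = g (f \<cdot> h)"
        using g[OF s(3), of "f \<cdot> h" "res Q h z"] g[OF s(3,4)] by simp
    qed
    then have ex: "\<exists>!t. t \<in> sec Q A \<and> (\<forall>f\<in>def_sieve S P A x. res Q f t = g f)"
      using Q A c unfolding is_sheaf_def by blast
    have "(\<forall>f\<in>def_sieve S P A x. res Q f t = g f) \<longleftrightarrow>
        (\<forall>f\<in>def_sieve S P A x. \<forall>s\<in>S. \<forall>z. app s (Dom C f) (res P f x) = Some z \<longrightarrow> res Q f t = z)" for t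
    proof (intro ball_cong refl)
      fix f assume "f \<in> def_sieve S P A x"
      then obtain s z where "s \<in> S" "app s (Dom C f) (res P f x) = Some z"
        unfolding def_sieve_def by blast
      then show "res Q f t = g f \<longleftrightarrow> (\<forall>s\<in>S. \<forall>z. app s (Dom C f) (res P f x) = Some z \<longrightarrow> res Q f t = z)"
        using g by metis
    qed
    then show ?thesis
      using ex unfolding V_def by simp
  qed
  define j where "j = \<lparr>psrc = P, ptgt = Q,
    app = (\<lambda>A x. if x \<in> sec P A \<and> def_sieve S P A x \<in> J A then Some (THE y. V A x y) else None)\<rparr>"
  have j_Some: "app j A x = Some y \<longleftrightarrow> x \<in> sec P A \<and> def_sieve S P A x \<in> J A \<and> V A x y" for A x y
  proof (cases "x \<in> sec P A \<and> def_sieve S P A x \<in> J A")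
    case True
    then have "\<exists>!y. V A x y"
      using V_ex by blast
    then have "(THE y. V A x y) = y \<longleftrightarrow> V A x y"
      by (metis theI')
    then show ?thesis
      using True by (simp add: j_def)
  qed (auto simp: j_def)
  have j_dom: "x \<in> dom (app j A) \<longleftrightarrow> x \<in> sec P A \<and> def_sieve S P A x \<in> J A" for A x
    by (simp add: j_def dom_def)
  \<comment> \<open>The sieve of \<open>x\<close> pulled back along \<open>f\<close> is the sieve of
    the restriction of \<open>x\<close>; stability of covers therefore closes the new domain under
    restriction.\<close>
  have W_res: "{g \<in> Arr C. Cod C g = Dom C f \<and> f \<cdot> g \<in> def_sieve S P (Cod C f) x} = def_sieve S P (Dom C f) (res P f x)"
    if f: "f \<in> Arr C" and x: "x \<in> sec P (Cod C f)" for f x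
  proof -
    have "res P (f \<cdot> g) x = res P g (res P f x)" if "g \<in> Arr C" "Cod C g = Dom C f" for g
      using presheaf_res_comp[OF P' that(1) f that(2) x] .
    then show ?thesis
      using f unfolding def_sieve_def by (auto cong: conj_cong)
  qed
  have "is_pmap j"
  proof (rule is_pmapI)
    show "is_sheaf U C J (psrc j)" "is_sheaf U C J (ptgt j)"
      using P Q by (simp_all add: j_def)
    show "x \<in> sec (psrc j) A \<and> y \<in> sec (ptgt j) A" if "app j A x = Some y" for A x y
      using that unfolding j_Some V_def by (simp add: j_def)
    fix f x y assume f: "f \<in> Arr C" and xy: "app j (Cod C f) x = Some y"
    then have x: "x \<in> sec P (Cod C f)" and c: "def_sieve S P (Cod C f) x \<in> J (Cod C f)" and V: "V (Cod C f) x y"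
      unfolding j_Some by blast+
    have y: "y \<in> sec Q (Cod C f)"
      using V unfolding V_def by blast
    have "V (Dom C f) (res P f x) (res Q f y)"
      unfolding V_def
    proof (intro conjI ballI allI impI)
      show "res Q f y \<in> sec Q (Dom C f)"
        using presheaf_res[OF Q' f y] .
      fix g s z assume g: "g \<in> def_sieve S P (Dom C f) (res P f x)" and s: "s \<in> S" "app s (Dom C g) (res P g (res P f x)) = Some z"
      then have g': "g \<in> Arr C" "Cod C g = Dom C f" "f \<cdot> g \<in> def_sieve S P (Cod C f) x"
        unfolding W_res[OF f x, symmetric] by blast+
      have "app s (Dom C (f \<cdot> g)) (res P (f \<cdot> g) x) = Some z"
        using s(2) presheaf_res_comp[OF P' g'(1) f g'(2) x] g' f by simp
      then have "res Q (f \<cdot> g) y = z"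
        using V g'(3) s(1) unfolding V_def by blast
      then show "res Q g (res Q f y) = z"
        using presheaf_res_comp[OF Q' g'(1) f g'(2) y] by simp
    qed
    moreover have "def_sieve S P (Dom C f) (res P f x) \<in> J (Dom C f)"
      using cover_pullback[OF c _ f] W_res[OF f x] Cod_Obj[OF f] by simp
    ultimately have "app j (Dom C f) (res P f x) = Some (res Q f y)"
      using presheaf_res[OF P' f x] unfolding j_Some by blast
    then show "app j (Dom C f) (res (psrc j) f x) = Some (res (ptgt j) f y)"
      by (simp add: j_def)
  next
    show "classified C M (psrc j) (\<lambda>A. dom (app j A))"
      unfolding classified_def
    proof (intro ballI)
      fix D q assume D: "D \<in> Obj C" and "q \<in> sec (psrc j) D"
      then have q: "q \<in> sec P D"
        by (simp add: j_def)
      \<comment> \<open>Each \<open>s\<close> in \<open>S\<close> has its classifying subobject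
        \<open>m s\<close> for \<open>q\<close>. For this family the sieve in \<open>M_join\<close>
        is \<open>def_sieve\<close> at the restriction of \<open>q\<close>, so the join of the
        \<open>m s\<close> classifies \<open>q\<close> for the new domain.\<close>
      have "\<exists>m. m \<in> M \<and> Cod C m = D \<and> (\<forall>f\<in>Arr C. Cod C f = D \<longrightarrow>
          (res P f q \<in> dom (app s (Dom C f)) \<longleftrightarrow> factors_through C f m))" if "s \<in> S" for s
        using is_pmapD(6)[OF sS(1)[OF that]] D q unfolding sS(2)[OF that] classified_def by blast
      then obtain m where m: "\<And>s. s \<in> S \<Longrightarrow> m s \<in> M" "\<And>s. s \<in> S \<Longrightarrow> Cod C (m s) = D"
        "\<And>s f. s \<in> S \<Longrightarrow> f \<in> Arr C \<Longrightarrow> Cod C f = D \<Longrightarrow>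
          res P f q \<in> dom (app s (Dom C f)) \<longleftrightarrow> factors_through C f (m s)"
        by metis
      have R: "m ` S \<subseteq> {n \<in> M. Cod C n = D}"
        using m(1,2) by blast
      obtain n where n: "n \<in> M" "Cod C n = D"
        "\<And>f. f \<in> Arr C \<Longrightarrow> Cod C f = D \<Longrightarrow> factors_through C f n \<longleftrightarrow>
          {g \<in> Arr C. Cod C g = Dom C f \<and> (\<exists>r\<in>m ` S. factors_through C (f \<cdot> g) r)} \<in> J (Dom C f)"
        using M_join[OF R D] by blast
      have "res (psrc j) f q \<in> dom (app j (Dom C f)) \<longleftrightarrow> factors_through C f n"
        if f: "f \<in> Arr C" "Cod C f = D" for f
      proof -
        have qf: "res P f q \<in> sec P (Dom C f)"
          using presheaf_res[OF P' f(1)] q f(2) by simp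
        have "res P g (res P f q) \<in> dom (app s (Dom C g)) \<longleftrightarrow> factors_through C (f \<cdot> g) (m s)"
          if "g \<in> Arr C" "Cod C g = Dom C f" "s \<in> S" for g s
          using m(3)[OF that(3), of "f \<cdot> g"] presheaf_res_comp[OF P' that(1) f(1) that(2), of q] q f that(1,2) by simp
        then have "def_sieve S P (Dom C f) (res P f q) =
            {g \<in> Arr C. Cod C g = Dom C f \<and> (\<exists>r\<in>m ` S. factors_through C (f \<cdot> g) r)}"
          unfolding def_sieve_def by auto
        then have "res P f q \<in> dom (app j (Dom C f)) \<longleftrightarrow> factors_through C f n"
          unfolding j_dom n(3)[OF f] using qf by simp
        then show ?thesis
          by (simp add: j_def)
      qed
      then show "\<exists>m\<in>M. Cod C m = D \<and> (\<forall>f\<in>Arr C. Cod C f = D \<longrightarrow>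
          (res (psrc j) f q \<in> dom (app j (Dom C f)) \<longleftrightarrow> factors_through C f m))"
        using n(1,2) by blast
    qed
  qed
  then have "j \<in> Hom PM P Q"
    by (simp add: PM_Hom_iff j_def)
  moreover have "app j A x = Some y" if s: "s \<in> S" and xy: "app s A x = Some y" for s A x y
    unfolding j_Some
  proof (intro conjI)
    show x: "x \<in> sec P A"
      using s3[OF s xy] by blast
    have A: "A \<in> Obj C"
      using presheaf_sec_Obj[OF P' x] .
    have "res P f x \<in> dom (app s (Dom C f))" if "f \<in> Arr C" "Cod C f = A" for f
      using s5[OF s that(1), of x y] that(2) xy by (simp add: dom_def)
    then have "def_sieve S P A x = {f \<in> Arr C. Cod C f = A}"
      using s unfolding def_sieve_def by blast
    then show "def_sieve S P A x \<in> J A"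
      using cover_maximal[OF A] by simp
    show "V A x y"
      unfolding V_def
    proof (intro conjI ballI allI impI)
      show "y \<in> sec Q A"
        using s3[OF s xy] by blast
      fix f s' z assume f: "f \<in> def_sieve S P A x" and s': "s' \<in> S" "app s' (Dom C f) (res P f x) = Some z"
      have "app s (Dom C f) (res P f x) = Some (res Q f y)"
        using s5[OF s, of f x y] xy f by (simp add: def_sieve_def)
      then show "res Q f y = z"
        using PM_compatible_Some[OF comp s s'(1) _ s'(2)] by blast
    qed
  qed
  moreover have "def_sieve S P A x \<in> J A" if "app j A x = Some y" for A x y
    using that unfolding j_Some by blast
  ultimately show thesis
    using that by blast
qed

text \<open>(J1) and (J2) speak of an arbitrary join. It lies below the constructed one, so wherever
  it is defined the covering condition holds.\<close>

lemma PM_joinD: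
  assumes P: "is_sheaf U C J P" and Q: "is_sheaf U C J Q"
    and S: "S \<subseteq> Hom PM P Q" and comp: "compatible_set PM pmap_rst S"
    and j: "is_join (hom_poset PM pmap_rst P Q) S j"
  shows "j \<in> Hom PM P Q"
    "s \<in> S \<Longrightarrow> app s A x = Some y \<Longrightarrow> app j A x = Some y"
    "app j A x = Some y \<Longrightarrow> def_sieve S P A x \<in> J A"
proof -
  let ?L = "hom_poset PM pmap_rst P Q"
  obtain k where k: "k \<in> Hom PM P Q"
    "\<And>s A x y. s \<in> S \<Longrightarrow> app s A x = Some y \<Longrightarrow> app k A x = Some y"
    "\<And>A x y. app k A x = Some y \<Longrightarrow> def_sieve S P A x \<in> J A"
    using PM_join_exists[OF P Q S comp] by blast
  have sub: "S \<subseteq> carrier ?L"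
    using S by (simp add: hom_poset_def)
  have k': "is_join ?L S k"
    using PM_joinI[OF S k] .
  note D = is_joinD[OF j sub] and K = is_joinD[OF k' sub]
  show jH: "j \<in> Hom PM P Q"
    using D(1) by (simp add: hom_poset_def)
  have "le ?L j k"
    by (rule D(3)[OF K(1) K(2)])
  then have jk: "app k A x = Some y" if "app j A x = Some y" for A x y
    using PM_le_iff[OF jH k(1)] that by blast
  show "app j A x = Some y" if "s \<in> S" "app s A x = Some y"
    using PM_le_iff[OF _ jH, of s] D(2)[OF that(1)] that S by blast
  show "def_sieve S P A x \<in> J A" if "app j A x = Some y"
    using k(3)[OF jk[OF that]] .
qed

lemma PM_join_restriction: "join_restriction_category U PM pmap_rst"
proof -
  interpret PM: restriction_category U PM pmap_rst by (rule PM_restriction)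
  show ?thesis
  proof
    fix P Q S assume "P \<in> Obj PM" "Q \<in> Obj PM" and S: "S \<subseteq> Hom PM P Q" and comp: "compatible_set PM pmap_rst S"
    then have P: "is_sheaf U C J P" and Q: "is_sheaf U C J Q"
      by simp_all
    note P' = sheaf_presheaf[OF P]
    obtain j where "j \<in> Hom PM P Q"
      "\<And>s A x y. s \<in> S \<Longrightarrow> app s A x = Some y \<Longrightarrow> app j A x = Some y"
      "\<And>A x y. app j A x = Some y \<Longrightarrow> def_sieve S P A x \<in> J A"
      using PM_join_exists[OF P Q S comp] by blast
    then show "\<exists>j. is_join (hom_poset PM pmap_rst P Q) S j"
      using PM_joinI[OF S] by blast
    fix j assume j: "is_join (hom_poset PM pmap_rst P Q) S j"
    note D = PM_joinD[OF P Q S comp j]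
    show "is_join (hom_poset PM pmap_rst P P) (pmap_rst ` S) (pmap_rst j)"
    proof (rule PM_joinI)
      show "pmap_rst ` S \<subseteq> Hom PM P P"
        using S PM.rst_Hom by blast
      show "pmap_rst j \<in> Hom PM P P"
        using PM.rst_Hom[OF D(1)] .
      show "app (pmap_rst j) A x = Some y" if st: "s \<in> pmap_rst ` S" "app s A x = Some y" for s A x y
      proof -
        obtain t where t: "t \<in> S" "s = pmap_rst t"
          using st(1) by blast
        obtain z where "app t A x = Some z" "y = x"
          using st(2) unfolding t(2) pmap_rst_Some by blast
        then show ?thesis
          unfolding pmap_rst_Some using D(2)[OF t(1)] by blast
      qed
      show "def_sieve (pmap_rst ` S) P A x \<in> J A" if xy: "app (pmap_rst j) A x = Some y" for A x y
      proof -
        have dom_rst: "dom (app (pmap_rst s) A) = dom (app s A)" for s :: "('o, 'v, 'v) pmap" and A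
          by (auto simp: dom_def)
        \<comment> \<open>Restriction does not change domains, so the two covering conditions
          coincide.\<close>
        have "def_sieve (pmap_rst ` S) P A x = def_sieve S P A x"
          by (simp add: def_sieve_def dom_rst)
        moreover obtain z where "app j A x = Some z"
          using xy unfolding pmap_rst_Some by blast
        ultimately show ?thesis
          using D(3) by simp
      qed
    qed
    fix g P0 assume g: "g \<in> Hom PM P0 P"
    then have gP: "is_pmap g" "psrc g = P0" "ptgt g = P"
      by (simp_all add: PM_Hom_iff)
    note G = is_pmapD[OF gP(1), unfolded gP]
    show "is_join (hom_poset PM pmap_rst P0 Q) ((\<lambda>s. s \<cdot>\<^bsub>PM\<^esub> g) ` S) (j \<cdot>\<^bsub>PM\<^esub> g)"
    proof (rule PM_joinI)
      show S': "(\<lambda>s. s \<cdot>\<^bsub>PM\<^esub> g) ` S \<subseteq> Hom PM P0 Q"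
        using S PM.Comp_Hom[OF g] by blast
      show "j \<cdot>\<^bsub>PM\<^esub> g \<in> Hom PM P0 Q"
        using PM.Comp_Hom[OF g D(1)] .
      show "app (j \<cdot>\<^bsub>PM\<^esub> g) A x = Some y" if st: "s \<in> (\<lambda>s. s \<cdot>\<^bsub>PM\<^esub> g) ` S" "app s A x = Some y" for s A x y
      proof -
        obtain t where t: "t \<in> S" "s = t \<cdot>\<^bsub>PM\<^esub> g"
          using st(1) by blast
        show ?thesis
          using st(2) D(2)[OF t(1)] unfolding t(2) PM_comp_Some by blast
      qed
      show "def_sieve ((\<lambda>s. s \<cdot>\<^bsub>PM\<^esub> g) ` S) P0 A x \<in> J A" if xy: "app (j \<cdot>\<^bsub>PM\<^esub> g) A x = Some y" for A x y
      proof -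
        obtain u where u: "app g A x = Some u" "app j A u = Some y"
          using xy unfolding PM_comp_Some by blast
        \<comment> \<open>By naturality of \<open>g\<close>, the restriction of \<open>u\<close>
          along \<open>f\<close> is the value of \<open>g\<close> at the restriction of
          \<open>x\<close>. A member of \<open>S\<close> defined there gives a composite with
          \<open>g\<close> defined at the restriction of \<open>x\<close>.\<close>
        have "def_sieve S P A u \<subseteq> def_sieve ((\<lambda>s. s \<cdot>\<^bsub>PM\<^esub> g) ` S) P0 A x"
        proof
          fix f assume "f \<in> def_sieve S P A u"
          then obtain s z where f: "f \<in> Arr C" "Cod C f = A" and s: "s \<in> S" "app s (Dom C f) (res P f u) = Some z"
            unfolding def_sieve_def by blast
          have "app g (Dom C f) (res P0 f x) = Some (res P f u)"
            using G(5)[OF f(1)] u(1) f(2) by simp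
          then have "app (s \<cdot>\<^bsub>PM\<^esub> g) (Dom C f) (res P0 f x) = Some z"
            unfolding PM_comp_Some using s(2) by blast
          then show "f \<in> def_sieve ((\<lambda>s. s \<cdot>\<^bsub>PM\<^esub> g) ` S) P0 A x"
            unfolding def_sieve_def using f s(1) by blast
        qed
        then show ?thesis
          using cover_mono[OF D(3)[OF u(2)]] def_sieve_sieve[OF S' sheaf_presheaf[OF G(1)] G(3)[OF u(1)]] by blast
      qed
    qed
  qed
qed

end


section \<open>Classes of spans of sheaves as partial maps\<close>

context sheaf_site
begin

definition pmap_of :: "('o, 'v, 'v) nat_trans \<Rightarrow> ('o, 'v, 'v) nat_trans \<Rightarrow> ('o, 'v, 'v) pmap" where
  "pmap_of \<mu> f = \<lparr>psrc = tgt \<mu>, ptgt = tgt f,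
     app = (\<lambda>A x. if x \<in> image_of \<mu> A
       then Some (cmp f A (SOME y. y \<in> sec (src \<mu>) A \<and> cmp \<mu> A y = x)) else None)\<rparr>"

lemma pmap_of_sel [simp]: "psrc (pmap_of \<mu> f) = tgt \<mu>" "ptgt (pmap_of \<mu> f) = tgt f"
  by (simp_all add: pmap_of_def)

lemma pmap_of_dom: "dom (app (pmap_of \<mu> f) A) = image_of \<mu> A"
  by (auto simp: pmap_of_def dom_def)

lemma pmap_of_Some:
  assumes \<mu>: "\<mu> \<in> M_Sh U C M"
  shows "app (pmap_of \<mu> f) A x = Some z \<longleftrightarrow> (\<exists>y\<in>sec (src \<mu>) A. cmp \<mu> A y = x \<and> cmp f A y = z)"
proof (cases "x \<in> image_of \<mu> A")
  case True
  then obtain y where y: "y \<in> sec (src \<mu>) A" "cmp \<mu> A y = x"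
    unfolding image_of_def by blast
  have un: "y' = y" if "y' \<in> sec (src \<mu>) A" "cmp \<mu> A y' = x" for y'
    using M_Sh_imp(2)[OF \<mu> that(1) y(1)] that(2) y(2) by simp
  then have "(SOME y. y \<in> sec (src \<mu>) A \<and> cmp \<mu> A y = x) = y"
    using y by (intro some_equality) blast+
  then have "app (pmap_of \<mu> f) A x = Some z \<longleftrightarrow> cmp f A y = z"
    using True by (simp add: pmap_of_def)
  then show ?thesis
    using y un by metis
next
  case False
  then show ?thesis
    by (auto simp: pmap_of_def image_of_def)
qed

lemma pmap_of_pmap:
  assumes \<mu>: "\<mu> \<in> M_Sh U C M" and f: "f \<in> Arr SH" "src f = src \<mu>"
  shows "is_pmap (pmap_of \<mu> f)"
proof (rule is_pmapI)
  note M = M_Sh_imp[OF \<mu>]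
  have N: "is_nat_trans U C \<mu>" "is_nat_trans U C f"
    using M f by simp_all
  show "is_sheaf U C J (psrc (pmap_of \<mu> f))" "is_sheaf U C J (ptgt (pmap_of \<mu> f))"
    using M f by simp_all
  show "x \<in> sec (psrc (pmap_of \<mu> f)) A \<and> z \<in> sec (ptgt (pmap_of \<mu> f)) A"
    if "app (pmap_of \<mu> f) A x = Some z" for A x z
    using that nat_cmp[OF N(1)] nat_cmp[OF N(2)] f(2) unfolding pmap_of_Some[OF \<mu>] by auto
  show "app (pmap_of \<mu> f) (Dom C g) (res (psrc (pmap_of \<mu> f)) g x) = Some (res (ptgt (pmap_of \<mu> f)) g z)"
    if g: "g \<in> Arr C" "app (pmap_of \<mu> f) (Cod C g) x = Some z" for g x z
  proof -
    obtain y where y: "y \<in> sec (src \<mu>) (Cod C g)" "cmp \<mu> (Cod C g) y = x" "cmp f (Cod C g) y = z"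
      using g(2) unfolding pmap_of_Some[OF \<mu>] by blast
    have "cmp \<mu> (Dom C g) (res (src \<mu>) g y) = res (tgt \<mu>) g x"
      "cmp f (Dom C g) (res (src \<mu>) g y) = res (tgt f) g z"
      using nat_res[OF N(1) g(1) y(1)] nat_res[OF N(2) g(1), of y] y f(2) by simp_all
    then show ?thesis
      unfolding pmap_of_Some[OF \<mu>] using presheaf_res[OF nat_src[OF N(1)] g(1) y(1)] by auto
  qed
  show "classified C M (psrc (pmap_of \<mu> f)) (\<lambda>A. dom (app (pmap_of \<mu> f) A))"
    unfolding pmap_of_dom using M(3) by simp
qed

text \<open>An isomorphism is bijective on sections, so both spans relate the same arguments to the
  same values.\<close>

lemma pmap_of_iso:
  assumes \<mu>: "\<mu> \<in> M_Sh U C M" and f: "f \<in> Arr SH" "src f = src \<mu>"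
    and i: "is_iso SH i" "tgt i = src \<mu>"
  shows "pmap_of (\<mu> \<cdot>\<^bsub>SH\<^esub> i) (f \<cdot>\<^bsub>SH\<^esub> i) = pmap_of \<mu> f"
proof (rule pmap_eqI)
  have iM: "i \<in> M_Sh U C M"
    by (rule Sh_iso_M[OF i(1)])
  have \<mu>i: "\<mu> \<cdot>\<^bsub>SH\<^esub> i \<in> M_Sh U C M"
    using Sh_comp_M[OF iM \<mu>] i(2) by simp
  obtain j where "i \<in> Arr SH" "j \<in> Arr SH" "Dom SH j = Cod SH i" "Cod SH j = Dom SH i"
    "j \<cdot>\<^bsub>SH\<^esub> i = Ide SH (Dom SH i)" "i \<cdot>\<^bsub>SH\<^esub> j = Ide SH (Cod SH i)"
    using i(1) by (rule SH.isoE)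
  then have ij: "is_nat_trans U C i" "is_nat_trans U C j" "src j = tgt i" "tgt j = src i"
    "i \<cdot>\<^bsub>PSh U C\<^esub> j = Ide (PSh U C) (tgt i)"
    by simp_all
  have surj: "\<exists>y'\<in>sec (src i) A. cmp i A y' = y" if y: "y \<in> sec (src \<mu>) A" for A y
  proof
    have "cmp (i \<cdot>\<^bsub>PSh U C\<^esub> j) A y = y"
      unfolding ij(5) using y i(2) by simp
    then show "cmp i A (cmp j A y) = y"
      using y ij(3) i(2) by simp
    show "cmp j A y \<in> sec (src i) A"
      using nat_cmp[OF ij(2), of y A] ij(3,4) i(2) y by simp
  qed
  show "app (pmap_of (\<mu> \<cdot>\<^bsub>SH\<^esub> i) (f \<cdot>\<^bsub>SH\<^esub> i)) A x = Some z \<longleftrightarrow> app (pmap_of \<mu> f) A x = Some z" for A x z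
  proof -
    have "app (pmap_of (\<mu> \<cdot>\<^bsub>SH\<^esub> i) (f \<cdot>\<^bsub>SH\<^esub> i)) A x = Some z \<longleftrightarrow>
        (\<exists>y\<in>sec (src i) A. cmp \<mu> A (cmp i A y) = x \<and> cmp f A (cmp i A y) = z)"
      unfolding pmap_of_Some[OF \<mu>i] by simp
    also have "\<dots> \<longleftrightarrow> (\<exists>y\<in>sec (src \<mu>) A. cmp \<mu> A y = x \<and> cmp f A y = z)"
      using surj nat_cmp[OF ij(1), of _ A] i(2) by metis
    finally show ?thesis
      unfolding pmap_of_Some[OF \<mu>] .
  qed
qed simp_all

text \<open>Depends on a chosen representative; by \<open>pmap_of_iso\<close> the choice is
  immaterial on the classes that are arrows of \<open>Par\<close>.\<close>

definition pmap_of_class where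
  "pmap_of_class K = (case SOME s. s \<in> K of (\<mu>, f) \<Rightarrow> pmap_of \<mu> f)"

lemma pmap_of_class:
  assumes \<mu>: "\<mu> \<in> M_Sh U C M" and f: "f \<in> Arr SH" "src f = src \<mu>"
  shows "pmap_of_class (span_class SH (\<mu>, f)) = pmap_of \<mu> f"
proof -
  have "(\<mu>, f) \<in> span_class SH (\<mu>, f)"
    using M_Sh_imp(1)[OF \<mu>] f by (intro SH.span_class_self) simp_all
  then have "(SOME s. s \<in> span_class SH (\<mu>, f)) \<in> span_class SH (\<mu>, f)"
    by (rule someI)
  then obtain i where "is_iso SH i" "Cod SH i = Dom SH \<mu>"
      "(SOME s. s \<in> span_class SH (\<mu>, f)) = (\<mu> \<cdot>\<^bsub>SH\<^esub> i, f \<cdot>\<^bsub>SH\<^esub> i)"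
    by (rule SH.span_class_memE)
  then show ?thesis
    using pmap_of_iso[OF \<mu> f, of i] by (simp add: pmap_of_class_def)
qed

text \<open>Equal domains mean equal images of \<open>\<mu>\<close> and \<open>\<nu>\<close>, and
  hence an isomorphism \<open>i\<close> through which \<open>\<nu>\<close> is \<open>\<mu>\<close>.
  Comparing values and using injectivity of \<open>\<mu>\<close> shows that the same
  \<open>i\<close> carries \<open>f\<close> to \<open>g\<close>.\<close>

lemma pmap_of_inj:
  assumes \<mu>: "\<mu> \<in> M_Sh U C M" and f: "f \<in> Arr SH" "src f = src \<mu>"
    and \<nu>: "\<nu> \<in> M_Sh U C M" and g: "g \<in> Arr SH" "src g = src \<nu>"
    and eq: "pmap_of \<mu> f = pmap_of \<nu> g"
  shows "span_class SH (\<mu>, f) = span_class SH (\<nu>, g)"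
proof -
  note M = M_Sh_imp[OF \<mu>] and N = M_Sh_imp[OF \<nu>]
  have t: "tgt \<mu> = tgt \<nu>" "tgt f = tgt g"
    using arg_cong[OF eq, of psrc] arg_cong[OF eq, of ptgt] by simp_all
  have im: "image_of \<mu> A = image_of \<nu> A" for A
    unfolding pmap_of_dom[of _ f, symmetric] unfolding eq pmap_of_dom ..
  obtain i where i: "is_iso SH i" "src i = src \<nu>" "tgt i = src \<mu>" "\<nu> = \<mu> \<cdot>\<^bsub>SH\<^esub> i"
    using M_Sh_iso[OF \<mu> \<nu> t(1) im] .
  have iA: "is_nat_trans U C i"
    using SH.iso_Arr[OF i(1)] by simp
  have "g = f \<cdot>\<^bsub>SH\<^esub> i"
  proof (rule nat_trans_eqI[where U = U])
    fix A y assume y: "y \<in> sec (src g) A"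
    have "app (pmap_of \<nu> g) A (cmp \<nu> A y) = Some (cmp g A y)"
      unfolding pmap_of_Some[OF \<nu>] using y g(2) by auto
    then have "app (pmap_of \<mu> f) A (cmp \<nu> A y) = Some (cmp g A y)"
      using eq by simp
    then obtain z where z: "z \<in> sec (src \<mu>) A" "cmp \<mu> A z = cmp \<nu> A y" "cmp f A z = cmp g A y"
      unfolding pmap_of_Some[OF \<mu>] by blast
    have "cmp \<nu> A y = cmp \<mu> A (cmp i A y)"
      using i(2,4) y g(2) by simp
    moreover have "cmp i A y \<in> sec (src \<mu>) A"
      using nat_cmp[OF iA, of y A] i(2,3) y g(2) by simp
    ultimately have "z = cmp i A y"
      using M(2)[OF z(1)] z(2) by simp
    then show "cmp g A y = cmp (f \<cdot>\<^bsub>SH\<^esub> i) A y"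
      using z(3) y g(2) i(2) by simp
  qed (use g f i(2,3) iA t in \<open>auto intro!: PSh_comp_nat\<close>)
  then show ?thesis
    using SH.span_class_iso[OF M(1) f(1) _ i(1)] f(2) i(3,4) by simp
qed

text \<open>The span consists of the inclusion of the domain, which is an \<open>M\<close>-map
  because the domain is classified, and of the value map on it.\<close>

lemma pmap_of_surj:
  assumes "is_pmap \<phi>"
  obtains \<mu> f where "\<mu> \<in> M_Sh U C M" "f \<in> Arr SH" "src f = src \<mu>" "pmap_of \<mu> f = \<phi>"
proof -
  note D = is_pmapD[OF assms]
  let ?T = "\<lambda>A. dom (app \<phi> A)"
  let ?\<mu> = "incl (psrc \<phi>) ?T"
  let ?f = "nat_of (sub_presheaf C (psrc \<phi>) ?T) (ptgt \<phi>) (\<lambda>A x. the (app \<phi> A x))"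
  have sub: "?T A \<subseteq> sec (psrc \<phi>) A" for A
    using D(3) by blast
  have \<mu>: "?\<mu> \<in> M_Sh U C M"
    by (rule incl_M_Sh[OF D(1) D(6) sub])
  have sh: "is_sheaf U C J (sub_presheaf C (psrc \<phi>) ?T)"
    by (rule sub_presheaf_sheaf[OF D(1) D(6) sub])
  have "is_nat_trans U C ?f"
  proof (rule nat_of_nat_trans[OF sheaf_presheaf[OF sh] sheaf_presheaf[OF D(2)]])
    show "the (app \<phi> A x) \<in> sec (ptgt \<phi>) A" if "x \<in> sec (sub_presheaf C (psrc \<phi>) ?T) A" for A x
      using that D(4) by auto
    show "the (app \<phi> (Dom C g) (res (sub_presheaf C (psrc \<phi>) ?T) g x)) = res (ptgt \<phi>) g (the (app \<phi> (Cod C g) x))"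
      if "g \<in> Arr C" "x \<in> sec (sub_presheaf C (psrc \<phi>) ?T) (Cod C g)" for g x
    proof -
      have "x \<in> dom (app \<phi> (Cod C g))"
        using that(2) by simp
      then obtain y where "app \<phi> (Cod C g) x = Some y"
        by blast
      then show ?thesis
        using D(5)[OF that(1)] that by simp
    qed
  qed
  then have f: "?f \<in> Arr SH" "src ?f = src ?\<mu>"
    using sh D(2) by simp_all
  have "pmap_of ?\<mu> ?f = \<phi>"
  proof (rule pmap_eqI)
    fix A x z
    have "app (pmap_of ?\<mu> ?f) A x = Some z \<longleftrightarrow> (\<exists>y\<in>?T A. cmp ?\<mu> A y = x \<and> cmp ?f A y = z)"
      unfolding pmap_of_Some[OF \<mu>] by simp
    also have "\<dots> \<longleftrightarrow> (\<exists>y\<in>?T A. y = x \<and> the (app \<phi> A y) = z)"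
      by (intro bex_cong refl) simp
    also have "\<dots> \<longleftrightarrow> app \<phi> A x = Some z"
      by auto
    finally show "app (pmap_of ?\<mu> ?f) A x = Some z \<longleftrightarrow> app \<phi> A x = Some z" .
  qed simp_all
  then show thesis
    using that \<mu> f by blast
qed

text \<open>Sections of the pullback are pairs \<open>a\<close>, \<open>b\<close> with equal images
  under \<open>f\<close> and \<open>\<nu>\<close>. That common image is precisely an intermediate
  value in the composite of the partial functions.\<close>

lemma pmap_of_comp:
  assumes \<mu>: "\<mu> \<in> M_Sh U C M" and \<nu>: "\<nu> \<in> M_Sh U C M" and f: "src f = src \<mu>"
    and pb: "is_pullback SH f \<nu> n' f'" and \<mu>n: "\<mu> \<cdot>\<^bsub>SH\<^esub> n' \<in> M_Sh U C M"
  shows "pmap_of (\<mu> \<cdot>\<^bsub>SH\<^esub> n') (g \<cdot>\<^bsub>SH\<^esub> f') = pmap_of \<nu> g \<cdot>\<^bsub>PM\<^esub> pmap_of \<mu> f"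
proof (rule pmap_eqI)
  note D = SH.pullbackD[OF pb]
  have N: "is_nat_trans U C n'" "is_nat_trans U C f'" "src f' = src n'" "tgt n' = src f" "tgt f' = src \<nu>"
    using D(3,4,6-8) by simp_all
  fix A x z
  have "app (pmap_of (\<mu> \<cdot>\<^bsub>SH\<^esub> n') (g \<cdot>\<^bsub>SH\<^esub> f')) A x = Some z \<longleftrightarrow>
      (\<exists>e\<in>sec (src n') A. cmp \<mu> A (cmp n' A e) = x \<and> cmp g A (cmp f' A e) = z)"
    unfolding pmap_of_Some[OF \<mu>n] using N(3) by simp
  also have "\<dots> \<longleftrightarrow> (\<exists>a\<in>sec (src \<mu>) A. \<exists>b\<in>sec (src \<nu>) A. cmp \<mu> A a = x \<and> cmp \<nu> A b = cmp f A a \<and> cmp g A b = z)"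
  proof
    assume "\<exists>e\<in>sec (src n') A. cmp \<mu> A (cmp n' A e) = x \<and> cmp g A (cmp f' A e) = z"
    then obtain e where e: "e \<in> sec (src n') A" "cmp \<mu> A (cmp n' A e) = x" "cmp g A (cmp f' A e) = z"
      by blast
    show "\<exists>a\<in>sec (src \<mu>) A. \<exists>b\<in>sec (src \<nu>) A. cmp \<mu> A a = x \<and> cmp \<nu> A b = cmp f A a \<and> cmp g A b = z"
    proof (intro bexI conjI)
      show "cmp \<nu> A (cmp f' A e) = cmp f A (cmp n' A e)"
        using pullback_comm_elem[OF pb e(1)] by simp
      show "cmp f' A e \<in> sec (src \<nu>) A" "cmp n' A e \<in> sec (src \<mu>) A"
        using nat_cmp[OF N(2), of e A] nat_cmp[OF N(1) e(1)] N f e(1) by simp_all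
    qed (use e in simp_all)
  next
    assume "\<exists>a\<in>sec (src \<mu>) A. \<exists>b\<in>sec (src \<nu>) A. cmp \<mu> A a = x \<and> cmp \<nu> A b = cmp f A a \<and> cmp g A b = z"
    then obtain a b where ab: "a \<in> sec (src \<mu>) A" "b \<in> sec (src \<nu>) A" "cmp \<mu> A a = x"
      "cmp \<nu> A b = cmp f A a" "cmp g A b = z"
      by blast
    obtain e where "e \<in> sec (src n') A" "cmp n' A e = a" "cmp f' A e = b"
      using Sh_pullback_elem[OF pb, of a A b] ab f by auto
    then show "\<exists>e\<in>sec (src n') A. cmp \<mu> A (cmp n' A e) = x \<and> cmp g A (cmp f' A e) = z"
      using ab by (intro bexI[of _ e]) simp_all
  qed
  also have "\<dots> \<longleftrightarrow> app (pmap_of \<nu> g \<cdot>\<^bsub>PM\<^esub> pmap_of \<mu> f) A x = Some z"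
    unfolding PM_comp_Some pmap_of_Some[OF \<mu>] pmap_of_Some[OF \<nu>] by auto
  finally show "app (pmap_of (\<mu> \<cdot>\<^bsub>SH\<^esub> n') (g \<cdot>\<^bsub>SH\<^esub> f')) A x = Some z \<longleftrightarrow>
      app (pmap_of \<nu> g \<cdot>\<^bsub>PM\<^esub> pmap_of \<mu> f) A x = Some z" .
qed simp_all

lemma Par_Sh_join_restriction: "join_restriction_category U (Par SH (M_Sh U C M)) Par_rst"
proof (rule join_restriction_category_transfer[OF PM_join_restriction, where F = pmap_of_class])
  let ?P = "Par SH (M_Sh U C M)"
  have ArrE: "\<exists>\<mu> f. \<mu> \<in> M_Sh U C M \<and> f \<in> Arr SH \<and> src f = src \<mu> \<and> K = span_class SH (\<mu>, f)"
    if K: "K \<in> Arr ?P" for K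
    using K
  proof (rule ShM.Par_ArrE)
    fix \<mu> f assume "\<mu> \<in> M_Sh U C M" "f \<in> Arr SH" "Dom SH \<mu> = Dom SH f" "K = span_class SH (\<mu>, f)"
    moreover from this have "src f = src \<mu>"
      by simp
    ultimately show ?thesis
      by blast
  qed
  show "Obj ?P = Obj PM"
    by simp
  show "pmap_of_class K \<in> Arr PM \<and> Dom PM (pmap_of_class K) = Dom ?P K \<and> Cod PM (pmap_of_class K) = Cod ?P K"
    if K: "K \<in> Arr ?P" for K
  proof -
    obtain \<mu> f where s: "\<mu> \<in> M_Sh U C M" "f \<in> Arr SH" "src f = src \<mu>" "K = span_class SH (\<mu>, f)"
      using ArrE[OF K] by blast
    have "Dom ?P K = tgt \<mu>" "Cod ?P K = tgt f"
      using ShM.Par_Dom[OF s(1,2)] ShM.Par_Cod[OF s(1,2)] s(3,4) by simp_all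
    then show ?thesis
      using pmap_of_class[OF s(1-3)] pmap_of_pmap[OF s(1-3)] s(4) by simp
  qed
  show "inj_on pmap_of_class (Arr ?P)"
  proof (rule inj_onI)
    fix K L assume K: "K \<in> Arr ?P" and L: "L \<in> Arr ?P" and eq: "pmap_of_class K = pmap_of_class L"
    obtain \<mu> f where s: "\<mu> \<in> M_Sh U C M" "f \<in> Arr SH" "src f = src \<mu>" "K = span_class SH (\<mu>, f)"
      using ArrE[OF K] by blast
    obtain \<nu> g where t: "\<nu> \<in> M_Sh U C M" "g \<in> Arr SH" "src g = src \<nu>" "L = span_class SH (\<nu>, g)"
      using ArrE[OF L] by blast
    show "K = L"
      using pmap_of_inj[OF s(1-3) t(1-3)] eq pmap_of_class[OF s(1-3)] pmap_of_class[OF t(1-3)] s(4) t(4) by simp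
  qed
  show "\<exists>K\<in>Arr ?P. pmap_of_class K = \<phi>" if "\<phi> \<in> Arr PM" for \<phi>
  proof -
    have "is_pmap \<phi>"
      using that by simp
    then obtain \<mu> f where s: "\<mu> \<in> M_Sh U C M" "f \<in> Arr SH" "src f = src \<mu>" "pmap_of \<mu> f = \<phi>"
      by (rule pmap_of_surj)
    then have "span_class SH (\<mu>, f) \<in> Arr ?P"
      by (intro ShM.Par_ArrI) simp_all
    then show ?thesis
      using pmap_of_class[OF s(1-3)] s(4) by blast
  qed
  show "Ide ?P P \<in> Arr ?P \<and> pmap_of_class (Ide ?P P) = Ide PM P" if "P \<in> Obj ?P" for P
  proof -
    have P: "P \<in> Obj SH"
      using that by simp
    let ?I = "Ide SH P"
    have I: "?I \<in> M_Sh U C M" "?I \<in> Arr SH"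
      using ShM.Ide_M[OF P] SH.ide_Arr(1)[OF P] by blast+
    have "Ide ?P P = span_class SH (?I, ?I)"
      by (simp add: Par_def)
    moreover have "pmap_of ?I ?I = Ide PM P"
    proof (rule pmap_eqI)
      show "app (pmap_of ?I ?I) A x = Some z \<longleftrightarrow> app (Ide PM P) A x = Some z" for A x z
        unfolding pmap_of_Some[OF I(1)] PM_ide_Some by auto
    qed simp_all
    ultimately show ?thesis
      using pmap_of_class[OF I] ShM.Par_ArrI[OF I] by simp
  qed
  show "L \<cdot>\<^bsub>?P\<^esub> K \<in> Arr ?P \<and> pmap_of_class (L \<cdot>\<^bsub>?P\<^esub> K) = pmap_of_class L \<cdot>\<^bsub>PM\<^esub> pmap_of_class K"
    if K: "K \<in> Arr ?P" and L: "L \<in> Arr ?P" and KL: "Cod ?P K = Dom ?P L" for K L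
  proof -
    obtain \<mu> f where s: "\<mu> \<in> M_Sh U C M" "f \<in> Arr SH" "src f = src \<mu>" "K = span_class SH (\<mu>, f)"
      using ArrE[OF K] by blast
    obtain \<nu> g where t: "\<nu> \<in> M_Sh U C M" "g \<in> Arr SH" "src g = src \<nu>" "L = span_class SH (\<nu>, g)"
      using ArrE[OF L] by blast
    have fn: "Cod SH f = Cod SH \<nu>"
      using KL ShM.Par_Cod[OF s(1,2)] ShM.Par_Dom[OF t(1,2)] s(3,4) t(3,4) by simp
    obtain n' f' where pb: "n' \<in> M_Sh U C M" "is_pullback SH f \<nu> n' f'"
      using ShM.pullback_M[OF t(1) s(2) fn] by blast
    note D = SH.pullbackD[OF pb(2)]
    have \<mu>n: "\<mu> \<cdot>\<^bsub>SH\<^esub> n' \<in> M_Sh U C M"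
      using ShM.Comp_M[OF pb(1) s(1)] D(6) s(3) by simp
    have gf: "g \<cdot>\<^bsub>SH\<^esub> f' \<in> Arr SH"
      using SH.comp_Arr(1)[OF D(4) t(2)] D(8) t(3) by simp
    have d: "src (g \<cdot>\<^bsub>SH\<^esub> f') = src (\<mu> \<cdot>\<^bsub>SH\<^esub> n')"
      using D(7) by simp
    have "L \<cdot>\<^bsub>?P\<^esub> K = span_class SH (\<mu> \<cdot>\<^bsub>SH\<^esub> n', g \<cdot>\<^bsub>SH\<^esub> f')"
      using ShM.Par_Comp[OF s(1,2) _ t(1,2) _ pb(2)] s(3,4) t(3,4) by simp
    moreover have "span_class SH (\<mu> \<cdot>\<^bsub>SH\<^esub> n', g \<cdot>\<^bsub>SH\<^esub> f') \<in> Arr ?P"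
      using ShM.Par_ArrI[OF \<mu>n gf] d by simp
    moreover have "pmap_of (\<mu> \<cdot>\<^bsub>SH\<^esub> n') (g \<cdot>\<^bsub>SH\<^esub> f') = pmap_of \<nu> g \<cdot>\<^bsub>PM\<^esub> pmap_of \<mu> f"
      by (rule pmap_of_comp[OF s(1) t(1) s(3) pb(2) \<mu>n])
    ultimately show ?thesis
      using pmap_of_class[OF \<mu>n gf d] pmap_of_class[OF s(1-3)] pmap_of_class[OF t(1-3)] s(4) t(4)
      by (simp only: simp_thms)
  qed
  show "Par_rst K \<in> Arr ?P \<and> pmap_of_class (Par_rst K) = pmap_rst (pmap_of_class K)" if K: "K \<in> Arr ?P" for K
  proof -
    obtain \<mu> f where s: "\<mu> \<in> M_Sh U C M" "f \<in> Arr SH" "src f = src \<mu>" "K = span_class SH (\<mu>, f)"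
      using ArrE[OF K] by blast
    note \<mu>A = M_Sh_imp(1)[OF s(1)]
    have "pmap_of \<mu> \<mu> = pmap_rst (pmap_of \<mu> f)"
    proof (rule pmap_eqI)
      show "app (pmap_of \<mu> \<mu>) A x = Some z \<longleftrightarrow> app (pmap_rst (pmap_of \<mu> f)) A x = Some z" for A x z
        unfolding pmap_rst_Some pmap_of_Some[OF s(1)] by blast
    qed simp_all
    then show ?thesis
      unfolding s(4) ShM.Par_rst_span
      using pmap_of_class[OF s(1-3)] pmap_of_class[OF s(1) \<mu>A] ShM.Par_ArrI[OF s(1) \<mu>A] by simp
  qed
qed

end

theorem theorem20:
  fixes U :: "'v set set" and C :: "('o, 'v) cat" and M :: "'v set"
  assumes "set_universe U"
    and "small_category U C"
    and "geometric U C M"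
  shows "geometric U (Sh U C (M_topology C M)) (M_Sh U C M)"
proof -
  interpret sheaf_site U C M
    using assms by (simp add: sheaf_site_def sheaf_site_axioms_def geometric_M_category_def
        geometric_def small_category_def)
  show ?thesis
    unfolding geometric_def using ShM.M_category_axioms Par_Sh_join_restriction by blast
qed

end
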